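(* Let $M$ be a complete MV-algebra and $N$ a semisimple MV-algebra such that $\operatorname{Max}N$ is metrisable. For every probability map $p\colon M\to N$ there is a $C_{\mathbb{R}}(\operatorname{Max}N)$-valued regular vector measure $\vec{\mu}$ on the Borel sets of $\operatorname{Max}M$ such that \[ p(a)^{*}=\int_{\operatorname{Max}M} a^{*}\,\mathrm{d}\vec{\mu}\qquad\text{for all } a\in M. \]
   Context: For an MV-algebra $(M,\oplus,\neg,0)$: $1\coloneqq\neg 0$, $a\vee b\coloneqq\neg(\neg a\oplus b)\oplus b$, $a\wedge b\coloneqq\neg(\neg a\vee\neg b)$; $M$ is complete if its lattice order is complete. A probability map is a function $p\colon M\to N$ between MV-algebras such that for all $a,b\in M$: (P1) $p(a\oplus b)=p(a)\oplus p(b\wedge\neg a)$; (P2) $p(\neg a)=\neg p(a)$; (P3) $p(1)=1$. $\operatorname{Max}M$ is the compact Hausdorff space of maximal ideals of $M$; for $\mathfrak{m}\in\operatorname{Max}M$ let $h_{\mathfrak{m}}$ be the unique MV-isomorphism of $M/\mathfrak{m}$ onto a subalgebra of $[0,1]$, and $a^*(\mathfrak{m})\coloneqq h_{\mathfrak{m}}(a/\mathfrak{m})$, a continuous function. $N$ is semisimple if the intersection of its maximal ideals is $\{0\}$. For compact Hausdorff $X,Y$, a vector measure is a map $\vec\mu$ from the Borel sets of $X$ to the Banach space $C_{\mathbb{R}}(Y)$ (sup norm) that is countably additive with norm-convergent sums; it is regular if for every Borel $A$ and $\epsilon>0$ there are compact $K$ and open $O$ with $K\subseteq A\subseteq O$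 and semivariation $\|\vec\mu\|(O\setminus K)<\epsilon$, where $\|\vec\mu\|(E)=\sup\{|x^*\circ\vec\mu|(E): x^*\in C_{\mathbb{R}}(Y)^*,\ \|x^*\|\le 1\}$. The integral $\int_X a\,\mathrm{d}\vec\mu$ of $a\in C_{\mathbb{R}}(X)$ is defined as the limit of integrals of uniformly approximating simple functions (Bartle–Dunford–Schwartz integral). *)

theory Defs
  imports "HOL-Analysis.Analysis"
begin

record 'a mv_algebra =
  mv_carrier :: "'a set"
  mv_plus :: "'a \<Rightarrow> 'a \<Rightarrow> 'a"
  mv_neg :: "'a \<Rightarrow> 'a"
  mv_zero :: 'a

definition mv_one :: "('a, 'm) mv_algebra_scheme \<Rightarrow> 'a" where
  "mv_one M = mv_neg M (mv_zero M)"

definition mv_join :: "('a, 'm) mv_algebra_scheme \<Rightarrow> 'a \<Rightarrow> 'a \<Rightarrow> 'a" where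
  "mv_join M a b = mv_plus M (mv_neg M (mv_plus M (mv_neg M a) b)) b"

definition mv_meet :: "('a, 'm) mv_algebra_scheme \<Rightarrow> 'a \<Rightarrow> 'a \<Rightarrow> 'a" where
  "mv_meet M a b = mv_neg M (mv_join M (mv_neg M a) (mv_neg M b))"

definition mv_algebra :: "('a, 'm) mv_algebra_scheme \<Rightarrow> bool" where
  "mv_algebra M \<longleftrightarrow>
     mv_zero M \<in> mv_carrier M \<and>
     (\<forall>x\<in>mv_carrier M. \<forall>y\<in>mv_carrier M. mv_plus M x y \<in> mv_carrier M) \<and>
     (\<forall>x\<in>mv_carrier M. mv_neg M x \<in> mv_carrier M) \<and>
     (\<forall>x\<in>mv_carrier M. \<forall>y\<in>mv_carrier M. \<forall>z\<in>mv_carrier M.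
        mv_plus M x (mv_plus M y z) = mv_plus M (mv_plus M x y) z) \<and>
     (\<forall>x\<in>mv_carrier M. \<forall>y\<in>mv_carrier M. mv_plus M x y = mv_plus M y x) \<and>
     (\<forall>x\<in>mv_carrier M. mv_plus M x (mv_zero M) = x) \<and>
     (\<forall>x\<in>mv_carrier M. mv_neg M (mv_neg M x) = x) \<and>
     (\<forall>x\<in>mv_carrier M. mv_plus M x (mv_one M) = mv_one M) \<and>
     (\<forall>x\<in>mv_carrier M. \<forall>y\<in>mv_carrier M.
        mv_plus M (mv_neg M (mv_plus M (mv_neg M x) y)) y =
        mv_plus M (mv_neg M (mv_plus M (mv_neg M y) x)) x)"

definition mv_le :: "('a, 'm) mv_algebra_scheme \<Rightarrow> 'a \<Rightarrow> 'a \<Rightarrow> bool" where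
  "mv_le M a b \<longleftrightarrow> mv_plus M (mv_neg M a) b = mv_one M"

definition mv_complete :: "('a, 'm) mv_algebra_scheme \<Rightarrow> bool" where
  "mv_complete M \<longleftrightarrow>
     (\<forall>S\<subseteq>mv_carrier M. \<exists>s\<in>mv_carrier M.
        (\<forall>x\<in>S. mv_le M x s) \<and>
        (\<forall>u\<in>mv_carrier M. (\<forall>x\<in>S. mv_le M x u) \<longrightarrow> mv_le M s u))"

definition mv_ideal :: "('a, 'm) mv_algebra_scheme \<Rightarrow> 'a set \<Rightarrow> bool" where
  "mv_ideal M I \<longleftrightarrow> I \<subseteq> mv_carrier M \<and> mv_zero M \<in> I \<and>
     (\<forall>a\<in>I. \<forall>b\<in>I. mv_plus M a b \<in> I) \<and>
     (\<forall>a\<in>I. \<forall>b\<in>mv_carrier M. mv_le M b a \<longrightarrow> b \<in> I)"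

definition mv_maximal_ideal :: "('a, 'm) mv_algebra_scheme \<Rightarrow> 'a set \<Rightarrow> bool" where
  "mv_maximal_ideal M I \<longleftrightarrow> mv_ideal M I \<and> I \<noteq> mv_carrier M \<and>
     (\<forall>J. mv_ideal M J \<and> I \<subseteq> J \<longrightarrow> J = I \<or> J = mv_carrier M)"

definition MaxSp :: "('a, 'm) mv_algebra_scheme \<Rightarrow> 'a set set" where
  "MaxSp M = {I. mv_maximal_ideal M I}"

definition mv_semisimple :: "('a, 'm) mv_algebra_scheme \<Rightarrow> bool" where
  "mv_semisimple M \<longleftrightarrow> mv_carrier M \<inter> \<Inter>(MaxSp M) = {mv_zero M}"

definition MaxTop :: "('a, 'm) mv_algebra_scheme \<Rightarrow> 'a set topology" where
  "MaxTop M = topology_generated_by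
     ((\<lambda>a. {m \<in> MaxSp M. a \<notin> m}) ` mv_carrier M)"

definition unit_mv :: "real mv_algebra" where
  "unit_mv = \<lparr>mv_carrier = {0..1}, mv_plus = (\<lambda>x y. min 1 (x + y)),
              mv_neg = (\<lambda>x. 1 - x), mv_zero = 0\<rparr>"

definition mv_hom :: "('a, 'm) mv_algebra_scheme \<Rightarrow> ('b, 'n) mv_algebra_scheme \<Rightarrow> ('a \<Rightarrow> 'b) \<Rightarrow> bool" where
  "mv_hom M N h \<longleftrightarrow> h \<in> mv_carrier M \<rightarrow> mv_carrier N \<and>
     (\<forall>x\<in>mv_carrier M. \<forall>y\<in>mv_carrier M. h (mv_plus M x y) = mv_plus N (h x) (h y)) \<and>
     (\<forall>x\<in>mv_carrier M. h (mv_neg M x) = mv_neg N (h x)) \<and>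
     h (mv_zero M) = mv_zero N"

text \<open>\<open>a\<^sup>*(m) = h\<^sub>m(a/m)\<close>, where \<open>h\<^sub>m\<close> is the unique embedding of \<open>M/m\<close> into \<open>[0,1]\<close>.
  Composing with the quotient map, \<open>h\<^sub>m \<circ> \<pi>\<^sub>m\<close> is the (unique) MV-homomorphism
  \<open>M \<rightarrow> [0,1]\<close> whose kernel is \<open>m\<close>.\<close>
definition mv_star :: "('a, 'm) mv_algebra_scheme \<Rightarrow> 'a \<Rightarrow> 'a set \<Rightarrow> real" where
  "mv_star M a m = (THE r. \<exists>h. mv_hom M unit_mv h \<and>
       {x \<in> mv_carrier M. h x = 0} = m \<and> h a = r)"

definition probability_map :: "('a, 'm) mv_algebra_scheme \<Rightarrow> ('b, 'n) mv_algebra_scheme \<Rightarrow> ('a \<Rightarrow> 'b) \<Rightarrow> bool" where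
  "probability_map M N p \<longleftrightarrow> p \<in> mv_carrier M \<rightarrow> mv_carrier N \<and>
     (\<forall>a\<in>mv_carrier M. \<forall>b\<in>mv_carrier M.
        p (mv_plus M a b) = mv_plus N (p a) (p (mv_meet M b (mv_neg M a)))) \<and>
     (\<forall>a\<in>mv_carrier M. p (mv_neg M a) = mv_neg N (p a)) \<and>
     p (mv_one M) = mv_one N"

definition borel_sets :: "'x topology \<Rightarrow> 'x set set" where
  "borel_sets X = sigma_sets (topspace X) {U. openin X U}"

text \<open>Elements of \<open>C\<^sub>\<real>(Y)\<close> are represented by functions continuous on \<open>Y\<close>
  (only their values on \<open>topspace Y\<close> matter). Norm convergence is uniform convergence
  on \<open>topspace Y\<close>.\<close>
definition unif_conv :: "'y topology \<Rightarrow> (nat \<Rightarrow> 'y \<Rightarrow> real) \<Rightarrow> ('y \<Rightarrow> real) \<Rightarrow> bool" where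
  "unif_conv Y F f \<longleftrightarrow>
     (\<forall>\<epsilon>>0. \<exists>n0. \<forall>n\<ge>n0. \<forall>y\<in>topspace Y. \<bar>F n y - f y\<bar> \<le> \<epsilon>)"

definition vector_measure :: "'x topology \<Rightarrow> 'y topology \<Rightarrow> ('x set \<Rightarrow> 'y \<Rightarrow> real) \<Rightarrow> bool" where
  "vector_measure X Y \<mu> \<longleftrightarrow>
     (\<forall>A\<in>borel_sets X. continuous_map Y euclideanreal (\<mu> A)) \<and>
     (\<forall>A :: nat \<Rightarrow> 'x set. range A \<subseteq> borel_sets X \<longrightarrow> disjoint_family A \<longrightarrow>
        unif_conv Y (\<lambda>n y. \<Sum>k<n. \<mu> (A k) y) (\<mu> (\<Union>n. A n)))"

definition dual_unit_ball :: "'y topology \<Rightarrow> (('y \<Rightarrow> real) \<Rightarrow> real) set" where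
  "dual_unit_ball Y = {\<phi>.
     (\<forall>f g. continuous_map Y euclideanreal f \<longrightarrow> continuous_map Y euclideanreal g \<longrightarrow>
        \<phi> (\<lambda>y. f y + g y) = \<phi> f + \<phi> g) \<and>
     (\<forall>c f. continuous_map Y euclideanreal f \<longrightarrow> \<phi> (\<lambda>y. c * f y) = c * \<phi> f) \<and>
     (\<forall>f c. continuous_map Y euclideanreal f \<longrightarrow> c \<ge> 0 \<longrightarrow>
        (\<forall>y\<in>topspace Y. \<bar>f y\<bar> \<le> c) \<longrightarrow> \<bar>\<phi> f\<bar> \<le> c)}"

definition borel_partitions :: "'x topology \<Rightarrow> 'x set \<Rightarrow> 'x set set set" where
  "borel_partitions X E = {P. finite P \<and> P \<subseteq> borel_sets X \<and> disjoint P \<and> \<Union>P = E}"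

definition scalar_variation ::
  "'x topology \<Rightarrow> (('y \<Rightarrow> real) \<Rightarrow> real) \<Rightarrow> ('x set \<Rightarrow> 'y \<Rightarrow> real) \<Rightarrow> 'x set \<Rightarrow> ereal" where
  "scalar_variation X \<phi> \<mu> E =
     (SUP P\<in>borel_partitions X E. ereal (\<Sum>B\<in>P. \<bar>\<phi> (\<mu> B)\<bar>))"

definition semivariation ::
  "'x topology \<Rightarrow> 'y topology \<Rightarrow> ('x set \<Rightarrow> 'y \<Rightarrow> real) \<Rightarrow> 'x set \<Rightarrow> ereal" where
  "semivariation X Y \<mu> E = (SUP \<phi>\<in>dual_unit_ball Y. scalar_variation X \<phi> \<mu> E)"

definition regular_vector_measure ::
  "'x topology \<Rightarrow> 'y topology \<Rightarrow> ('x set \<Rightarrow> 'y \<Rightarrow> real) \<Rightarrow> bool" where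
  "regular_vector_measure X Y \<mu> \<longleftrightarrow> vector_measure X Y \<mu> \<and>
     (\<forall>A\<in>borel_sets X. \<forall>\<epsilon>>0. \<exists>K U. compactin X K \<and> openin X U \<and> K \<subseteq> A \<and> A \<subseteq> U \<and>
        semivariation X Y \<mu> (U - K) < ereal \<epsilon>)"

text \<open>A simple function is given by a finite list of pairs \<open>(c\<^sub>i, B\<^sub>i)\<close> with pairwise
  disjoint Borel sets \<open>B\<^sub>i\<close>; it denotes \<open>\<Sum>\<^sub>i c\<^sub>i \<chi>\<^bsub>B\<^sub>i\<^esub>\<close> and its integral is
  \<open>\<Sum>\<^sub>i c\<^sub>i \<mu>(B\<^sub>i)\<close>.\<close>
definition simple_repr :: "'x topology \<Rightarrow> (real \<times> 'x set) list \<Rightarrow> bool" where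
  "simple_repr X s \<longleftrightarrow> (\<forall>i<length s. snd (s ! i) \<in> borel_sets X) \<and>
     (\<forall>i<length s. \<forall>j<length s. i \<noteq> j \<longrightarrow> snd (s ! i) \<inter> snd (s ! j) = {})"

definition simple_fun :: "(real \<times> 'x set) list \<Rightarrow> 'x \<Rightarrow> real" where
  "simple_fun s x = (\<Sum>i<length s. fst (s ! i) * indicator (snd (s ! i)) x)"

definition simple_integral :: "('x set \<Rightarrow> 'y \<Rightarrow> real) \<Rightarrow> (real \<times> 'x set) list \<Rightarrow> 'y \<Rightarrow> real" where
  "simple_integral \<mu> s y = (\<Sum>i<length s. fst (s ! i) * \<mu> (snd (s ! i)) y)"

definition vm_has_integral ::
  "'x topology \<Rightarrow> 'y topology \<Rightarrow> ('x set \<Rightarrow> 'y \<Rightarrow> real) \<Rightarrow> ('x \<Rightarrow> real) \<Rightarrow> ('y \<Rightarrow> real) \<Rightarrow> bool" where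
  "vm_has_integral X Y \<mu> f I \<longleftrightarrow>
     (\<exists>s. (\<forall>n. simple_repr X (s n)) \<and> unif_conv X (\<lambda>n. simple_fun (s n)) f) \<and>
     (\<forall>s. (\<forall>n. simple_repr X (s n)) \<longrightarrow> unif_conv X (\<lambda>n. simple_fun (s n)) f \<longrightarrow>
        unif_conv Y (\<lambda>n. simple_integral \<mu> (s n)) I)"

end

theory Submission
  imports Defs
begin

text \<open>
  Evaluating \<open>p(a)\<^sup>*\<close> at \<open>y \<in> Max N\<close> gives an additive \<open>[0,1]\<close>-valued state \<open>s\<^sub>y\<close> on \<open>M\<close>. Since \<open>M\<close> is
  complete, \<open>Max M\<close> has a clopen base given by the Boolean elements of \<open>M\<close>, the restriction of \<open>s\<^sub>y\<close>
  to these extends to a Borel measure \<open>\<mu>\<^sub>y\<close>, and \<open>\<mu>(A)(y) = \<mu>\<^sub>y(A)\<close> is the vector measure. Binary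
  expansions of the elements of \<open>M\<close> into Boolean elements give the integral formula.

  The point is the continuity of \<open>y \<mapsto> \<mu>\<^sub>y(A)\<close>, a positive case of Grothendieck's theorem on
  weakly compact operators. For disjoint Boolean \<open>e\<^sub>k\<close> the numbers \<open>s\<^sub>y(e\<^sub>k)\<close> cannot stay above some
  \<open>\<epsilon> > 0\<close> at points \<open>y\<^sub>k\<close>: along a convergent subsequence, the suprema of infinitely many disjoint
  infinite subfamilies would all have value at least \<open>\<epsilon>\<close> at the limit point. Hence every open set is
  approximated from inside by clopen sets uniformly in \<open>y\<close>, all Borel sets are uniformly regular, and
  \<open>y \<mapsto> \<mu>\<^sub>y(A)\<close> is a uniform limit of continuous functions. Positivity bounds the semivariation of a
  set by the supremum of its measures.
\<close>

section \<open>Borel measures from contents on a clopen base\<close>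

text \<open>A state need not respect infinite suprema, so \<open>M\<close> hands down no countable
  additivity. For a single \<open>y\<close> it comes from compactness of clopen sets; uniformly in
  \<open>y\<close> it comes from the fact that disjoint Boolean elements have disjoint Boolean
  envelopes, to which finite additivity still applies. Completeness is used only to form these
  envelopes, metrisability of \<open>Max N\<close> to extract a convergent sequence of points and to
  have a Hausdorff space.

  The function \<open>mv_star\<close> is a definite description, so existence and uniqueness of the
  embedding of \<open>M/m\<close> into the unit interval have to be proved. This is Hoelder's
  argument: count how many copies of a small unit are needed to cover an element, divide by the
  count for \<open>1\<close>, and let the unit shrink. Rounding makes the quotients additive only up
  to an error \<eta>. One estimate, that two such approximate states differ by at most
  \<open>6 * \<eta>\<close>, gives both convergence of the quotients and uniqueness of the limit.

  The binary expansion is formulated for arbitrary states. Evaluation at a point of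
  \<open>Max M\<close> and the functional attached to \<open>y\<close> are both states, so the same
  digits approximate the integrand and the integral.\<close>

locale clopen_base =
  fixes X :: "'x topology" and \<A> :: "'x set set"
  assumes compact: "compact_space X"
    and algebra: "algebra (topspace X) \<A>"
    and open_member: "a \<in> \<A> \<Longrightarrow> openin X a"
    and base: "openin X U \<Longrightarrow> x \<in> U \<Longrightarrow> \<exists>a\<in>\<A>. x \<in> a \<and> a \<subseteq> U"
begin

sublocale algebra "topspace X" \<A> by (rule algebra)

lemma closed_member: "a \<in> \<A> \<Longrightarrow> closedin X a"
  using open_member[OF compl_sets, of a] sets_into_space[of a] by (simp add: closedin_def)

lemma open_diff_member: "openin X U \<Longrightarrow> a \<in> \<A> \<Longrightarrow> openin X (U - a)"
  using closed_member by (simp add: openin_diff)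

text \<open>Members are compact, so finitely many basic sets, each inside some \<open>U n\<close>,
  cover \<open>a\<close>; grouping them by the index of a \<open>U n\<close> that contains them
  gives the \<open>b n\<close>. This replaces countable additivity of a content and later truncates
  countable unions.\<close>

lemma countable_cover_member:
  assumes a: "a \<in> \<A>" "a \<subseteq> (\<Union>n. U n)" and U: "\<And>n::nat. openin X (U n)"
  obtains N b where "\<And>n. b n \<in> \<A>" "\<And>n. b n \<subseteq> U n" "a \<subseteq> (\<Union>n<N. b n)"
proof -
  define F where "F = {c \<in> \<A>. \<exists>n. c \<subseteq> U n}"
  have "compactin X a" using closed_member[OF a(1)] compact by (blast intro: closedin_compact_space)
  moreover have "a \<subseteq> \<Union>F"
  proof
    fix x assume "x \<in> a"
    then obtain n where "x \<in> U n" using a(2) by blast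
    then show "x \<in> \<Union>F" using base[OF U[of n]] unfolding F_def by blast
  qed
  moreover have "\<forall>c\<in>F. openin X c" using open_member by (simp add: F_def)
  ultimately obtain F' where F': "finite F'" "F' \<subseteq> F" "a \<subseteq> \<Union>F'"
    unfolding compactin_def by meson
  then have "\<forall>c\<in>F'. \<exists>n. c \<subseteq> U n" by (auto simp: F_def)
  then obtain i where i: "\<And>c. c \<in> F' \<Longrightarrow> c \<subseteq> U (i c)" by metis
  define b where "b n = \<Union>{c \<in> F'. i c = n}" for n
  have "b n \<in> \<A>" for n
    unfolding b_def using F' by (intro finite_Union) (auto simp: F_def)
  moreover have "b n \<subseteq> U n" for n using i by (auto simp: b_def)
  \<comment> \<open>If \<open>F'\<close> is empty the maximum is unspecified, but then
    \<open>a\<close> is empty too.\<close>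
  moreover have "a \<subseteq> (\<Union>n<Suc (Max (i ` F')). b n)"
    using F' by (fastforce simp: b_def less_Suc_eq_le)
  ultimately show ?thesis by (rule that)
qed

end

text \<open>Only finite additivity is required, since that is all a state provides.\<close>

locale clopen_content = clopen_base +
  fixes \<nu> :: "'a set \<Rightarrow> real"
  assumes nonneg: "a \<in> \<A> \<Longrightarrow> 0 \<le> \<nu> a"
    and add: "a \<in> \<A> \<Longrightarrow> b \<in> \<A> \<Longrightarrow> a \<inter> b = {} \<Longrightarrow> \<nu> (a \<union> b) = \<nu> a + \<nu> b"
begin

lemma \<nu>_empty: "\<nu> {} = 0"
  using add[of "{}" "{}"] by simp

lemma \<nu>_mono: assumes "a \<in> \<A>" "b \<in> \<A>" "a \<subseteq> b" shows "\<nu> a \<le> \<nu> b"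
proof -
  have "a \<union> (b - a) = b" using assms by auto
  then show ?thesis using add[of a "b - a"] nonneg[of "b - a"] assms Diff[of b a] by simp
qed

lemma \<nu>_subadd: assumes "a \<in> \<A>" "b \<in> \<A>" shows "\<nu> (a \<union> b) \<le> \<nu> a + \<nu> b"
proof -
  have "a \<union> (b - a) = a \<union> b" by auto
  then show ?thesis using add[of a "b - a"] \<nu>_mono[of "b - a" b] assms Diff[of b a] by auto
qed

lemma \<nu>_UN_le: assumes "\<And>n::nat. b n \<in> \<A>" shows "\<nu> (\<Union>n<N. b n) \<le> (\<Sum>n<N. \<nu> (b n))"
proof (induction N)
  case (Suc N)
  have "(\<Union>n<Suc N. b n) = (\<Union>n<N. b n) \<union> b N" by (auto simp: less_Suc_eq)
  moreover have "(\<Union>n<N. b n) \<in> \<A>" using assms by auto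
  ultimately show ?case using \<nu>_subadd[of "\<Union>n<N. b n" "b N"] assms Suc by simp
qed (simp add: \<nu>_empty)

section \<open>Inner content of open sets and the outer measure it induces\<close>

definition inner :: "'a set \<Rightarrow> ennreal" where
  "inner U = (SUP a\<in>{a \<in> \<A>. a \<subseteq> U}. ennreal (\<nu> a))"

definition outer :: "'a set \<Rightarrow> ennreal" where
  "outer E = (INF U\<in>{U. openin X U \<and> E \<subseteq> U}. inner U)"

lemma inner_upper: "a \<in> \<A> \<Longrightarrow> a \<subseteq> U \<Longrightarrow> ennreal (\<nu> a) \<le> inner U"
  unfolding inner_def by (rule SUP_upper) simp

lemma inner_least: "(\<And>a. a \<in> \<A> \<Longrightarrow> a \<subseteq> U \<Longrightarrow> ennreal (\<nu> a) \<le> c) \<Longrightarrow> inner U \<le> c"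
  unfolding inner_def by (rule SUP_least) simp

lemma inner_member: "a \<in> \<A> \<Longrightarrow> inner a = ennreal (\<nu> a)"
  using \<nu>_mono by (intro antisym inner_least inner_upper) (auto simp: ennreal_leI)

lemma inner_mono: "U \<subseteq> V \<Longrightarrow> inner U \<le> inner V"
  by (rule inner_least) (auto intro: inner_upper)

lemma outer_lower: "openin X U \<Longrightarrow> E \<subseteq> U \<Longrightarrow> outer E \<le> inner U"
  unfolding outer_def by (rule INF_lower) simp

lemma outer_greatest: "(\<And>U. openin X U \<Longrightarrow> E \<subseteq> U \<Longrightarrow> c \<le> inner U) \<Longrightarrow> c \<le> outer E"
  unfolding outer_def by (rule INF_greatest) simp

lemma outer_open: "openin X U \<Longrightarrow> outer U = inner U"
  by (intro antisym outer_lower outer_greatest inner_mono) auto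

lemma outer_mono: "E \<subseteq> F \<Longrightarrow> outer E \<le> outer F"
  by (rule outer_greatest) (auto intro: outer_lower)

lemma outer_empty: "outer {} = 0"
  using inner_member[of "{}"] by (simp add: outer_open \<nu>_empty)

text \<open>A member inside the union is compact, hence already covered by finitely many members of
  the separate \<open>U n\<close>, where finite subadditivity of the content suffices.\<close>

lemma inner_countable_subadd:
  assumes U: "\<And>n::nat. openin X (U n)" shows "inner (\<Union>n. U n) \<le> (\<Sum>n. inner (U n))"
proof (rule inner_least)
  fix a assume "a \<in> \<A>" "a \<subseteq> (\<Union>n. U n)"
  with countable_cover_member[OF this U] obtain N b where
    a: "a \<in> \<A>" and b: "\<And>n. b n \<in> \<A>" "\<And>n. b n \<subseteq> U n" "a \<subseteq> (\<Union>n<N. b n)"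
    by metis
  have "\<nu> a \<le> \<nu> (\<Union>n<N. b n)" using a b by (intro \<nu>_mono) auto
  also have "\<dots> \<le> (\<Sum>n<N. \<nu> (b n))" by (rule \<nu>_UN_le[OF b(1)])
  finally have "ennreal (\<nu> a) \<le> ennreal (\<Sum>n<N. \<nu> (b n))" by (rule ennreal_leI)
  also have "\<dots> = (\<Sum>n<N. ennreal (\<nu> (b n)))" using nonneg b by (simp add: sum_ennreal)
  also have "\<dots> \<le> (\<Sum>n<N. inner (U n))" using b by (intro sum_mono inner_upper)
  also have "\<dots> \<le> (\<Sum>n. inner (U n))" by (intro sum_le_suminf) auto
  finally show "ennreal (\<nu> a) \<le> (\<Sum>n. inner (U n))" .
qed

lemma outer_countable_subadd: "outer (\<Union>n. E n) \<le> (\<Sum>n. outer (E n))"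
proof (rule ennreal_le_epsilon)
  fix e :: real assume e: "0 < e" and fin: "(\<Sum>n. outer (E n)) < top"
  have "\<exists>U. openin X U \<and> E n \<subseteq> U \<and> inner U < outer (E n) + e * (1/2) ^ Suc n" for n
  proof -
    \<comment> \<open>The strict inequality needs \<open>outer (E n)\<close> to be finite, which
      follows from the finite sum.\<close>
    have "outer (E n) < outer (E n) + e * (1/2) ^ Suc n"
      using e fin by (auto simp: less_top dest!: ennreal_suminf_lessD)
    then show ?thesis unfolding outer_def[of "E n"] INF_less_iff by blast
  qed
  then obtain U where U: "\<And>n. openin X (U n)" "\<And>n. E n \<subseteq> U n"
      "\<And>n. inner (U n) < outer (E n) + e * (1/2) ^ Suc n"
    by metis
  have "outer (\<Union>n. E n) \<le> inner (\<Union>n. U n)"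
    using U by (intro outer_lower openin_Union) auto
  also have "\<dots> \<le> (\<Sum>n. inner (U n))" by (rule inner_countable_subadd[OF U(1)])
  also have "\<dots> \<le> (\<Sum>n. outer (E n) + e * (1/2) ^ Suc n)"
    using U by (intro suminf_le) (auto intro: less_imp_le)
  also have "\<dots> = (\<Sum>n. outer (E n)) + (\<Sum>n. ennreal e * ennreal ((1/2) ^ Suc n))"
    using e by (subst suminf_add[symmetric])
      (auto simp del: ennreal_suminf_cmult simp add: ennreal_mult[symmetric])
  also have "\<dots> = (\<Sum>n. outer (E n)) + e"
    unfolding ennreal_suminf_cmult
    by (subst suminf_ennreal_eq[OF zero_le_power power_half_series]) auto
  finally show "outer (\<Union>n. E n) \<le> (\<Sum>n. outer (E n)) + e" .
qed

text \<open>Exhaust \<open>U \<inter> V\<close> by members \<open>a\<close>. Since \<open>a\<close>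
  is closed, \<open>V - a\<close> is an open superset of \<open>V - U\<close>, and a member inside
  it is disjoint from \<open>a\<close>, so the two contents add up inside \<open>V\<close>. Taking
  the supremum over \<open>a\<close> gives the Caratheodory condition for open test sets.\<close>

lemma inner_split:
  assumes "openin X U" "openin X V" shows "outer (U \<inter> V) + outer (V - U) \<le> inner V"
proof -
  have "ennreal (\<nu> a) + outer (V - U) \<le> inner V" if a: "a \<in> \<A>" "a \<subseteq> U \<inter> V" for a
  proof -
    have "outer (V - U) \<le> inner (V - a)"
      using a assms by (intro outer_lower open_diff_member) auto
    then have "ennreal (\<nu> a) + outer (V - U) \<le> ennreal (\<nu> a) + inner (V - a)"
      by (rule add_left_mono)
    also have "\<dots> = (SUP b\<in>{b \<in> \<A>. b \<subseteq> V - a}. ennreal (\<nu> a) + ennreal (\<nu> b))"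
      unfolding inner_def by (rule ennreal_SUP_add_right) auto
    also have "\<dots> \<le> inner V"
    proof (rule SUP_least)
      fix b assume "b \<in> {b \<in> \<A>. b \<subseteq> V - a}"
      then have b: "b \<in> \<A>" "b \<subseteq> V - a" by auto
      then have "\<nu> a + \<nu> b = \<nu> (a \<union> b)" using a by (intro add[symmetric]) auto
      then have "ennreal (\<nu> a) + ennreal (\<nu> b) = ennreal (\<nu> (a \<union> b))"
        using a b nonneg by (simp flip: ennreal_plus)
      also have "\<dots> \<le> inner V" using a b by (intro inner_upper) auto
      finally show "ennreal (\<nu> a) + ennreal (\<nu> b) \<le> inner V" .
    qed
    finally show ?thesis .
  qed
  then have "(SUP a\<in>{a \<in> \<A>. a \<subseteq> U \<inter> V}. ennreal (\<nu> a) + outer (V - U)) \<le> inner V"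
    by (intro SUP_least) simp
  moreover have "(SUP a\<in>{a \<in> \<A>. a \<subseteq> U \<inter> V}. ennreal (\<nu> a) + outer (V - U))
      = inner (U \<inter> V) + outer (V - U)"
    unfolding inner_def by (rule ennreal_SUP_add_left) auto
  ultimately show ?thesis using assms by (simp add: outer_open openin_Int)
qed

lemma outer_measure_space_outer: "outer_measure_space (Pow (topspace X)) outer"
  unfolding outer_measure_space_def positive_def increasing_def countably_subadditive_def
  by (auto simp: outer_empty outer_mono outer_countable_subadd)

text \<open>An arbitrary test set \<open>E\<close> reduces to an open superset \<open>V\<close>,
  because \<open>outer E\<close> is an infimum over such \<open>V\<close>; there
  \<open>inner_split\<close> applies.\<close>

lemma open_in_lambda_system:
  assumes U: "openin X U" shows "U \<in> lambda_system (topspace X) (Pow (topspace X)) outer"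
proof -
  interpret P: sigma_algebra "topspace X" "Pow (topspace X)" by (rule sigma_algebra_Pow)
  have sub: "subadditive (Pow (topspace X)) outer"
    using outer_measure_space_outer unfolding outer_measure_space_def
    by (intro P.countably_subadditive_subadditive) auto
  have US: "U \<subseteq> topspace X" using U by (rule openin_subset)
  have "outer (U \<inter> E) + outer ((topspace X - U) \<inter> E) = outer E" if E: "E \<subseteq> topspace X" for E
  proof (rule antisym)
    show "outer (U \<inter> E) + outer ((topspace X - U) \<inter> E) \<le> outer E"
    proof (rule outer_greatest)
      fix V assume V: "openin X V" "E \<subseteq> V"
      have "outer (U \<inter> E) + outer ((topspace X - U) \<inter> E) \<le> outer (U \<inter> V) + outer (V - U)"
        using V by (intro add_mono outer_mono) auto
      also have "\<dots> \<le> inner V" using inner_split[OF U V(1)] .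
      finally show "outer (U \<inter> E) + outer ((topspace X - U) \<inter> E) \<le> inner V" .
    qed
    have "E = U \<inter> E \<union> (topspace X - U) \<inter> E" using E by auto
    then show "outer E \<le> outer (U \<inter> E) + outer ((topspace X - U) \<inter> E)"
      using subadditiveD[OF sub, of "U \<inter> E" "(topspace X - U) \<inter> E"] E by auto
  qed
  then show ?thesis using US by (auto simp: lambda_system_def)
qed

definition extension :: "'a measure" where
  "extension = measure_of (topspace X) {U. openin X U} outer"

lemma sets_extension: "sets extension = borel_sets X"
  unfolding extension_def borel_sets_def by (rule sets_measure_of) (auto dest: openin_subset)

lemma space_extension: "space extension = topspace X"
  unfolding extension_def by (rule space_measure_of) (auto dest: openin_subset)

lemma emeasure_extension_open:
  assumes U: "openin X U" shows "emeasure extension U = inner U"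
proof -
  interpret P: sigma_algebra "topspace X" "Pow (topspace X)" by (rule sigma_algebra_Pow)
  have ms: "measure_space (topspace X) (lambda_system (topspace X) (Pow (topspace X)) outer) outer"
    by (rule P.caratheodory_lemma[OF outer_measure_space_outer])
  then have sa: "sigma_algebra (topspace X) (lambda_system (topspace X) (Pow (topspace X)) outer)"
    by (simp add: measure_space_def)
  have "measure_space (topspace X) (sigma_sets (topspace X) {U. openin X U}) outer"
    using open_in_lambda_system
    by (intro measure_down[OF ms] sigma_algebra_sigma_sets sigma_algebra.sigma_sets_subset[OF sa])
      (auto dest: openin_subset)
  then have "positive (sets extension) outer" "countably_additive (sets extension) outer"
    by (auto simp: measure_space_def sets_extension borel_sets_def)
  then have "emeasure extension U = outer U"
    using U by (intro emeasure_measure_of[OF extension_def])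
      (auto simp: sets_extension borel_sets_def dest: openin_subset)
  then show ?thesis using U by (simp add: outer_open)
qed

lemma emeasure_extension_member: "a \<in> \<A> \<Longrightarrow> emeasure extension a = ennreal (\<nu> a)"
  using emeasure_extension_open[OF open_member] inner_member by simp

text \<open>Inner regularity by clopen sets. This is the form in which the next locale uses the
  construction, and it transports statements about Boolean elements to open sets.\<close>

lemma emeasure_extension_open_gt:
  assumes "openin X U" "c < emeasure extension U"
  shows "\<exists>a\<in>\<A>. a \<subseteq> U \<and> c < emeasure extension a"
  using assms(2) unfolding emeasure_extension_open[OF assms(1)] inner_def less_SUP_iff
  by (auto simp: emeasure_extension_member)

end

section \<open>Families of measures as vector measures\<close>

text \<open>Everything about the states that the vector measure needs: regularity by members for
  each \<open>y\<close>, continuity in \<open>y\<close> on members, and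
  \<open>uniformly_small\<close>. The last asks for one good index only; as it ranges over all
  disjoint sequences, this is enough to stop an infinite splitting process.\<close>

locale measure_family = clopen_base X \<A> for X :: "'x topology" and \<A> +
  fixes Y :: "'y topology" and \<mu> :: "'y \<Rightarrow> 'x measure"
  assumes compact_Y: "compact_space Y"
    and sets_\<mu>: "y \<in> topspace Y \<Longrightarrow> sets (\<mu> y) = borel_sets X"
    and space_\<mu>: "y \<in> topspace Y \<Longrightarrow> space (\<mu> y) = topspace X"
    and prob: "y \<in> topspace Y \<Longrightarrow> emeasure (\<mu> y) (topspace X) = 1"
    and open_gt: "y \<in> topspace Y \<Longrightarrow> openin X U \<Longrightarrow> c < emeasure (\<mu> y) U \<Longrightarrow>
        \<exists>a\<in>\<A>. a \<subseteq> U \<and> c < emeasure (\<mu> y) a"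
    and cont_member: "a \<in> \<A> \<Longrightarrow> continuous_map Y euclideanreal (\<lambda>y. measure (\<mu> y) a)"
    and uniformly_small: "range D \<subseteq> \<A> \<Longrightarrow> disjoint_family D \<Longrightarrow> 0 < \<epsilon> \<Longrightarrow>
        \<exists>k::nat. \<forall>y\<in>topspace Y. measure (\<mu> y) (D k) \<le> \<epsilon>"
begin

lemma finite_measure_\<mu>: "y \<in> topspace Y \<Longrightarrow> finite_measure (\<mu> y)"
  by (rule finite_measureI) (simp add: space_\<mu> prob)

lemma open_borel: "openin X U \<Longrightarrow> U \<in> borel_sets X"
  unfolding borel_sets_def by (auto intro: sigma_sets.Basic)

lemma sigma_algebra_borel: "sigma_algebra (topspace X) (borel_sets X)"
  unfolding borel_sets_def by (rule sigma_algebra_sigma_sets) (auto dest: openin_subset)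

sublocale borel: sigma_algebra "topspace X" "borel_sets X" by (rule sigma_algebra_borel)

lemma closed_borel: "closedin X K \<Longrightarrow> K \<in> borel_sets X"
  using borel.compl_sets[OF open_borel, of "topspace X - K"]
  by (simp add: closedin_def double_diff)

lemma member_borel: "a \<in> \<A> \<Longrightarrow> a \<in> borel_sets X"
  using open_borel open_member by blast

lemma meas: "y \<in> topspace Y \<Longrightarrow> B \<in> borel_sets X \<Longrightarrow> B \<in> sets (\<mu> y)"
  by (simp add: sets_\<mu>)

lemma measure_mono:
  "y \<in> topspace Y \<Longrightarrow> B \<in> borel_sets X \<Longrightarrow> A \<subseteq> B \<Longrightarrow> measure (\<mu> y) A \<le> measure (\<mu> y) B"
  using finite_measure.finite_measure_mono[OF finite_measure_\<mu>] sets_\<mu> by blast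

lemma measure_Un_le:
  "y \<in> topspace Y \<Longrightarrow> A \<in> borel_sets X \<Longrightarrow> B \<in> borel_sets X \<Longrightarrow>
    measure (\<mu> y) (A \<union> B) \<le> measure (\<mu> y) A + measure (\<mu> y) B"
  using measure_subadditive[of A "\<mu> y" B] finite_measure.emeasure_finite[OF finite_measure_\<mu>] sets_\<mu>
  by simp

text \<open>If \<open>U\<close> could not be exhausted, clopen sets of uniformly positive mass could be split off
  one after the other.\<close>

lemma open_uniform_inner:
  assumes U: "openin X U" and \<epsilon>: "0 < \<epsilon>"
  shows "\<exists>a\<in>\<A>. a \<subseteq> U \<and> (\<forall>y\<in>topspace Y. measure (\<mu> y) (U - a) \<le> \<epsilon>)"
proof (rule ccontr)
  assume contra: "\<not> ?thesis"
  have step: "\<exists>d\<in>\<A>. d \<subseteq> U - a \<and> (\<exists>y\<in>topspace Y. \<epsilon> < measure (\<mu> y) d)" if a: "a \<in> \<A>" "a \<subseteq> U" for a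
  proof -
    obtain y where y: "y \<in> topspace Y" "\<epsilon> < measure (\<mu> y) (U - a)"
      using contra a by (force simp: not_le)
    have "ennreal \<epsilon> < emeasure (\<mu> y) (U - a)"
      using y \<epsilon> by (simp add: finite_measure.emeasure_eq_measure[OF finite_measure_\<mu>] ennreal_less_iff)
    then obtain d where d: "d \<in> \<A>" "d \<subseteq> U - a" "ennreal \<epsilon> < emeasure (\<mu> y) d"
      using open_gt[OF y(1) open_diff_member[OF U a(1)]] by blast
    then have "\<epsilon> < measure (\<mu> y) d"
      using y \<epsilon> by (simp add: finite_measure.emeasure_eq_measure[OF finite_measure_\<mu>] ennreal_less_iff)
    then show ?thesis using d y by blast
  qed
  \<comment> \<open>The implication makes the choice total, so that \<open>pick\<close> can be
    iterated by plain recursion.\<close>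
  have "\<exists>d. a \<in> \<A> \<and> a \<subseteq> U \<longrightarrow> d \<in> \<A> \<and> d \<subseteq> U - a \<and> (\<exists>y\<in>topspace Y. \<epsilon> < measure (\<mu> y) d)" for a
    using step[of a] by (cases "a \<in> \<A> \<and> a \<subseteq> U") auto
  then obtain pick where *: "\<And>a. a \<in> \<A> \<and> a \<subseteq> U \<longrightarrow> pick a \<in> \<A> \<and> pick a \<subseteq> U - a \<and>
      (\<exists>y\<in>topspace Y. \<epsilon> < measure (\<mu> y) (pick a))"
    by (rule that[OF someI_ex])
  have pick: "pick a \<in> \<A>" "pick a \<subseteq> U - a" "\<exists>y\<in>topspace Y. \<epsilon> < measure (\<mu> y) (pick a)"
    if "a \<in> \<A>" "a \<subseteq> U" for a
    using *[of a] that by simp_all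
  \<comment> \<open>\<open>E n\<close> is the union of the first \<open>n\<close> picked pieces;
    each new piece avoids it, which makes the pieces disjoint.\<close>
  define E where "E = rec_nat {} (\<lambda>_ a. a \<union> pick a)"
  have E0: "E 0 = {}" and ES: "E (Suc n) = E n \<union> pick (E n)" for n by (auto simp: E_def)
  have E: "E n \<in> \<A> \<and> E n \<subseteq> U" for n
  proof (induction n)
    case (Suc n)
    then show ?case using pick[of "E n"] by (auto simp: ES)
  qed (simp add: E0)
  have "mono E" by (rule mono_iff_le_Suc[THEN iffD2]) (auto simp: ES)
  define D where "D n = pick (E n)" for n
  have "D i \<inter> D j = {}" if "i < j" for i j
  proof -
    have "D i \<subseteq> E (Suc i)" by (auto simp: D_def ES)
    also have "\<dots> \<subseteq> E j" using that \<open>mono E\<close> by (auto simp: mono_def dest: Suc_leI)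
    finally show ?thesis using pick[of "E j"] E by (auto simp: D_def)
  qed
  then have "disjoint_family D"
    unfolding disjoint_family_on_def by (metis inf_commute linorder_neqE_nat)
  moreover have "range D \<subseteq> \<A>" using pick E by (auto simp: D_def)
  ultimately obtain k where "\<forall>y\<in>topspace Y. measure (\<mu> y) (D k) \<le> \<epsilon>"
    using uniformly_small \<epsilon> by blast
  then show False using pick(3)[of "E k"] E by (force simp: D_def)
qed

section \<open>Uniform regularity of Borel sets\<close>

definition uniformly_regular :: "'x set \<Rightarrow> bool" where
  "uniformly_regular B \<longleftrightarrow> (\<forall>\<epsilon>>0. \<exists>K U. closedin X K \<and> openin X U \<and> K \<subseteq> B \<and> B \<subseteq> U \<and>
     (\<forall>y\<in>topspace Y. measure (\<mu> y) (U - K) \<le> \<epsilon>))"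

lemma uniformly_regularE:
  assumes "uniformly_regular B" "0 < \<epsilon>"
  obtains K U where "closedin X K" "openin X U" "K \<subseteq> B" "B \<subseteq> U"
    "\<forall>y\<in>topspace Y. measure (\<mu> y) (U - K) \<le> \<epsilon>"
  using assms unfolding uniformly_regular_def by (elim allE impE exE conjE) (assumption | rule that)+

lemma uniformly_regular_open: assumes "openin X U" shows "uniformly_regular U"
  unfolding uniformly_regular_def
proof (intro allI impI)
  fix \<epsilon> :: real assume "0 < \<epsilon>"
  then obtain a where "a \<in> \<A>" "a \<subseteq> U" "\<forall>y\<in>topspace Y. measure (\<mu> y) (U - a) \<le> \<epsilon>"
    using open_uniform_inner[OF assms] by blast
  then show "\<exists>K V. closedin X K \<and> openin X V \<and> K \<subseteq> U \<and> U \<subseteq> V \<and>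
     (\<forall>y\<in>topspace Y. measure (\<mu> y) (V - K) \<le> \<epsilon>)"
    using assms closed_member by (intro exI[of _ a] exI[of _ U]) simp
qed

lemma uniformly_regular_compl:
  assumes "uniformly_regular B" shows "uniformly_regular (topspace X - B)"
  unfolding uniformly_regular_def
proof (intro allI impI)
  fix \<epsilon> :: real assume \<epsilon>: "0 < \<epsilon>"
  obtain K U where KU: "closedin X K" "openin X U" "K \<subseteq> B" "B \<subseteq> U"
    "\<forall>y\<in>topspace Y. measure (\<mu> y) (U - K) \<le> \<epsilon>"
    using uniformly_regularE[OF assms \<epsilon>] .
  have "(topspace X - K) - (topspace X - U) = U - K" using openin_subset[OF KU(2)] by auto
  then show "\<exists>L V. closedin X L \<and> openin X V \<and> L \<subseteq> topspace X - B \<and> topspace X - B \<subseteq> V \<and>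
     (\<forall>y\<in>topspace Y. measure (\<mu> y) (V - L) \<le> \<epsilon>)"
    using KU by (intro exI[of _ "topspace X - U"] exI[of _ "topspace X - K"]) auto
qed

text \<open>The union of all \<open>K n\<close> need not be closed, and it must be cut off at an
  \<open>N\<close> that works for every \<open>y\<close> at once. A member \<open>a\<close> fills
  \<open>V\<close> uniformly up to \<open>\<epsilon> / 2\<close> and is covered by finitely many
  \<open>b n\<close> inside \<open>U n\<close>, so outside \<open>L\<close> only
  \<open>V - a\<close> and the first \<open>N\<close> gaps \<open>U n - K n\<close> remain.\<close>

lemma uniformly_regular_UN:
  assumes B: "\<And>n::nat. uniformly_regular (B n)" shows "uniformly_regular (\<Union>n. B n)"
  unfolding uniformly_regular_def
proof (intro allI impI)
  fix \<epsilon> :: real assume \<epsilon>: "0 < \<epsilon>"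
  \<comment> \<open>All gaps together cost at most \<open>\<epsilon> / 2\<close>; the other half is
    kept for \<open>V - a\<close>.\<close>
  have "\<exists>K U. closedin X K \<and> openin X U \<and> K \<subseteq> B n \<and> B n \<subseteq> U \<and>
     (\<forall>y\<in>topspace Y. measure (\<mu> y) (U - K) \<le> \<epsilon> / 2 * (1/2) ^ Suc n)" for n
  proof -
    have "0 < \<epsilon> / 2 * (1/2) ^ Suc n" using \<epsilon> by simp
    then show ?thesis using B[of n] unfolding uniformly_regular_def by (elim allE impE)
  qed
  then obtain K U where KU: "\<And>n. closedin X (K n)" "\<And>n. openin X (U n)" "\<And>n. K n \<subseteq> B n" "\<And>n. B n \<subseteq> U n"
    "\<And>n y. y \<in> topspace Y \<Longrightarrow> measure (\<mu> y) (U n - K n) \<le> \<epsilon> / 2 * (1/2) ^ Suc n" by metis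
  define V where "V = (\<Union>n. U n)"
  have V: "openin X V" using KU by (auto simp: V_def)
  obtain a where a: "a \<in> \<A>" "a \<subseteq> V" "\<And>y. y \<in> topspace Y \<Longrightarrow> measure (\<mu> y) (V - a) \<le> \<epsilon> / 2"
    using open_uniform_inner[OF V, of "\<epsilon> / 2"] \<epsilon> by auto
  obtain N b where b: "\<And>n. b n \<in> \<A>" "\<And>n. b n \<subseteq> U n" "a \<subseteq> (\<Union>n<N. b n)"
    using countable_cover_member[OF a(1) a(2)[unfolded V_def] KU(2)] by metis
  define L where "L = (\<Union>n<N. K n)"
  have L: "closedin X L" unfolding L_def using KU by (intro closedin_Union) auto
  have UK: "U n - K n \<in> borel_sets X" for n
    using KU open_borel closed_borel by auto
  have "measure (\<mu> y) (V - L) \<le> \<epsilon>" if y: "y \<in> topspace Y" for y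
  proof -
    have "V - L \<subseteq> (V - a) \<union> (\<Union>n<N. U n - K n)"
    proof
      fix x assume x: "x \<in> V - L"
      show "x \<in> (V - a) \<union> (\<Union>n<N. U n - K n)"
      proof (cases "x \<in> a")
        case True
        then obtain n where "n < N" "x \<in> b n" using b(3) by auto
        then show ?thesis using b(2)[of n] x by (auto simp: L_def)
      qed (use x in simp)
    qed
    moreover have "(\<Union>n<N. U n - K n) \<in> borel_sets X" using UK by auto
    moreover have Va: "V - a \<in> borel_sets X" using V a(1) open_borel member_borel by auto
    ultimately have "measure (\<mu> y) (V - L) \<le> measure (\<mu> y) (V - a) + measure (\<mu> y) (\<Union>n<N. U n - K n)"
      using y measure_mono[of y "(V - a) \<union> (\<Union>n<N. U n - K n)" "V - L"]
        measure_Un_le[of y "V - a" "\<Union>n<N. U n - K n"] by fastforce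
    also have "measure (\<mu> y) (\<Union>n<N. U n - K n) \<le> (\<Sum>n<N. measure (\<mu> y) (U n - K n))"
      using finite_measure.finite_measure_subadditive_finite[OF finite_measure_\<mu>[OF y], of "{..<N}" "\<lambda>n. U n - K n"]
        UK meas[OF y] by auto
    also have "\<dots> \<le> (\<Sum>n<N. \<epsilon> / 2 * (1/2) ^ Suc n)"
      using KU(5)[OF y] by (intro sum_mono)
    also have "\<dots> = \<epsilon> / 2 * (\<Sum>n<N. (1/2) ^ Suc n)" by (simp add: sum_distrib_left)
    also have "\<dots> \<le> \<epsilon> / 2 * 1"
    proof (rule mult_left_mono)
      have "(\<Sum>n<N. (1/2::real) ^ Suc n) \<le> (\<Sum>n. (1/2) ^ Suc n)"
        using power_half_series by (intro sum_le_suminf) (auto simp: sums_iff)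
      then show "(\<Sum>n<N. (1/2::real) ^ Suc n) \<le> 1"
        using power_half_series by (simp only: sums_iff)
    qed (use \<epsilon> in simp)
    finally show ?thesis using a(3)[OF y] by simp
  qed
  moreover have "L \<subseteq> (\<Union>n. B n)" "(\<Union>n. B n) \<subseteq> V" using KU(3,4) by (fastforce simp: L_def V_def)+
  ultimately show "\<exists>K U. closedin X K \<and> openin X U \<and> K \<subseteq> (\<Union>n. B n) \<and> (\<Union>n. B n) \<subseteq> U \<and>
     (\<forall>y\<in>topspace Y. measure (\<mu> y) (U - K) \<le> \<epsilon>)"
    using V L by blast
qed

lemma uniformly_regular_borel: "B \<in> borel_sets X \<Longrightarrow> uniformly_regular B"
  unfolding borel_sets_def
proof (induction rule: sigma_sets.induct)
  case Empty
  show ?case using uniformly_regular_open[of "{}"] by simp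
qed (auto intro: uniformly_regular_open uniformly_regular_compl uniformly_regular_UN)

section \<open>Continuity, countable additivity and semivariation\<close>

lemma continuous_uniform_approx:
  assumes "\<And>\<epsilon>::real. 0 < \<epsilon> \<Longrightarrow> \<exists>g. continuous_map Y euclideanreal g \<and> (\<forall>y\<in>topspace Y. \<bar>g y - f y\<bar> \<le> \<epsilon>)"
  shows "continuous_map Y euclideanreal f"
proof -
  have "\<exists>g. continuous_map Y euclideanreal (g::'y \<Rightarrow> real) \<and> (\<forall>y\<in>topspace Y. \<bar>g y - f y\<bar> \<le> 1 / Suc n)" for n
    by (rule assms) simp
  then obtain g where g: "\<And>n. continuous_map Y euclideanreal (g n)"
    "\<And>n y. y \<in> topspace Y \<Longrightarrow> \<bar>g n y - f y\<bar> \<le> 1 / Suc n" by metis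
  have "continuous_map Y Met_TC.mtopology f"
  proof (rule Met_TC.continuous_map_uniform_limit_alt[where F = sequentially and f = g])
    fix e :: real assume e: "0 < e"
    obtain N :: nat where "1 / e < N" using reals_Archimedean2 by blast
    then have N: "1 < N * e" using e by (simp add: pos_divide_less_eq)
    show "\<forall>\<^sub>F n in sequentially. \<forall>y\<in>topspace Y. dist (g n y) (f y) < e"
    proof (rule eventually_sequentiallyI[of N], rule ballI)
      fix n y assume n: "N \<le> n" and y: "y \<in> topspace Y"
      have "N * e \<le> Suc n * e" using n e by (intro mult_right_mono) auto
      then have "1 / Suc n < e" using N by (simp add: pos_divide_less_eq mult.commute)
      then show "dist (g n y) (f y) < e" using g(2)[OF y, of n] by (simp add: dist_real_def)
    qed
  qed (use g in auto)
  then show ?thesis by simp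
qed

text \<open>The member \<open>a\<close> need not be comparable with \<open>B\<close>. Both have
  measure between that of \<open>U\<close> minus \<epsilon> and that of \<open>U\<close>, hence they
  differ by at most \<epsilon> for every \<open>y\<close>, and the measure of \<open>a\<close> is
  continuous in \<open>y\<close>.\<close>

lemma continuous_measure:
  assumes B: "B \<in> borel_sets X" shows "continuous_map Y euclideanreal (\<lambda>y. measure (\<mu> y) B)"
proof (rule continuous_uniform_approx)
  fix \<epsilon> :: real assume \<epsilon>: "0 < \<epsilon>"
  obtain K U where KU: "closedin X K" "openin X U" "K \<subseteq> B" "B \<subseteq> U"
    "\<forall>y\<in>topspace Y. measure (\<mu> y) (U - K) \<le> \<epsilon>"
    using uniformly_regularE[OF uniformly_regular_borel[OF B] \<epsilon>] .
  obtain a where a: "a \<in> \<A>" "a \<subseteq> U" "\<And>y. y \<in> topspace Y \<Longrightarrow> measure (\<mu> y) (U - a) \<le> \<epsilon>"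
    using open_uniform_inner[OF KU(2) \<epsilon>] by auto
  have "\<bar>measure (\<mu> y) a - measure (\<mu> y) B\<bar> \<le> \<epsilon>" if y: "y \<in> topspace Y" for y
  proof -
    note bs = open_borel[OF KU(2)] closed_borel[OF KU(1)] member_borel[OF a(1)] B
    have "measure (\<mu> y) (U - K) = measure (\<mu> y) U - measure (\<mu> y) K"
      "measure (\<mu> y) (U - a) = measure (\<mu> y) U - measure (\<mu> y) a"
      using y bs KU a(2) by (auto intro!: finite_measure.finite_measure_Diff[OF finite_measure_\<mu>] meas)
    moreover have "measure (\<mu> y) K \<le> measure (\<mu> y) B" "measure (\<mu> y) B \<le> measure (\<mu> y) U"
      "measure (\<mu> y) a \<le> measure (\<mu> y) U"
      using y bs KU a(2) by (auto intro!: measure_mono)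
    ultimately show ?thesis using KU(5)[rule_format, OF y] a(3)[OF y] by linarith
  qed
  then show "\<exists>g. continuous_map Y euclideanreal g \<and> (\<forall>y\<in>topspace Y. \<bar>g y - measure (\<mu> y) B\<bar> \<le> \<epsilon>)"
    using cont_member[OF a(1)] by blast
qed

text \<open>Dini's theorem: the partial sums are continuous and increase pointwise to a limit that
  is continuous by \<open>continuous_measure\<close>, so on the compact \<open>Y\<close> they
  converge uniformly.\<close>

lemma vector_measure_\<mu>: "vector_measure X Y (\<lambda>B y. measure (\<mu> y) B)"
  unfolding vector_measure_def
proof (intro conjI ballI allI impI)
  fix B :: "nat \<Rightarrow> 'x set" assume B: "range B \<subseteq> borel_sets X" "disjoint_family B"
  let ?g = "\<lambda>n y. measure (\<mu> y) (\<Union>n. B n) - (\<Sum>k<n. measure (\<mu> y) (B k))"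
  have sums: "(\<lambda>k. measure (\<mu> y) (B k)) sums measure (\<mu> y) (\<Union>n. B n)" if "y \<in> topspace Y" for y
    using that B by (intro finite_measure.finite_measure_UNION[OF finite_measure_\<mu>]) (auto simp: sets_\<mu>)
  have nonneg: "0 \<le> ?g n y" if "y \<in> topspace Y" for n y
    using sum_le_suminf[of "\<lambda>k. measure (\<mu> y) (B k)" "{..<n}"] sums[OF that] by (simp add: sums_iff)
  show "unif_conv Y (\<lambda>n y. \<Sum>k<n. measure (\<mu> y) (B k)) (\<lambda>y. measure (\<mu> y) (\<Union>n. B n))"
    unfolding unif_conv_def
  proof (intro allI impI)
    fix \<epsilon> :: real assume \<epsilon>: "0 < \<epsilon>"
    define W where "W n = {y \<in> topspace Y. ?g n y < \<epsilon>}" for n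
    have "openin Y (W n)" for n
    proof -
      have "continuous_map Y euclideanreal (?g n)"
        using B by (intro continuous_map_diff continuous_map_sum continuous_measure) auto
      then show ?thesis
        using openin_continuous_map_preimage[of Y euclideanreal "?g n" "{..<\<epsilon>}"]
        by (simp add: W_def)
    qed
    moreover have "topspace Y \<subseteq> (\<Union>n. W n)"
    proof
      fix y assume y: "y \<in> topspace Y"
      have "(\<lambda>n. ?g n y) \<longlonglongrightarrow> measure (\<mu> y) (\<Union>n. B n) - measure (\<mu> y) (\<Union>n. B n)"
        using sums[OF y] by (intro tendsto_diff tendsto_const) (simp add: sums_def)
      then have "\<forall>\<^sub>F n in sequentially. ?g n y < \<epsilon>" using \<epsilon> by (intro order_tendstoD(2)) auto
      then obtain n where "?g n y < \<epsilon>" by (auto simp: eventually_sequentially)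
      then show "y \<in> (\<Union>n. W n)" using y by (auto simp: W_def)
    qed
    ultimately obtain \<W> where \<W>: "finite \<W>" "\<W> \<subseteq> range W" "topspace Y \<subseteq> \<Union>\<W>"
      using compact_Y unfolding compact_space_alt by (metis (no_types, lifting) imageE)
    then obtain I where I: "finite I" "\<W> = W ` I" by (metis finite_subset_image)
    show "\<exists>n0. \<forall>n\<ge>n0. \<forall>y\<in>topspace Y. \<bar>(\<Sum>k<n. measure (\<mu> y) (B k)) - measure (\<mu> y) (\<Union>n. B n)\<bar> \<le> \<epsilon>"
    \<comment> \<open>The inserted \<open>0\<close> keeps the maximum defined when \<open>I\<close>
      is empty.\<close>
    proof (intro exI[of _ "Max (insert 0 I)"] allI impI ballI)
      fix n y assume n: "Max (insert 0 I) \<le> n" and y: "y \<in> topspace Y"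
      obtain i where i: "i \<in> I" "?g i y < \<epsilon>" using y \<W> I by (auto simp: W_def)
      have "i \<le> n" using n i I by simp
      then have "(\<Sum>k<i. measure (\<mu> y) (B k)) \<le> (\<Sum>k<n. measure (\<mu> y) (B k))"
        by (intro sum_mono2) auto
      then show "\<bar>(\<Sum>k<n. measure (\<mu> y) (B k)) - measure (\<mu> y) (\<Union>n. B n)\<bar> \<le> \<epsilon>"
        using nonneg[OF y, of n] i by linarith
    qed
  qed
qed (rule continuous_measure)

text \<open>By linearity the sum of the absolute values is \<phi> applied to one continuous
  function, the combination of the measures of the parts with signs \<sigma>. As the measures are
  positive, this function is bounded by the measure of \<open>E\<close>, so by
  \<open>c\<close>.\<close>

lemma semivariation_le:
  assumes E: "\<And>y. y \<in> topspace Y \<Longrightarrow> measure (\<mu> y) E \<le> c" and c: "0 \<le> c"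
  shows "semivariation X Y (\<lambda>B y. measure (\<mu> y) B) E \<le> ereal c"
  unfolding semivariation_def scalar_variation_def
proof (intro SUP_least)
  fix \<phi> P assume \<phi>: "\<phi> \<in> dual_unit_ball Y" and P: "P \<in> borel_partitions X E"
  have P': "finite P" "P \<subseteq> borel_sets X" "disjoint P" "\<Union>P = E"
    using P by (auto simp: borel_partitions_def)
  let ?m = "\<lambda>B y. measure (\<mu> y) B"
  have cont: "continuous_map Y euclideanreal (?m B)" if "B \<in> P" for B
    using that P' continuous_measure by blast
  define \<sigma> where "\<sigma> B = sgn (\<phi> (?m B))" for B
  have \<phi>_add: "\<phi> (\<lambda>y. f y + g y) = \<phi> f + \<phi> g"
    if "continuous_map Y euclideanreal f" "continuous_map Y euclideanreal g" for f g
    using \<phi> that unfolding dual_unit_ball_def by blast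
  have \<phi>_cmul: "\<phi> (\<lambda>y. r * f y) = r * \<phi> f" if "continuous_map Y euclideanreal f" for r f
    using \<phi> that unfolding dual_unit_ball_def by blast
  have \<phi>_sum: "\<phi> (\<lambda>y. \<Sum>B\<in>Q. \<sigma> B * ?m B y) = (\<Sum>B\<in>Q. \<sigma> B * \<phi> (?m B))" if "finite Q" "Q \<subseteq> P" for Q
    using that
  proof (induction Q rule: finite_induct)
    case empty
    show ?case using \<phi>_cmul[of "\<lambda>_. 0" 0] by simp
  next
    case (insert B Q)
    have "\<phi> (\<lambda>y. \<sigma> B * ?m B y + (\<Sum>B\<in>Q. \<sigma> B * ?m B y)) = \<phi> (\<lambda>y. \<sigma> B * ?m B y) + \<phi> (\<lambda>y. \<Sum>B\<in>Q. \<sigma> B * ?m B y)"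
      using insert cont by (intro \<phi>_add continuous_map_sum continuous_map_real_mult_left) auto
    then show ?case using insert cont by (simp add: \<phi>_cmul)
  qed
  have bound: "\<bar>\<Sum>B\<in>P. \<sigma> B * ?m B y\<bar> \<le> c" if y: "y \<in> topspace Y" for y
  proof -
    have "\<bar>\<Sum>B\<in>P. \<sigma> B * ?m B y\<bar> \<le> (\<Sum>B\<in>P. \<bar>\<sigma> B * ?m B y\<bar>)" by (rule sum_abs)
    also have "\<dots> \<le> (\<Sum>B\<in>P. ?m B y)"
      by (intro sum_mono) (simp add: \<sigma>_def abs_mult abs_sgn_eq)
    also have "\<dots> = measure (\<mu> y) (\<Union>B\<in>P. B)"
      using P' y by (intro finite_measure.finite_measure_finite_Union[OF finite_measure_\<mu>, symmetric])
        (auto simp: sets_\<mu> disjoint_family_on_def dest: disjointD)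
    finally show ?thesis using E[OF y] P' by simp
  qed
  have "(\<Sum>B\<in>P. \<bar>\<phi> (?m B)\<bar>) = (\<Sum>B\<in>P. \<sigma> B * \<phi> (?m B))"
    by (simp add: \<sigma>_def abs_sgn mult.commute)
  also have "\<dots> = \<phi> (\<lambda>y. \<Sum>B\<in>P. \<sigma> B * ?m B y)"
    using \<phi>_sum[OF P'(1) subset_refl] by simp
  also have "\<dots> \<le> \<bar>\<phi> (\<lambda>y. \<Sum>B\<in>P. \<sigma> B * ?m B y)\<bar>" by simp
  also have "\<dots> \<le> c"
  proof -
    have "continuous_map Y euclideanreal (\<lambda>y. \<Sum>B\<in>P. \<sigma> B * ?m B y)"
      using P' cont by (intro continuous_map_sum continuous_map_real_mult_left) auto
    then show ?thesis using \<phi> bound c unfolding dual_unit_ball_def by blast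
  qed
  finally show "ereal (\<Sum>B\<in>P. \<bar>\<phi> (?m B)\<bar>) \<le> ereal c" by simp
qed

lemma regular_vector_measure_\<mu>: "regular_vector_measure X Y (\<lambda>B y. measure (\<mu> y) B)"
  unfolding regular_vector_measure_def
proof (intro conjI ballI allI impI)
  fix B and \<epsilon> :: real assume B: "B \<in> borel_sets X" and \<epsilon>: "0 < \<epsilon>"
  obtain K U where KU: "closedin X K" "openin X U" "K \<subseteq> B" "B \<subseteq> U"
    "\<forall>y\<in>topspace Y. measure (\<mu> y) (U - K) \<le> \<epsilon> / 2"
    \<comment> \<open>Halving turns the non-strict bound of \<open>semivariation_le\<close> into the
      strict one required.\<close>
    using uniformly_regularE[OF uniformly_regular_borel[OF B] half_gt_zero[OF \<epsilon>]] .
  have "semivariation X Y (\<lambda>B y. measure (\<mu> y) B) (U - K) \<le> ereal (\<epsilon> / 2)"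
    using KU \<epsilon> by (intro semivariation_le) auto
  also have "\<dots> < ereal \<epsilon>" using \<epsilon> by simp
  finally show "\<exists>K U. compactin X K \<and> openin X U \<and> K \<subseteq> B \<and> B \<subseteq> U \<and>
      semivariation X Y (\<lambda>B y. measure (\<mu> y) B) (U - K) < ereal \<epsilon>"
    using KU closedin_compact_space[OF compact KU(1)] by (intro exI[of _ K] exI[of _ U]) simp
qed (rule vector_measure_\<mu>)

section \<open>Integration of simple functions\<close>

lemma integral_simple_fun:
  assumes s: "simple_repr X s" and y: "y \<in> topspace Y"
  shows "integrable (\<mu> y) (simple_fun s)" "integral\<^sup>L (\<mu> y) (simple_fun s) = simple_integral (\<lambda>B y. measure (\<mu> y) B) s y"
proof -
  have B: "snd (s ! i) \<in> sets (\<mu> y)" if "i < length s" for i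
    using s that y by (simp add: simple_repr_def sets_\<mu>)
  have int: "integrable (\<mu> y) (\<lambda>x. fst (s ! i) * indicator (snd (s ! i)) x :: real)" if "i < length s" for i
    using B[OF that] finite_measure.emeasure_finite[OF finite_measure_\<mu>[OF y]]
    by (intro integrable_mult_right integrable_real_indicator) (auto simp: less_top)
  have eq: "simple_fun s = (\<lambda>x. \<Sum>i<length s. fst (s ! i) * indicator (snd (s ! i)) x)"
    by (auto simp: simple_fun_def)
  show "integrable (\<mu> y) (simple_fun s)"
    unfolding eq using int by (intro Bochner_Integration.integrable_sum) auto
  have "integral\<^sup>L (\<mu> y) (simple_fun s) = (\<Sum>i<length s. integral\<^sup>L (\<mu> y) (\<lambda>x. fst (s ! i) * indicator (snd (s ! i)) x))"
    unfolding eq using int by (intro Bochner_Integration.integral_sum) auto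
  also have "\<dots> = (\<Sum>i<length s. fst (s ! i) * measure (\<mu> y) (snd (s ! i)))"
    using B sets.sets_into_space by (intro sum.cong) (auto simp: Int_absorb2)
  finally show "integral\<^sup>L (\<mu> y) (simple_fun s) = simple_integral (\<lambda>B y. measure (\<mu> y) B) s y"
    by (simp add: simple_integral_def)
qed

text \<open>At each \<open>y\<close> both sides are Bochner integrals against a probability measure,
  so they depend on the functions only, not on their representations, and the sup norm bounds their
  difference.\<close>

lemma simple_integral_close:
  assumes st: "simple_repr X s" "simple_repr X t" and y: "y \<in> topspace Y"
    and c: "\<And>x. x \<in> topspace X \<Longrightarrow> \<bar>simple_fun s x - simple_fun t x\<bar> \<le> c"
  shows "\<bar>simple_integral (\<lambda>B y. measure (\<mu> y) B) s y - simple_integral (\<lambda>B y. measure (\<mu> y) B) t y\<bar> \<le> c"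
proof -
  interpret finite_measure "\<mu> y" by (rule finite_measure_\<mu>[OF y])
  note i = integral_simple_fun[OF st(1) y] integral_simple_fun[OF st(2) y]
  have "\<bar>integral\<^sup>L (\<mu> y) (\<lambda>x. simple_fun s x - simple_fun t x)\<bar> \<le> integral\<^sup>L (\<mu> y) (\<lambda>x. \<bar>simple_fun s x - simple_fun t x\<bar>)"
    by (rule integral_abs_bound)
  also have "\<dots> \<le> integral\<^sup>L (\<mu> y) (\<lambda>x. c)"
    using i c by (intro integral_mono) (auto simp: space_\<mu>[OF y])
  also have "\<dots> = c" using prob[OF y] by (simp add: space_\<mu>[OF y] measure_def)
  finally show ?thesis using i by simp
qed

text \<open>\<open>vm_has_integral\<close> quantifies over all approximating sequences; by
  \<open>simple_integral_close\<close> any other one has integrals close to those of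
  \<open>t\<close>, so a single sequence suffices.\<close>

lemma vm_has_integralI:
  assumes t: "\<And>n. simple_repr X (t n)" "unif_conv X (\<lambda>n. simple_fun (t n)) f"
    and I: "unif_conv Y (\<lambda>n. simple_integral (\<lambda>B y. measure (\<mu> y) B) (t n)) I"
  shows "vm_has_integral X Y (\<lambda>B y. measure (\<mu> y) B) f I"
  unfolding vm_has_integral_def
proof (intro conjI allI impI)
  show "\<exists>s. (\<forall>n. simple_repr X (s n)) \<and> unif_conv X (\<lambda>n. simple_fun (s n)) f" using t by blast
  fix s assume s: "\<forall>n. simple_repr X (s n)" "unif_conv X (\<lambda>n. simple_fun (s n)) f"
  let ?I = "simple_integral (\<lambda>B y. measure (\<mu> y) B)"
  show "unif_conv Y (\<lambda>n. ?I (s n)) I"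
    unfolding unif_conv_def
  proof (intro allI impI)
    fix \<epsilon> :: real assume \<epsilon>: "0 < \<epsilon>"
    then have 3: "0 < \<epsilon> / 3" by simp
    obtain n1 where n1: "\<And>n x. n \<ge> n1 \<Longrightarrow> x \<in> topspace X \<Longrightarrow> \<bar>simple_fun (s n) x - f x\<bar> \<le> \<epsilon> / 3"
      using s(2) 3 unfolding unif_conv_def by blast
    obtain n2 where n2: "\<And>n x. n \<ge> n2 \<Longrightarrow> x \<in> topspace X \<Longrightarrow> \<bar>simple_fun (t n) x - f x\<bar> \<le> \<epsilon> / 3"
      using t(2) 3 unfolding unif_conv_def by blast
    obtain n3 where n3: "\<And>n y. n \<ge> n3 \<Longrightarrow> y \<in> topspace Y \<Longrightarrow> \<bar>?I (t n) y - I y\<bar> \<le> \<epsilon> / 3"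
      using I 3 unfolding unif_conv_def by blast
    show "\<exists>n0. \<forall>n\<ge>n0. \<forall>y\<in>topspace Y. \<bar>?I (s n) y - I y\<bar> \<le> \<epsilon>"
    proof (intro exI[of _ "max n1 (max n2 n3)"] allI impI ballI)
      fix n y assume n: "max n1 (max n2 n3) \<le> n" and y: "y \<in> topspace Y"
      have "\<bar>?I (s n) y - ?I (t n) y\<bar> \<le> 2 * (\<epsilon> / 3)"
      proof (rule simple_integral_close[OF _ _ y])
        fix x assume "x \<in> topspace X"
        then show "\<bar>simple_fun (s n) x - simple_fun (t n) x\<bar> \<le> 2 * (\<epsilon> / 3)"
          using n1[of n x] n2[of n x] n by linarith
      qed (use s t in auto)
      then show "\<bar>?I (s n) y - I y\<bar> \<le> \<epsilon>" using n3[OF _ y, of n] n by linarith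
    qed
  qed
qed

text \<open>\<open>simple_repr\<close> demands disjoint sets, whereas the sets \<open>B i\<close>
  may overlap. The level sets of the sum \<open>g\<close> give a disjoint representation, and the
  integrals agree because both are Bochner integrals of \<open>g\<close>.\<close>

lemma simple_repr_sum:
  fixes c :: "nat \<Rightarrow> real"
  assumes B: "\<And>i. B i \<in> borel_sets X"
  obtains t where "simple_repr X t"
    "\<And>x. x \<in> topspace X \<Longrightarrow> simple_fun t x = (\<Sum>i<n. c i * indicator (B i) x)"
    "\<And>y. y \<in> topspace Y \<Longrightarrow>
      simple_integral (\<lambda>B y. measure (\<mu> y) B) t y = (\<Sum>i<n. c i * measure (\<mu> y) (B i))"
proof -
  define g where "g x = (\<Sum>i<n. c i * indicator (B i) x)" for x
  \<comment> \<open>All subset sums of the coefficients: a finite set containing every value of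
    \<open>g\<close>. Values that are not attained contribute an empty level set.\<close>
  define F where "F = (\<lambda>T. \<Sum>i\<in>T. c i) ` Pow {..<n}"
  define S where "S = sigma (topspace X) {U. openin X U}"
  have S: "space S = topspace X" "sets S = borel_sets X"
    unfolding S_def borel_sets_def by (auto intro!: space_measure_of sets_measure_of dest: openin_subset)
  have gF: "g x \<in> F" for x
  proof -
    have "g x = (\<Sum>i<n. if x \<in> B i then c i else 0)"
      unfolding g_def by (intro sum.cong) (simp_all add: indicator_def)
    also have "\<dots> = (\<Sum>i\<in>{i \<in> {..<n}. x \<in> B i}. c i)" by (rule sum.inter_filter[symmetric]) simp
    finally show ?thesis unfolding F_def by auto
  qed
  have "finite F" by (simp add: F_def)
  then obtain r where r: "set r = F" "distinct r" using finite_distinct_list by metis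
  define t where "t = map (\<lambda>v. (v, {x \<in> topspace X. g x = v})) r"
  have t_nth: "fst (t ! i) = r ! i" "snd (t ! i) = {x \<in> topspace X. g x = r ! i}" if "i < length r" for i
    using that by (simp_all add: t_def)
  have len: "length t = length r" by (simp add: t_def)
  have g_meas: "g \<in> borel_measurable S"
    unfolding g_def using B S by (intro borel_measurable_sum borel_measurable_times borel_measurable_indicator) auto
  have level: "{x \<in> topspace X. g x = v} \<in> borel_sets X" for v
    using borel_measurable_eq[OF g_meas borel_measurable_const[of v]] by (simp add: S)
  have repr: "simple_repr X t"
    unfolding simple_repr_def len using level r(2) by (auto simp: t_nth nth_eq_iff_index_eq)
  have fun_eq: "simple_fun t x = g x" if x: "x \<in> topspace X" for x
  proof -
    have "simple_fun t x = (\<Sum>i<length r. r ! i * indicator {x \<in> topspace X. g x = r ! i} x)"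
      unfolding simple_fun_def len by (intro sum.cong) (simp_all add: t_nth)
    also have "\<dots> = (\<Sum>v\<in>set r. v * indicator {x \<in> topspace X. g x = v} x)"
      by (rule sum.reindex_bij_betw[OF bij_betw_nth[OF r(2) refl refl]])
    also have "\<dots> = (\<Sum>v\<in>F. if v = g x then v else 0)"
      unfolding r(1) using x by (intro sum.cong) (auto simp: indicator_def)
    also have "\<dots> = g x" using gF[of x] \<open>finite F\<close> by simp
    finally show ?thesis .
  qed
  have "simple_integral (\<lambda>B y. measure (\<mu> y) B) t y = (\<Sum>i<n. c i * measure (\<mu> y) (B i))"
    if y: "y \<in> topspace Y" for y
  proof -
    have sB: "B i \<in> sets (\<mu> y)" for i using meas[OF y B] .
    have int: "integrable (\<mu> y) (\<lambda>x. c i * indicator (B i) x :: real)" for i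
      using sB[of i] finite_measure.emeasure_finite[OF finite_measure_\<mu>[OF y]]
      by (intro integrable_mult_right integrable_real_indicator) (auto simp: less_top)
    have "simple_integral (\<lambda>B y. measure (\<mu> y) B) t y = integral\<^sup>L (\<mu> y) (simple_fun t)"
      using integral_simple_fun(2)[OF repr y] by simp
    also have "\<dots> = integral\<^sup>L (\<mu> y) (\<lambda>x. \<Sum>i<n. c i * indicator (B i) x)"
      using fun_eq by (intro Bochner_Integration.integral_cong) (simp_all add: space_\<mu>[OF y] g_def)
    also have "\<dots> = (\<Sum>i<n. integral\<^sup>L (\<mu> y) (\<lambda>x. c i * indicator (B i) x))"
      using int by (intro Bochner_Integration.integral_sum)
    also have "\<dots> = (\<Sum>i<n. c i * measure (\<mu> y) (B i))"
      using sB sets.sets_into_space by (intro sum.cong) (auto simp: Int_absorb2)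
    finally show ?thesis .
  qed
  then show ?thesis using that[OF repr] fun_eq by (simp add: g_def)
qed

end

section \<open>MV-algebras and their ideals\<close>

locale mv_alg =
  fixes M :: "('a, 'm) mv_algebra_scheme"
  assumes mv: "mv_algebra M"
begin

abbreviation "C \<equiv> mv_carrier M"
abbreviation oplus (infixl "\<oplus>" 65) where "x \<oplus> y \<equiv> mv_plus M x y"
abbreviation "neg \<equiv> mv_neg M"
abbreviation zer ("\<zero>") where "\<zero> \<equiv> mv_zero M"
abbreviation one ("\<one>") where "\<one> \<equiv> mv_one M"
abbreviation leq (infix "\<sqsubseteq>" 50) where "x \<sqsubseteq> y \<equiv> mv_le M x y"
abbreviation meet (infixl "\<sqinter>" 70) where "x \<sqinter> y \<equiv> mv_meet M x y"
abbreviation join (infixl "\<squnion>" 65) where "x \<squnion> y \<equiv> mv_join M x y"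
text \<open>Truncated difference: in the unit interval this is the maximum of \<open>0\<close> and
  \<open>x - y\<close>.\<close>

definition ominus (infixl "\<ominus>" 65) where "x \<ominus> y = neg (neg x \<oplus> y)"

lemmas mv_axioms = mv[unfolded mv_algebra_def]

lemma zero_closed [simp]: "\<zero> \<in> C"
  using mv_axioms by (elim conjE)

lemma plus_closed [simp]: "x \<in> C \<Longrightarrow> y \<in> C \<Longrightarrow> x \<oplus> y \<in> C"
  by (rule mv_axioms[THEN conjunct2, THEN conjunct1, rule_format])

lemma neg_closed [simp]: "x \<in> C \<Longrightarrow> neg x \<in> C"
  by (rule mv_axioms[THEN conjunct2, THEN conjunct2, THEN conjunct1, rule_format])

lemma plus_assoc: "x \<in> C \<Longrightarrow> y \<in> C \<Longrightarrow> z \<in> C \<Longrightarrow> (x \<oplus> y) \<oplus> z = x \<oplus> (y \<oplus> z)"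
  by (rule mv_axioms[THEN conjunct2, THEN conjunct2, THEN conjunct2, THEN conjunct1, rule_format, symmetric])

lemma plus_comm: "x \<in> C \<Longrightarrow> y \<in> C \<Longrightarrow> x \<oplus> y = y \<oplus> x"
  by (rule mv_axioms[THEN conjunct2, THEN conjunct2, THEN conjunct2, THEN conjunct2, THEN conjunct1, rule_format])

lemma plus_zero [simp]: "x \<in> C \<Longrightarrow> x \<oplus> \<zero> = x"
  by (rule mv_axioms[THEN conjunct2, THEN conjunct2, THEN conjunct2, THEN conjunct2, THEN conjunct2, THEN conjunct1, rule_format])

lemma neg_neg [simp]: "x \<in> C \<Longrightarrow> neg (neg x) = x"
  by (rule mv_axioms[THEN conjunct2, THEN conjunct2, THEN conjunct2, THEN conjunct2, THEN conjunct2, THEN conjunct2, THEN conjunct1, rule_format])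

lemma plus_one [simp]: "x \<in> C \<Longrightarrow> x \<oplus> \<one> = \<one>"
  by (rule mv_axioms[THEN conjunct2, THEN conjunct2, THEN conjunct2, THEN conjunct2, THEN conjunct2, THEN conjunct2, THEN conjunct2, THEN conjunct1, rule_format])

lemma luka: "x \<in> C \<Longrightarrow> y \<in> C \<Longrightarrow> neg (neg x \<oplus> y) \<oplus> y = neg (neg y \<oplus> x) \<oplus> x"
  by (rule mv_axioms[THEN conjunct2, THEN conjunct2, THEN conjunct2, THEN conjunct2, THEN conjunct2, THEN conjunct2, THEN conjunct2, THEN conjunct2, rule_format])

lemma one_closed [simp]: "\<one> \<in> C"
  by (simp add: mv_one_def)

lemma minus_closed [simp]: "x \<in> C \<Longrightarrow> y \<in> C \<Longrightarrow> x \<ominus> y \<in> C"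
  by (simp add: ominus_def)

lemma join_closed [simp]: "x \<in> C \<Longrightarrow> y \<in> C \<Longrightarrow> x \<squnion> y \<in> C"
  by (simp add: mv_join_def)

lemma meet_closed [simp]: "x \<in> C \<Longrightarrow> y \<in> C \<Longrightarrow> x \<sqinter> y \<in> C"
  by (simp add: mv_meet_def)

lemma neg_zero [simp]: "neg \<zero> = \<one>"
  by (simp add: mv_one_def)

lemma neg_one [simp]: "neg \<one> = \<zero>"
  using neg_neg[of "\<zero>"] by simp

lemma zero_plus [simp]: "x \<in> C \<Longrightarrow> \<zero> \<oplus> x = x"
  using plus_comm[of \<zero> x] by simp

lemma one_plus [simp]: "x \<in> C \<Longrightarrow> \<one> \<oplus> x = \<one>"
  using plus_comm[of \<one> x] by simp

lemma plus_left_comm: "x \<in> C \<Longrightarrow> y \<in> C \<Longrightarrow> z \<in> C \<Longrightarrow> x \<oplus> (y \<oplus> z) = y \<oplus> (x \<oplus> z)"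
  using plus_assoc plus_comm by metis

lemmas plus_ac = plus_assoc plus_comm plus_left_comm

text \<open>The axiom \<open>luka\<close> at \<open>y = \<one>\<close> reduces to this.\<close>

lemma plus_neg [simp]: "x \<in> C \<Longrightarrow> x \<oplus> neg x = \<one>" "x \<in> C \<Longrightarrow> neg x \<oplus> x = \<one>"
  using luka[of x \<one>] plus_comm[of "neg x" x] by simp_all

lemma leI: "x \<in> C \<Longrightarrow> z \<in> C \<Longrightarrow> y = x \<oplus> z \<Longrightarrow> x \<sqsubseteq> y"
  by (simp add: mv_le_def plus_assoc[symmetric])

lemma join_eq: "x \<squnion> y = (x \<ominus> y) \<oplus> y"
  by (simp add: mv_join_def ominus_def)

lemma join_comm: "x \<in> C \<Longrightarrow> y \<in> C \<Longrightarrow> x \<squnion> y = y \<squnion> x"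
  using luka by (simp add: mv_join_def)

lemma le_minus_plus: "x \<in> C \<Longrightarrow> y \<in> C \<Longrightarrow> x \<sqsubseteq> y \<Longrightarrow> (y \<ominus> x) \<oplus> x = y"
  using luka[of x y] by (simp add: mv_le_def ominus_def)

lemma le_refl [simp]: "x \<in> C \<Longrightarrow> x \<sqsubseteq> x"
  by (simp add: mv_le_def)

lemma le_antisym: "x \<in> C \<Longrightarrow> y \<in> C \<Longrightarrow> x \<sqsubseteq> y \<Longrightarrow> y \<sqsubseteq> x \<Longrightarrow> x = y"
  using luka[of x y] by (simp add: mv_le_def)

lemma le_trans: assumes "x \<in> C" "y \<in> C" "z \<in> C" "x \<sqsubseteq> y" "y \<sqsubseteq> z" shows "x \<sqsubseteq> z"
proof -
  have "z = (z \<ominus> y) \<oplus> ((y \<ominus> x) \<oplus> x)"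
    using assms by (simp add: le_minus_plus)
  also have "\<dots> = x \<oplus> ((z \<ominus> y) \<oplus> (y \<ominus> x))"
    using assms by (simp add: plus_ac)
  finally show ?thesis
    using assms by (intro leI[where z = "(z \<ominus> y) \<oplus> (y \<ominus> x)"]) auto
qed

lemma zero_le [simp]: "x \<in> C \<Longrightarrow> \<zero> \<sqsubseteq> x"
  by (simp add: mv_le_def)

lemma le_one [simp]: "x \<in> C \<Longrightarrow> x \<sqsubseteq> \<one>"
  by (simp add: mv_le_def)

lemma le_zero: "x \<in> C \<Longrightarrow> x \<sqsubseteq> \<zero> \<longleftrightarrow> x = \<zero>"
  using le_antisym[of x \<zero>] by auto

lemma neg_le_neg: "x \<in> C \<Longrightarrow> y \<in> C \<Longrightarrow> neg x \<sqsubseteq> neg y \<longleftrightarrow> y \<sqsubseteq> x"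
  by (simp add: mv_le_def plus_comm)

lemma le_neg_swap: "x \<in> C \<Longrightarrow> y \<in> C \<Longrightarrow> x \<sqsubseteq> neg y \<longleftrightarrow> y \<sqsubseteq> neg x"
  by (simp add: mv_le_def plus_comm)

text \<open>Residuation: once a double negation is removed, both sides are the same equation. Many
  of the later inequalities are obtained by moving a term across with it.\<close>

lemma minus_le_iff: "x \<in> C \<Longrightarrow> y \<in> C \<Longrightarrow> z \<in> C \<Longrightarrow> x \<ominus> y \<sqsubseteq> z \<longleftrightarrow> x \<sqsubseteq> y \<oplus> z"
  by (simp add: mv_le_def ominus_def plus_ac)

lemma le_plus_left [simp]: "x \<in> C \<Longrightarrow> y \<in> C \<Longrightarrow> x \<sqsubseteq> x \<oplus> y"
  by (rule leI) auto

lemma le_plus_right [simp]: "x \<in> C \<Longrightarrow> y \<in> C \<Longrightarrow> x \<sqsubseteq> y \<oplus> x"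
  by (rule leI[of _ y]) (auto simp: plus_comm)

lemma le_plus_minus: "x \<in> C \<Longrightarrow> y \<in> C \<Longrightarrow> x \<sqsubseteq> y \<oplus> (x \<ominus> y)"
  using minus_le_iff[of x y "x \<ominus> y"] by simp

lemma plus_mono_left:
  assumes "x \<in> C" "y \<in> C" "z \<in> C" "x \<sqsubseteq> y" shows "z \<oplus> x \<sqsubseteq> z \<oplus> y"
proof -
  have "z \<oplus> y = z \<oplus> ((y \<ominus> x) \<oplus> x)"
    using assms by (simp add: le_minus_plus)
  then show ?thesis
    using assms by (intro leI[where z = "y \<ominus> x"]) (auto simp: plus_ac)
qed

lemma plus_mono:
  assumes "x \<in> C" "y \<in> C" "z \<in> C" "w \<in> C" "x \<sqsubseteq> y" "z \<sqsubseteq> w" shows "x \<oplus> z \<sqsubseteq> y \<oplus> w"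
proof -
  have "x \<oplus> z \<sqsubseteq> x \<oplus> w" "w \<oplus> x \<sqsubseteq> w \<oplus> y"
    using assms by (auto intro: plus_mono_left)
  then show ?thesis
    using assms le_trans[of "x \<oplus> z" "x \<oplus> w" "y \<oplus> w"] by (simp add: plus_comm)
qed

lemma minus_mono:
  assumes "x \<in> C" "y \<in> C" "z \<in> C" "w \<in> C" "x \<sqsubseteq> y" "w \<sqsubseteq> z" shows "x \<ominus> z \<sqsubseteq> y \<ominus> w"
  unfolding ominus_def using assms by (simp add: neg_le_neg plus_mono)

lemma minus_le [simp]: "x \<in> C \<Longrightarrow> y \<in> C \<Longrightarrow> x \<ominus> y \<sqsubseteq> x"
  by (simp add: minus_le_iff)

lemma minus_le_neg [simp]: "x \<in> C \<Longrightarrow> y \<in> C \<Longrightarrow> x \<ominus> y \<sqsubseteq> neg y"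
  by (simp add: minus_le_iff)

lemma minus_self [simp]: "x \<in> C \<Longrightarrow> x \<ominus> x = \<zero>"
  by (simp add: ominus_def)

lemma minus_zero [simp]: "x \<in> C \<Longrightarrow> x \<ominus> \<zero> = x"
  by (simp add: ominus_def)

lemma le_join [simp]: "x \<in> C \<Longrightarrow> y \<in> C \<Longrightarrow> x \<sqsubseteq> x \<squnion> y" "x \<in> C \<Longrightarrow> y \<in> C \<Longrightarrow> y \<sqsubseteq> x \<squnion> y"
  by (simp_all add: join_eq plus_comm le_plus_minus)

lemma join_least:
  assumes "x \<in> C" "y \<in> C" "z \<in> C" "x \<sqsubseteq> z" "y \<sqsubseteq> z" shows "x \<squnion> y \<sqsubseteq> z"
proof -
  have "(x \<ominus> y) \<oplus> y \<sqsubseteq> (z \<ominus> y) \<oplus> y"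
    using assms by (auto intro!: plus_mono minus_mono)
  then show ?thesis
    using assms by (simp add: join_eq le_minus_plus)
qed

lemma meet_le [simp]: "x \<in> C \<Longrightarrow> y \<in> C \<Longrightarrow> x \<sqinter> y \<sqsubseteq> x" "x \<in> C \<Longrightarrow> y \<in> C \<Longrightarrow> x \<sqinter> y \<sqsubseteq> y"
  using neg_le_neg[of "neg x \<squnion> neg y" "neg x"] neg_le_neg[of "neg x \<squnion> neg y" "neg y"]
  by (simp_all add: mv_meet_def)

lemma meet_greatest:
  assumes "x \<in> C" "y \<in> C" "z \<in> C" "z \<sqsubseteq> x" "z \<sqsubseteq> y" shows "z \<sqsubseteq> x \<sqinter> y"
proof -
  have "neg x \<squnion> neg y \<sqsubseteq> neg z"
    using assms by (intro join_least) (auto simp: neg_le_neg)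
  then show ?thesis
    using assms by (simp add: mv_meet_def le_neg_swap)
qed

lemma meet_comm: "x \<in> C \<Longrightarrow> y \<in> C \<Longrightarrow> x \<sqinter> y = y \<sqinter> x"
  by (simp add: mv_meet_def join_comm[of "neg x"])

lemma meet_absorb: "x \<in> C \<Longrightarrow> y \<in> C \<Longrightarrow> x \<sqsubseteq> y \<Longrightarrow> x \<sqinter> y = x"
  by (intro le_antisym meet_greatest) auto

lemma meet_eq: "x \<in> C \<Longrightarrow> y \<in> C \<Longrightarrow> x \<ominus> (x \<ominus> y) = x \<sqinter> y"
  using join_comm[of "neg x" "neg y"]
  by (simp add: mv_meet_def mv_join_def ominus_def plus_comm)

lemma plus_minus_meet: "x \<in> C \<Longrightarrow> y \<in> C \<Longrightarrow> (x \<oplus> y) \<ominus> x = y \<sqinter> neg x"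
  by (simp add: mv_meet_def mv_join_def ominus_def plus_comm[of x y])

lemma minus_meet:
  assumes "x \<in> C" "y \<in> C" shows "x \<ominus> (x \<sqinter> y) = x \<ominus> y"
proof (rule le_antisym)
  show "x \<ominus> (x \<sqinter> y) \<sqsubseteq> x \<ominus> y"
    using assms meet_eq[of x y] meet_eq[of x "x \<ominus> y"] by simp
qed (use assms in \<open>auto intro!: minus_mono\<close>)

lemma plus_meet_distrib:
  assumes "x \<in> C" "y \<in> C" "z \<in> C" shows "x \<oplus> (y \<sqinter> z) = (x \<oplus> y) \<sqinter> (x \<oplus> z)"
proof (rule le_antisym)
  show "x \<oplus> y \<sqinter> z \<sqsubseteq> (x \<oplus> y) \<sqinter> (x \<oplus> z)"
    using assms by (auto intro!: meet_greatest plus_mono_left)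
  have "((x \<oplus> y) \<sqinter> (x \<oplus> z)) \<ominus> x \<sqsubseteq> y \<sqinter> z"
    using assms by (intro meet_greatest) (auto simp: minus_le_iff)
  then show "(x \<oplus> y) \<sqinter> (x \<oplus> z) \<sqsubseteq> x \<oplus> y \<sqinter> z"
    using assms by (simp add: minus_le_iff)
qed (use assms in auto)

text \<open>Let \<open>w\<close> be the meet of \<open>x\<close> and \<open>y\<close>, and
  \<open>d\<close> the meet in question. Then \<open>d \<oplus> w\<close> lies below both
  \<open>x\<close> and \<open>y\<close>, hence \<open>d \<oplus> w = w\<close>. Since
  \<open>d \<sqsubseteq> neg w\<close>, this sum is not truncated and \<open>w\<close> can be
  subtracted, leaving \<open>d = \<zero>\<close>.\<close>

lemma prelinear:
  assumes "x \<in> C" "y \<in> C" shows "(x \<ominus> y) \<sqinter> (y \<ominus> x) = \<zero>"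
proof -
  define w d where "w = x \<sqinter> y" and "d = (x \<ominus> y) \<sqinter> (y \<ominus> x)"
  have C: "w \<in> C" "d \<in> C" using assms by (auto simp: w_def d_def)
  have x: "x \<ominus> y = x \<ominus> w" and y: "y \<ominus> x = y \<ominus> w"
    using assms minus_meet[of x y] minus_meet[of y x] by (simp_all add: w_def meet_comm)
  have dx: "d \<sqsubseteq> x \<ominus> w" and dy: "d \<sqsubseteq> y \<ominus> w"
    using assms C unfolding x[symmetric] y[symmetric] by (auto simp: d_def)
  have "d \<oplus> w \<sqsubseteq> (x \<ominus> w) \<oplus> w" "d \<oplus> w \<sqsubseteq> (y \<ominus> w) \<oplus> w"
    using assms C dx dy by (auto intro!: plus_mono)
  moreover have "w \<sqsubseteq> x" "w \<sqsubseteq> y" using assms by (auto simp: w_def)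
  ultimately have "d \<oplus> w \<sqsubseteq> w"
    using assms C unfolding w_def by (intro meet_greatest) (auto simp: le_minus_plus)
  then have eq: "w \<oplus> d = w"
    using C by (intro le_antisym) (auto simp: plus_comm)
  have "d \<sqsubseteq> neg w"
    using le_trans[OF _ _ _ dx, of "neg w"] assms C by auto
  then have "d = (w \<oplus> d) \<ominus> w"
    using C by (simp add: plus_minus_meet meet_absorb)
  then show ?thesis
    using C unfolding eq by (simp flip: d_def)
qed

lemma meet_plus_le:
  assumes "x \<in> C" "y \<in> C" "z \<in> C" shows "x \<sqinter> (y \<oplus> z) \<sqsubseteq> (x \<sqinter> y) \<oplus> (x \<sqinter> z)"
proof -
  let ?l = "x \<sqinter> (y \<oplus> z)"
  have l: "?l \<sqsubseteq> x" "?l \<sqsubseteq> y \<oplus> z" "?l \<in> C" using assms by auto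
  have a: "?l \<sqsubseteq> x \<oplus> w" "?l \<sqsubseteq> w \<oplus> x" if "w \<in> C" for w
    using l(1,3) assms that le_trans[of ?l x "x \<oplus> w"] le_trans[of ?l x "w \<oplus> x"] by auto
  have "?l \<sqsubseteq> (x \<sqinter> y) \<oplus> x"
    using assms a by auto
  moreover have "?l \<sqsubseteq> (x \<sqinter> y) \<oplus> z"
    using assms a[of z] l by (simp add: plus_comm[of "x \<sqinter> y"] plus_meet_distrib plus_comm[of z])
      (auto intro!: meet_greatest)
  ultimately show ?thesis
    using assms l by (auto simp: plus_meet_distrib intro!: meet_greatest)
qed

text \<open>Annihilators are closed under \<open>\<oplus>\<close>; multiples of disjoint elements
  thus stay disjoint, and suprema of annihilators can be idempotent.\<close>

lemma disjoint_plus: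
  assumes "x \<in> C" "y \<in> C" "z \<in> C" "x \<sqinter> y = \<zero>" "x \<sqinter> z = \<zero>" shows "x \<sqinter> (y \<oplus> z) = \<zero>"
  using meet_plus_le[of x y z] assms by (simp add: le_zero)

fun mult :: "nat \<Rightarrow> 'a \<Rightarrow> 'a" where
  "mult 0 x = \<zero>" | "mult (Suc n) x = x \<oplus> mult n x"

lemma mult_closed [simp]: "x \<in> C \<Longrightarrow> mult n x \<in> C"
  by (induction n) auto

lemma mult_add: "x \<in> C \<Longrightarrow> mult (m + n) x = mult m x \<oplus> mult n x"
  by (induction m) (auto simp: plus_assoc)

lemma mult_mono_nat: "x \<in> C \<Longrightarrow> m \<le> n \<Longrightarrow> mult m x \<sqsubseteq> mult n x"
  using mult_add[of x m "n - m"] by simp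

lemma disjoint_mult:
  assumes "x \<in> C" "y \<in> C" "x \<sqinter> y = \<zero>" shows "x \<sqinter> mult n y = \<zero>"
proof (induction n)
  case 0
  show ?case using assms meet_le(2)[of x \<zero>] by (simp add: le_zero)
next
  case (Suc n)
  then show ?case using assms by (simp add: disjoint_plus)
qed

lemma disjoint_mult_mult:
  assumes "x \<in> C" "y \<in> C" "x \<sqinter> y = \<zero>" shows "mult m x \<sqinter> mult n y = \<zero>"
  using disjoint_mult[of "mult n y" x m] disjoint_mult[of x y n] assms by (simp add: meet_comm)

section \<open>Ideals and primeness of maximal ideals\<close>

lemma idealD:
  assumes "mv_ideal M I"
  shows "I \<subseteq> C" "\<zero> \<in> I" "a \<in> I \<Longrightarrow> b \<in> I \<Longrightarrow> a \<oplus> b \<in> I"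
    "a \<in> I \<Longrightarrow> b \<in> C \<Longrightarrow> b \<sqsubseteq> a \<Longrightarrow> b \<in> I"
  using assms unfolding mv_ideal_def by auto

lemma ideal_one: "mv_ideal M I \<Longrightarrow> \<one> \<in> I \<Longrightarrow> I = C"
  using idealD[of I] le_one by blast

lemma maximalD:
  assumes "mv_maximal_ideal M m"
  shows "mv_ideal M m" "\<one> \<notin> m" "m \<subseteq> C"
  using assms ideal_one idealD(1)[of m] unfolding mv_maximal_ideal_def by auto

lemma maximal_sum:
  assumes m: "mv_maximal_ideal M m" and a: "a \<in> C" "a \<notin> m"
  obtains n c where "c \<in> m" "mult n a \<oplus> c = \<one>"
proof -
  note mi = maximalD[OF m] and mI = idealD[OF maximalD(1)[OF m]]
  \<comment> \<open>The ideal generated by \<open>m\<close> and \<open>a\<close>; by maximality it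
    is everything and so contains \<open>\<one>\<close>.\<close>
  define J where "J = {x \<in> C. \<exists>n. \<exists>c\<in>m. x \<sqsubseteq> mult n a \<oplus> c}"
  have memC: "c \<in> C" if "c \<in> m" for c using that mi by auto
  have "mv_ideal M J"
    unfolding mv_ideal_def
  proof (intro conjI ballI impI)
    show "J \<subseteq> C" by (auto simp: J_def)
    show "\<zero> \<in> J" using mI(2) a by (auto simp: J_def intro!: exI[of _ 0] bexI[of _ \<zero>])
    fix x assume x: "x \<in> J"
    show "y \<in> J" if y: "y \<in> C" "y \<sqsubseteq> x" for y
    proof -
      from x obtain n c where *: "c \<in> m" "x \<sqsubseteq> mult n a \<oplus> c" "x \<in> C" by (auto simp: J_def)
      then have "y \<sqsubseteq> mult n a \<oplus> c" using y a memC le_trans[of y x "mult n a \<oplus> c"] by auto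
      then show ?thesis using y * by (auto simp: J_def)
    qed
    show "x \<oplus> y \<in> J" if y: "y \<in> J" for y
    proof -
      from x obtain n c where 1: "c \<in> m" "x \<sqsubseteq> mult n a \<oplus> c" "x \<in> C" by (auto simp: J_def)
      from y obtain k d where 2: "d \<in> m" "y \<sqsubseteq> mult k a \<oplus> d" "y \<in> C" by (auto simp: J_def)
      have "x \<oplus> y \<sqsubseteq> (mult n a \<oplus> c) \<oplus> (mult k a \<oplus> d)"
        using 1 2 a memC by (auto intro!: plus_mono)
      also have "\<dots> = mult (n + k) a \<oplus> (c \<oplus> d)"
        using 1 2 a memC by (simp add: mult_add plus_ac)
      finally show ?thesis using 1 2 mI(3)[of c d] by (auto simp: J_def)
    qed
  qed
  moreover have "m \<subseteq> J"
  proof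
    fix x assume "x \<in> m"
    then show "x \<in> J" using memC[of x] by (auto simp: J_def intro!: exI[of _ 0] bexI[of _ x])
  qed
  moreover have "a \<in> J"
    using a mI(2) by (auto simp: J_def intro!: exI[of _ 1] bexI[of _ \<zero>])
  ultimately have "J = C"
    using m a unfolding mv_maximal_ideal_def by blast
  then obtain n c where *: "c \<in> m" "\<one> \<sqsubseteq> mult n a \<oplus> c"
    unfolding J_def using one_closed by blast
  then have "mult n a \<oplus> c = \<one>"
    using memC a by (intro le_antisym) auto
  then show ?thesis using * that by blast
qed

text \<open>If both elements were outside \<open>m\<close>, some \<open>c \<oplus> d\<close> in
  \<open>m\<close> would reach \<open>\<one>\<close> with a multiple of \<open>a\<close> and with a
  multiple of \<open>b\<close>. These multiples are still disjoint, so distributing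
  \<open>\<oplus>\<close> over their meet gives \<open>c \<oplus> d = \<one>\<close>.\<close>

lemma maximal_prime:
  assumes m: "mv_maximal_ideal M m" and ab: "a \<in> C" "b \<in> C" "a \<sqinter> b = \<zero>"
  shows "a \<in> m \<or> b \<in> m"
proof (rule ccontr)
  assume "\<not> ?thesis"
  then obtain n c k d where cd: "c \<in> m" "mult n a \<oplus> c = \<one>" "d \<in> m" "mult k b \<oplus> d = \<one>"
    using maximal_sum[OF m ab(1)] maximal_sum[OF m ab(2)] by metis
  note mI = idealD[OF maximalD(1)[OF m]]
  have C: "c \<in> C" "d \<in> C" using cd mI by auto
  have 1: "(c \<oplus> d) \<oplus> mult n a = \<one>"
    using C ab cd by (metis plus_comm plus_assoc mult_closed plus_one)
  have 2: "(c \<oplus> d) \<oplus> mult k b = \<one>"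
    using C ab cd by (metis plus_comm plus_assoc mult_closed plus_one)
  have "c \<oplus> d = (c \<oplus> d) \<oplus> (mult n a \<sqinter> mult k b)"
    using ab C by (simp add: disjoint_mult_mult)
  also have "\<dots> = \<one>"
    using C ab by (subst plus_meet_distrib) (simp_all add: 1 2 meet_absorb)
  finally show False
    using mI(3)[OF cd(1,3)] maximalD[OF m] by simp
qed

end

section \<open>Embedding simple quotients into the unit interval\<close>

lemma (in mv_alg) minus_eq_zero: "x \<in> C \<Longrightarrow> y \<in> C \<Longrightarrow> x \<sqsubseteq> y \<Longrightarrow> x \<ominus> y = \<zero>"
  using minus_le_iff[of x y \<zero>] by (simp add: le_zero)

locale mv_maximal = mv_alg +
  fixes m assumes m: "mv_maximal_ideal M m"
begin

text \<open>The order of the quotient by \<open>m\<close>, pulled back to \<open>M\<close> so that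
  no quotient algebra has to be formed. It is total because \<open>m\<close> is prime.\<close>

definition pre (infix "\<preceq>" 50) where "x \<preceq> y \<longleftrightarrow> x \<ominus> y \<in> m"

lemmas mI = idealD[OF maximalD(1)[OF m]]

lemma pre_le: "x \<in> C \<Longrightarrow> y \<in> C \<Longrightarrow> x \<sqsubseteq> y \<Longrightarrow> x \<preceq> y"
  by (simp add: pre_def minus_eq_zero mI(2))

lemma pre_refl [simp]: "x \<in> C \<Longrightarrow> x \<preceq> x"
  by (simp add: pre_le)

lemma pre_zero: "x \<in> C \<Longrightarrow> x \<preceq> \<zero> \<longleftrightarrow> x \<in> m"
  by (simp add: pre_def)

lemma zero_pre [simp]: "x \<in> C \<Longrightarrow> \<zero> \<preceq> x"
  by (simp add: pre_le)

lemma pre_one [simp]: "x \<in> C \<Longrightarrow> x \<preceq> \<one>"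
  by (simp add: pre_le)

lemma not_one_pre_zero: "\<not> \<one> \<preceq> \<zero>"
  using maximalD[OF m] by (simp add: pre_zero)

lemma pre_trans:
  assumes "x \<in> C" "y \<in> C" "z \<in> C" "x \<preceq> y" "y \<preceq> z" shows "x \<preceq> z"
proof -
  have "y \<sqsubseteq> z \<oplus> (y \<ominus> z)" "x \<sqsubseteq> y \<oplus> (x \<ominus> y)"
    using assms by (auto simp: le_plus_minus)
  then have "x \<sqsubseteq> (z \<oplus> (y \<ominus> z)) \<oplus> (x \<ominus> y)"
    using assms le_trans[of x "y \<oplus> (x \<ominus> y)" "(z \<oplus> (y \<ominus> z)) \<oplus> (x \<ominus> y)"]
      plus_mono[of y "z \<oplus> (y \<ominus> z)" "x \<ominus> y" "x \<ominus> y"] by simp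
  then have "x \<ominus> z \<sqsubseteq> (y \<ominus> z) \<oplus> (x \<ominus> y)"
    using assms by (simp add: minus_le_iff plus_assoc)
  then show ?thesis
    using assms mI(4)[OF mI(3), of "y \<ominus> z" "x \<ominus> y" "x \<ominus> z"] by (simp add: pre_def)
qed

lemma pre_plus_mono:
  assumes "x \<in> C" "y \<in> C" "z \<in> C" "x \<preceq> y" shows "x \<oplus> z \<preceq> y \<oplus> z"
proof -
  have "x \<oplus> z \<sqsubseteq> (y \<oplus> (x \<ominus> y)) \<oplus> z"
    using assms by (auto intro!: plus_mono le_plus_minus)
  also have "\<dots> = (y \<oplus> z) \<oplus> (x \<ominus> y)"
    using assms by (simp add: plus_ac)
  finally have "(x \<oplus> z) \<ominus> (y \<oplus> z) \<sqsubseteq> x \<ominus> y"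
    using assms by (simp add: minus_le_iff)
  then show ?thesis
    using assms mI(4) by (simp add: pre_def)
qed

lemma pre_plus_mono2:
  assumes "x \<in> C" "y \<in> C" "z \<in> C" "w \<in> C" "x \<preceq> y" "z \<preceq> w" shows "x \<oplus> z \<preceq> y \<oplus> w"
  using assms pre_plus_mono[of x y z] pre_plus_mono[of z w y]
    pre_trans[of "x \<oplus> z" "y \<oplus> z" "y \<oplus> w"] by (simp add: plus_comm[of z] plus_comm[of w])

lemma pre_neg: "x \<in> C \<Longrightarrow> y \<in> C \<Longrightarrow> x \<preceq> y \<Longrightarrow> neg y \<preceq> neg x"
  by (simp add: pre_def ominus_def plus_comm)

lemma pre_neg_swap: "x \<in> C \<Longrightarrow> y \<in> C \<Longrightarrow> x \<preceq> neg y \<longleftrightarrow> y \<preceq> neg x"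
  by (simp add: pre_def ominus_def plus_comm)

lemma pre_total: "x \<in> C \<Longrightarrow> y \<in> C \<Longrightarrow> x \<preceq> y \<or> y \<preceq> x"
  using maximal_prime[OF m, of "x \<ominus> y" "y \<ominus> x"] prelinear[of x y] by (simp add: pre_def)

lemma archimedean:
  assumes "a \<in> C" "a \<notin> m" obtains n where "\<one> \<preceq> mult n a"
proof -
  obtain n c where c: "c \<in> m" "mult n a \<oplus> c = \<one>"
    using maximal_sum[OF m assms] by blast
  then have "\<one> \<ominus> mult n a \<sqsubseteq> c"
    using assms mI(1) by (subst minus_le_iff) auto
  then have "\<one> \<preceq> mult n a"
    using mI(4)[OF c(1)] assms by (simp add: pre_def)
  then show ?thesis by (rule that)
qed

text \<open>The hypothesis \<open>a \<preceq> neg b\<close> says that \<open>a \<oplus> b\<close> is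
  not truncated modulo \<open>m\<close>. Subtracting \<open>b\<close> from a sum
  \<open>z \<oplus> b\<close> leaves the meet of \<open>z\<close> and \<open>neg b\<close>, which is
  \<open>a\<close> modulo \<open>m\<close> on the left and at most \<open>x\<close> on the
  right.\<close>

lemma pre_cancel:
  assumes "x \<in> C" "a \<in> C" "b \<in> C" "a \<preceq> neg b" "a \<oplus> b \<preceq> x \<oplus> b" shows "a \<preceq> x"
proof -
  have eq: "(z \<oplus> b) \<ominus> b = z \<ominus> (z \<ominus> neg b)" if "z \<in> C" for z
    using that assms plus_minus_meet[of b z] by (simp add: plus_comm meet_eq)
  have "a \<ominus> ((a \<oplus> b) \<ominus> b) \<sqsubseteq> a \<ominus> neg b"
    using assms by (simp add: eq meet_eq[of a "a \<ominus> neg b"])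
  then have "a \<preceq> (a \<oplus> b) \<ominus> b"
    using assms mI(4)[of "a \<ominus> neg b" "a \<ominus> ((a \<oplus> b) \<ominus> b)"] by (simp add: pre_def)
  moreover have "(a \<oplus> b) \<ominus> b \<preceq> (x \<oplus> b) \<ominus> b"
  proof -
    have "neg (x \<oplus> b) \<preceq> neg (a \<oplus> b)" using assms by (simp add: pre_neg)
    then have "neg (x \<oplus> b) \<oplus> b \<preceq> neg (a \<oplus> b) \<oplus> b" using assms by (simp add: pre_plus_mono)
    then show ?thesis using assms unfolding ominus_def by (intro pre_neg) simp_all
  qed
  moreover have "(x \<oplus> b) \<ominus> b \<preceq> x"
    using assms by (intro pre_le) (auto simp: eq)
  ultimately show ?thesis
    using assms pre_trans[of a "(a \<oplus> b) \<ominus> b" "(x \<oplus> b) \<ominus> b"] pre_trans[of a "(x \<oplus> b) \<ominus> b" x]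
    by simp
qed

section \<open>Counting multiples of a unit\<close>

lemma minus_plus_pre:
  assumes "x \<in> C" "y \<in> C" "y \<preceq> x" shows "(x \<ominus> y) \<oplus> y \<preceq> x"
proof -
  have "(x \<ominus> y) \<oplus> y = (y \<ominus> x) \<oplus> x"
    using assms join_comm[of x y] by (simp add: join_eq)
  moreover have "(y \<ominus> x) \<oplus> x \<preceq> \<zero> \<oplus> x"
    using assms by (intro pre_plus_mono) (auto simp: pre_def)
  ultimately show ?thesis using assms by simp
qed

text \<open>Size of \<open>a\<close> measured in units \<open>u\<close>, rounded up. For
  \<open>u\<close> outside \<open>m\<close> a suitable \<open>k\<close> exists by
  \<open>archimedean\<close>.\<close>

definition cnt :: "'a \<Rightarrow> 'a \<Rightarrow> nat" where "cnt u a = (LEAST k. a \<preceq> mult k u)"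

context
  fixes u assumes u: "u \<in> C" "u \<notin> m"
begin

lemma cnt_pre: assumes "a \<in> C" shows "a \<preceq> mult (cnt u a) u"
proof -
  obtain n where "\<one> \<preceq> mult n u" using archimedean[OF u] .
  then have "a \<preceq> mult n u" using assms u pre_trans[of a \<one> "mult n u"] by simp
  then show ?thesis unfolding cnt_def by (rule LeastI)
qed

lemma cnt_le: "a \<preceq> mult k u \<Longrightarrow> cnt u a \<le> k"
  unfolding cnt_def by (rule Least_le)

lemma cnt_mono: "a \<in> C \<Longrightarrow> b \<in> C \<Longrightarrow> a \<preceq> b \<Longrightarrow> cnt u a \<le> cnt u b"
  using cnt_le[of a "cnt u b"] pre_trans[of a b "mult (cnt u b) u"] cnt_pre[of b] u by simp

lemma cnt_one: "0 < cnt u \<one>"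
  using cnt_pre[of \<one>] not_one_pre_zero by (intro Nat.gr0I) auto

lemma cnt_plus_le: "a \<in> C \<Longrightarrow> b \<in> C \<Longrightarrow> cnt u (a \<oplus> b) \<le> cnt u a + cnt u b"
  using u by (intro cnt_le) (auto simp: mult_add intro!: pre_plus_mono2 cnt_pre)

lemma mult_pre_mono: "i \<le> j \<Longrightarrow> mult i u \<preceq> mult j u"
  using u by (intro pre_le mult_mono_nat) auto

lemma cnt_gt: assumes "a \<in> C" "k < cnt u a" shows "\<not> a \<preceq> mult k u" "mult k u \<preceq> a"
proof -
  show 1: "\<not> a \<preceq> mult k u" using cnt_le[of a k] assms by auto
  show "mult k u \<preceq> a" using pre_total[of a "mult k u"] assms u 1 by auto
qed

text \<open>Rounding up loses at most one unit: if \<open>A\<close> and \<open>B\<close> are one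
  less than the two counts, then \<open>A\<close> units do not cover \<open>a\<close> and
  \<open>B\<close> units lie below \<open>b\<close>, so by cancellation \<open>A + B\<close> units
  cannot cover the sum.\<close>

lemma cnt_plus_ge:
  assumes "a \<in> C" "b \<in> C" "a \<preceq> neg b" shows "cnt u a + cnt u b \<le> cnt u (a \<oplus> b) + 1"
proof -
  consider "cnt u a = 0" | "cnt u b = 0" | A B where "cnt u a = Suc A" "cnt u b = Suc B"
    by (metis not0_implies_Suc)
  then show ?thesis
  proof cases
    case 1
    then show ?thesis using assms cnt_mono[of b "a \<oplus> b"] by (simp add: pre_le)
  next
    case 2
    then show ?thesis using assms cnt_mono[of a "a \<oplus> b"] by (simp add: pre_le)
  next
    case (3 A B)
    have A: "\<not> a \<preceq> mult A u" and B: "mult B u \<preceq> b" using cnt_gt 3 assms by auto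
    have "\<not> a \<oplus> b \<preceq> mult (A + B) u"
    proof
      assume "a \<oplus> b \<preceq> mult (A + B) u"
      moreover have "mult (A + B) u \<preceq> mult A u \<oplus> b"
        using u B assms by (auto simp: mult_add intro!: pre_plus_mono2)
      ultimately have "a \<oplus> b \<preceq> mult A u \<oplus> b"
        using u assms by (meson pre_trans mult_closed plus_closed)
      then show False using pre_cancel[of "mult A u" a b] assms u A by auto
    qed
    then have "A + B < cnt u (a \<oplus> b)"
      using cnt_pre[of "a \<oplus> b"] mult_pre_mono[of "cnt u (a \<oplus> b)" "A + B"] assms u
      by (meson not_le pre_trans mult_closed plus_closed)
    then show ?thesis using 3 by simp
  qed
qed

text \<open>When the class of \<open>u\<close> is the least nonzero one, every element is an exact
  multiple of \<open>u\<close> modulo \<open>m\<close>, so nothing is lost by rounding.\<close>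

lemma cnt_plus_atom:
  assumes atom: "\<And>x. x \<in> C \<Longrightarrow> x \<notin> m \<Longrightarrow> u \<preceq> x"
    and ab: "a \<in> C" "b \<in> C" "a \<preceq> neg b" shows "cnt u a + cnt u b = cnt u (a \<oplus> b)"
proof (rule antisym)
  show "cnt u (a \<oplus> b) \<le> cnt u a + cnt u b" using ab by (intro cnt_plus_le)
  have A: "mult (cnt u a) u \<preceq> a"
  proof (cases "cnt u a")
    case (Suc A)
    then have *: "\<not> a \<preceq> mult A u" "mult A u \<preceq> a" using cnt_gt ab by auto
    then have "u \<preceq> a \<ominus> mult A u" using atom u ab by (simp add: pre_def)
    then have "u \<oplus> mult A u \<preceq> (a \<ominus> mult A u) \<oplus> mult A u" using u ab by (simp add: pre_plus_mono)
    then show ?thesis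
      using Suc u ab * minus_plus_pre[of a "mult A u"] pre_trans[of "u \<oplus> mult A u" "(a \<ominus> mult A u) \<oplus> mult A u" a]
      by simp
  qed (use ab in auto)
  show "cnt u a + cnt u b \<le> cnt u (a \<oplus> b)"
  proof (cases "cnt u b")
    case 0
    then show ?thesis using ab cnt_mono[of a "a \<oplus> b"] by (simp add: pre_le)
  next
    case (Suc B)
    let ?A = "cnt u a"
    have "\<not> a \<oplus> b \<preceq> mult (?A + B) u"
    proof
      assume "a \<oplus> b \<preceq> mult (?A + B) u"
      moreover have "mult (?A + B) u \<preceq> a \<oplus> mult B u"
        using u A ab by (auto simp: mult_add intro!: pre_plus_mono2)
      ultimately have "a \<oplus> b \<preceq> a \<oplus> mult B u"
        using u ab by (meson pre_trans mult_closed plus_closed)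
      then have "b \<oplus> a \<preceq> mult B u \<oplus> a" using u ab by (simp add: plus_comm)
      moreover have "b \<preceq> neg a" using ab by (simp add: pre_neg_swap)
      ultimately show False using pre_cancel[of "mult B u" b a] cnt_gt[of b B] ab u Suc by auto
    qed
    then have "?A + B < cnt u (a \<oplus> b)"
      using cnt_pre[of "a \<oplus> b"] mult_pre_mono[of "cnt u (a \<oplus> b)" "?A + B"] ab u
      by (meson not_le pre_trans mult_closed plus_closed)
    then show ?thesis using Suc by simp
  qed
qed

end

text \<open>Normalised and additive up to \<eta> on sums that are not truncated in the quotient. For
  \<eta> = \<open>0\<close> these are the homomorphisms into the unit interval with kernel
  \<open>m\<close> (\<open>hom_exact\<close>, \<open>exact_hom\<close>).\<close>

definition approx_state :: "real \<Rightarrow> ('a \<Rightarrow> real) \<Rightarrow> bool" where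
  "approx_state \<eta> s \<longleftrightarrow> (\<forall>a\<in>C. 0 \<le> s a \<and> s a \<le> 1) \<and> s \<one> = 1 \<and>
     (\<forall>a\<in>C. \<forall>b\<in>C. a \<preceq> neg b \<longrightarrow> \<bar>s (a \<oplus> b) - s a - s b\<bar> \<le> \<eta>)"

lemma approx_state_mono: "approx_state \<eta> s \<Longrightarrow> \<eta> \<le> \<eta>' \<Longrightarrow> approx_state \<eta>' s"
  unfolding approx_state_def by fastforce

lemma approx_state_cnt:
  fixes \<eta> :: real
  assumes u: "u \<in> C" "u \<notin> m"
    and \<eta>: "\<And>a b. a \<in> C \<Longrightarrow> b \<in> C \<Longrightarrow> a \<preceq> neg b \<Longrightarrow>
      real (cnt u a + cnt u b) \<le> cnt u (a \<oplus> b) + \<eta> * cnt u \<one>" "0 \<le> \<eta>"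
  shows "approx_state \<eta> (\<lambda>a. cnt u a / cnt u \<one>)"
  unfolding approx_state_def
proof (intro conjI ballI impI)
  have pos: "0 < real (cnt u \<one>)" using cnt_one[OF u] by simp
  fix a assume a: "a \<in> C"
  show "0 \<le> real (cnt u a) / real (cnt u \<one>)" by simp
  show "real (cnt u a) / real (cnt u \<one>) \<le> 1" using cnt_mono[OF u a, of \<one>] a pos by simp
  fix b assume b: "b \<in> C" "a \<preceq> neg b"
  have "\<bar>real (cnt u (a \<oplus> b)) - real (cnt u a) - real (cnt u b)\<bar> \<le> \<eta> * real (cnt u \<one>)"
  proof -
    have "0 \<le> \<eta> * real (cnt u \<one>)" using \<eta>(2) pos by simp
    moreover have "real (cnt u (a \<oplus> b)) \<le> real (cnt u a) + real (cnt u b)"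
      using cnt_plus_le[OF u a b(1)] by linarith
    ultimately show ?thesis using \<eta>(1)[OF a b] by linarith
  qed
  then show "\<bar>real (cnt u (a \<oplus> b)) / real (cnt u \<one>) - real (cnt u a) / real (cnt u \<one>)
      - real (cnt u b) / real (cnt u \<one>)\<bar> \<le> \<eta>"
    using pos by (simp add: pos_divide_le_eq flip: diff_divide_distrib)
qed (use cnt_one[OF u] in simp)

text \<open>Without a least positive class, some \<open>x\<close> lies strictly between
  \<open>0\<close> and \<open>u\<close> in the quotient; the smaller one, \<open>v\<close>, of
  \<open>x\<close> and \<open>u \<ominus> x\<close> satisfies
  \<open>v \<oplus> v \<preceq> u\<close>. Replacing \<open>u\<close> by \<open>v\<close> therefore
  raises the number of copies needed to cover \<open>\<one>\<close>.\<close>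

lemma small_unit:
  assumes "\<And>u. u \<in> C \<Longrightarrow> u \<notin> m \<Longrightarrow> \<exists>x\<in>C. x \<notin> m \<and> \<not> u \<preceq> x"
  shows "\<exists>u\<in>C. u \<notin> m \<and> \<not> \<one> \<preceq> mult n u"
proof (induction n)
  case 0
  show ?case using not_one_pre_zero maximalD[OF m] by (auto intro!: bexI[of _ \<one>])
next
  case (Suc n)
  then obtain u where u: "u \<in> C" "u \<notin> m" "\<not> \<one> \<preceq> mult n u" by blast
  then obtain x where x: "x \<in> C" "x \<notin> m" "\<not> u \<preceq> x" using assms by blast
  define w where "w = u \<ominus> x"
  have w: "w \<in> C" "w \<notin> m" using u x by (auto simp: w_def pre_def)
  have xu: "x \<preceq> u" using pre_total u x by blast
  obtain v where v: "v \<in> C" "v \<notin> m" "v \<preceq> x" "v \<preceq> w"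
    using pre_total[of x w] x w pre_refl by metis
  have vv: "v \<oplus> v \<preceq> u"
  proof -
    have "v \<oplus> v \<preceq> w \<oplus> x" using v w x by (intro pre_plus_mono2) auto
    moreover have "w \<oplus> x \<preceq> u" unfolding w_def using u x xu by (intro minus_plus_pre) auto
    ultimately show ?thesis using u v w x pre_trans[of "v \<oplus> v" "w \<oplus> x" u] by auto
  qed
  \<comment> \<open>One \<open>u\<close> absorbs two copies of \<open>v\<close>, each further
    \<open>u\<close> one copy: a gain of one is all that the induction needs.\<close>
  have *: "mult (Suc (Suc k)) v \<preceq> mult (Suc k) u" for k
  proof (induction k)
    case 0
    show ?case using vv v u by simp
  next
    case (Suc k)
    have "v \<preceq> u" using pre_trans[of v x u] v x u xu by auto
    then have "v \<oplus> mult (Suc (Suc k)) v \<preceq> u \<oplus> mult (Suc k) u"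
      using v u Suc.IH by (intro pre_plus_mono2) auto
    then show ?case by simp
  qed
  have "\<not> \<one> \<preceq> mult (Suc n) v"
  proof
    assume a: "\<one> \<preceq> mult (Suc n) v"
    show False
    proof (cases n)
      case 0
      then have "\<one> \<preceq> x" using a v x pre_trans[of \<one> v x] by auto
      then show False using x u pre_trans[of u \<one> x] by auto
    next
      case (Suc k)
      then have "\<one> \<preceq> mult n u"
        using a *[of k] pre_trans[of \<one> "mult (Suc n) v" "mult n u"] v u by simp
      then show False using u by simp
    qed
  qed
  then show ?case using v by blast
qed

lemma approx_state_exists: assumes "0 < \<eta>" shows "\<exists>s. approx_state \<eta> s"
proof (cases "\<exists>u\<in>C. u \<notin> m \<and> (\<forall>x\<in>C. x \<notin> m \<longrightarrow> u \<preceq> x)")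
  case True
  then obtain u where "u \<in> C" "u \<notin> m" "\<And>x. x \<in> C \<Longrightarrow> x \<notin> m \<Longrightarrow> u \<preceq> x" by blast
  then show ?thesis
    using assms by (intro exI[of _ "\<lambda>a. cnt u a / cnt u \<one>"] approx_state_cnt[of u]) (auto simp: cnt_plus_atom)
next
  case False
  then have small: "\<exists>x\<in>C. x \<notin> m \<and> \<not> u \<preceq> x" if "u \<in> C" "u \<notin> m" for u using that by blast
  obtain n :: nat where n: "1 / \<eta> < n" using reals_Archimedean2 by blast
  obtain u where u: "u \<in> C" "u \<notin> m" "\<not> \<one> \<preceq> mult n u" using small_unit[OF small] by blast
  have "n < cnt u \<one>"
    using cnt_pre[OF u(1,2), of \<one>] mult_pre_mono[OF u(1,2), of "cnt u \<one>" n] u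
    by (meson not_le pre_trans mult_closed one_closed)
  then have "1 / \<eta> < cnt u \<one>" using n by linarith
  \<comment> \<open>The rounding error of one unit becomes at most \<eta> after division by
    \<open>cnt u \<one>\<close>.\<close>
  then have 1: "1 \<le> \<eta> * cnt u \<one>" using assms by (simp add: field_simps)
  have "approx_state \<eta> (\<lambda>a. cnt u a / cnt u \<one>)"
  proof (rule approx_state_cnt[OF u(1,2)])
    fix a b assume "a \<in> C" "b \<in> C" "a \<preceq> neg b"
    from cnt_plus_ge[OF u(1,2) this]
    show "real (cnt u a + cnt u b) \<le> cnt u (a \<oplus> b) + \<eta> * cnt u \<one>" using 1 by linarith
  qed (use assms in simp)
  then show ?thesis by blast
qed

text \<open>Doubling: if \<open>a \<preceq> neg a\<close>, the values at \<open>a\<close> are half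
  those at \<open>a \<oplus> a\<close> up to \<eta>; otherwise the same holds for
  \<open>neg a\<close>, whose values are complementary up to \<eta>. Each round halves the
  discrepancy.\<close>

lemma approx_state_close:
  assumes s: "approx_state \<eta> s" and t: "approx_state \<eta> t" and a: "a \<in> C"
  shows "\<bar>s a - t a\<bar> \<le> 6 * \<eta>"
proof -
  have ss: "0 \<le> s a" "s a \<le> 1" "0 \<le> t a" "t a \<le> 1" if "a \<in> C" for a
    using s t that unfolding approx_state_def by auto
  have \<eta>: "0 \<le> \<eta>"
    using s unfolding approx_state_def by (smt (verit) zero_pre neg_closed one_closed zero_closed)
  have add: "\<bar>s (a \<oplus> b) - s a - s b\<bar> \<le> \<eta>" "\<bar>t (a \<oplus> b) - t a - t b\<bar> \<le> \<eta>"
    if "a \<in> C" "b \<in> C" "a \<preceq> neg b" for a b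
    using s t that unfolding approx_state_def by auto
  have *: "\<bar>s a - t a\<bar> \<le> 1 / 2 ^ k + 6 * \<eta>" if "a \<in> C" for k a
    using that
  proof (induction k arbitrary: a)
    case 0
    then show ?case using ss[of a] \<eta> by simp
  next
    case (Suc k)
    \<comment> \<open>Halving adds \<eta> and reflection another \<open>2 * \<eta>\<close>, and
      \<open>6 * \<eta>\<close> is the fixed point of the resulting map from \<open>D\<close> to
      \<open>D / 2 + 3 * \<eta>\<close>.\<close>
    define D where "D = 1 / 2 ^ k + 6 * \<eta>"
    have half: "\<bar>s a - t a\<bar> \<le> D / 2 + \<eta>" if "a \<in> C" "a \<preceq> neg a" for a
    proof -
      have "\<bar>s (a \<oplus> a) - t (a \<oplus> a)\<bar> \<le> D"
        using Suc.IH[of "a \<oplus> a"] that by (simp add: D_def)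
      then show ?thesis using add[OF that(1) that] by linarith
    qed
    have D: "D / 2 + 3 * \<eta> = 1 / 2 ^ Suc k + 6 * \<eta>"
      by (simp add: D_def field_simps)
    show ?case
    proof (cases "a \<preceq> neg a")
      case True
      then show ?thesis using half[OF Suc.prems] \<eta> D by linarith
    next
      case False
      then have "neg a \<preceq> neg (neg a)"
        using pre_total[of a "neg a"] Suc.prems by simp
      then have "\<bar>s (neg a) - t (neg a)\<bar> \<le> D / 2 + \<eta>" using half Suc.prems by simp
      moreover have "\<bar>1 - s a - s (neg a)\<bar> \<le> \<eta>" "\<bar>1 - t a - t (neg a)\<bar> \<le> \<eta>"
        using add[of a "neg a"] Suc.prems s t by (auto simp: approx_state_def)
      ultimately show ?thesis using D by linarith
    qed
  qed
  have "(\<lambda>k. 1 / 2 ^ k + 6 * \<eta>) \<longlonglongrightarrow> 0 + 6 * \<eta>"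
    by (intro tendsto_add tendsto_const LIMSEQ_divide_realpow_zero) simp
  then show ?thesis
    using *[OF a] by (intro LIMSEQ_le_const[where X = "\<lambda>k. 1 / 2 ^ k + 6 * \<eta>"]) auto
qed

text \<open>Approximate states with errors tending to \<open>0\<close> are pointwise Cauchy by
  \<open>approx_state_close\<close>, and the error vanishes in the limit.\<close>

lemma exact_state_exists: "\<exists>h. approx_state 0 h"
proof -
  have "\<exists>s. approx_state (1 / Suc n) s" for n by (rule approx_state_exists) simp
  then obtain s where s: "\<And>n. approx_state (1 / Suc n) (s n)" by metis
  have "Cauchy (\<lambda>n. s n a)" if a: "a \<in> C" for a
  proof (rule metric_CauchyI)
    fix e :: real assume "0 < e"
    obtain N :: nat where "6 / e < N" using reals_Archimedean2 by blast
    then have "6 < N * e" using \<open>0 < e\<close> by (simp add: pos_divide_less_eq)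
    then have N: "6 / real (Suc N) < e" using \<open>0 < e\<close> by (simp add: pos_divide_less_eq algebra_simps)
    have "approx_state (1 / Suc N) (s n)" if "N \<le> n" for n
      using that by (intro approx_state_mono[OF s]) (simp add: frac_le)
    then have "\<bar>s i a - s j a\<bar> \<le> 6 / Suc N" if "N \<le> i" "N \<le> j" for i j
      using that a approx_state_close[of "1 / Suc N" "s i" "s j" a] by simp
    then show "\<exists>N. \<forall>i\<ge>N. \<forall>j\<ge>N. dist (s i a) (s j a) < e"
      using N by (intro exI[of _ N]) (auto simp: dist_real_def intro: le_less_trans)
  qed
  then have "convergent (\<lambda>n. s n a)" if "a \<in> C" for a
    using that Cauchy_convergent by blast
  then obtain h where h: "\<And>a. a \<in> C \<Longrightarrow> (\<lambda>n. s n a) \<longlonglongrightarrow> h a"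
    unfolding convergent_def by metis
  have "approx_state 0 h"
    unfolding approx_state_def
  proof (intro conjI ballI impI)
    fix a assume a: "a \<in> C"
    show "0 \<le> h a" "h a \<le> 1"
      using s a unfolding approx_state_def
      by (auto intro!: LIMSEQ_le_const[OF h] LIMSEQ_le_const2[OF h])
    fix b assume b: "b \<in> C" "a \<preceq> neg b"
    have "(\<lambda>n. \<bar>s n (a \<oplus> b) - s n a - s n b\<bar>) \<longlonglongrightarrow> \<bar>h (a \<oplus> b) - h a - h b\<bar>"
      using a b by (intro tendsto_intros h) auto
    moreover have "(\<lambda>n. 1 / real (Suc n)) \<longlonglongrightarrow> 0"
      using LIMSEQ_inverse_real_of_nat by (simp add: inverse_eq_divide)
    moreover have "\<bar>s n (a \<oplus> b) - s n a - s n b\<bar> \<le> 1 / real (Suc n)" for n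
      using s[of n] a b unfolding approx_state_def by auto
    ultimately show "\<bar>h (a \<oplus> b) - h a - h b\<bar> \<le> 0"
      by (intro LIMSEQ_le) auto
  next
    have "(\<lambda>n. s n \<one>) = (\<lambda>n. 1)" using s unfolding approx_state_def by auto
    then show "h \<one> = 1" using h[of \<one>] by (simp add: LIMSEQ_const_iff)
  qed
  then show ?thesis by blast
qed

end

section \<open>Homomorphisms into the unit interval and their kernels\<close>

lemma unit_hom_iff:
  "mv_hom M unit_mv h \<longleftrightarrow> (\<forall>x\<in>mv_carrier M. 0 \<le> h x \<and> h x \<le> 1) \<and>
     (\<forall>x\<in>mv_carrier M. \<forall>y\<in>mv_carrier M. h (mv_plus M x y) = min 1 (h x + h y)) \<and>
     (\<forall>x\<in>mv_carrier M. h (mv_neg M x) = 1 - h x) \<and> h (mv_zero M) = 0"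
  unfolding mv_hom_def unit_mv_def by auto

context mv_alg begin

lemma unit_hom_one: assumes "mv_hom M unit_mv h" shows "h \<one> = 1"
proof -
  have "h (neg \<zero>) = 1 - h \<zero>" "h \<zero> = 0" using assms by (simp_all add: unit_hom_iff del: neg_zero)
  then show ?thesis by simp
qed

lemma unit_hom_mult:
  assumes "mv_hom M unit_mv h" "a \<in> C" shows "h (mult n a) = min 1 (n * h a)"
proof (induction n)
  case 0
  then show ?case using assms by (simp add: unit_hom_iff)
next
  case (Suc n)
  then show ?case using assms by (auto simp: unit_hom_iff min_def algebra_simps)
qed

lemma unit_hom_kernel_maximal:
  assumes h: "mv_hom M unit_mv h" shows "mv_maximal_ideal M {x \<in> C. h x = 0}" (is "mv_maximal_ideal M ?K")
  unfolding mv_maximal_ideal_def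
proof (intro conjI allI impI)
  note h' = h[unfolded unit_hom_iff]
  show "mv_ideal M ?K"
    unfolding mv_ideal_def
  proof (intro conjI ballI impI)
    fix a b assume *: "a \<in> ?K" "b \<in> C" "b \<sqsubseteq> a"
    then have "h (neg b \<oplus> a) = 1" by (simp add: mv_le_def unit_hom_one h)
    then show "b \<in> ?K" using * h' by (auto simp: min_def split: if_splits)
  qed (use h' in auto)
  show "?K \<noteq> C"
  proof
    assume "?K = C"
    then have "\<one> \<in> ?K" by (simp only: one_closed)
    then show False using unit_hom_one[OF h] by simp
  qed
  fix J assume J: "mv_ideal M J \<and> ?K \<subseteq> J"
  show "J = ?K \<or> J = C"
  proof (rule disjCI)
    assume "J \<noteq> C"
    show "J = ?K"
    proof (rule ccontr)
      assume "J \<noteq> ?K"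
      then obtain a where a: "a \<in> J" "a \<notin> ?K" using J by auto
      then have aC: "a \<in> C" "h a > 0" using J idealD(1)[of J] h' by (auto simp: less_le)
      obtain n where n: "1 < real n * h a" using reals_Archimedean3[OF aC(2)] by blast
      \<comment> \<open>A large multiple of \<open>a\<close> has value \<open>1\<close>, so its
        complement is in the kernel and hence in \<open>J\<close>, which then contains
        \<open>\<one>\<close>.\<close>
      have "h (neg (mult n a)) = 0" using h' aC n unit_hom_mult[OF h aC(1), of n] by simp
      then have 1: "neg (mult n a) \<in> J" using J aC by auto
      have "mult k a \<in> J" for k using a(1) idealD(2,3)[of J] J by (induction k) auto
      then have "mult n a \<oplus> neg (mult n a) \<in> J" using 1 idealD(3)[of J] J by blast
      then show False using aC \<open>J \<noteq> C\<close> ideal_one[of J] J by simp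
    qed
  qed
qed

end

context mv_maximal begin

lemma hom_exact:
  assumes "mv_hom M unit_mv h" "{x \<in> C. h x = 0} = m" shows "approx_state 0 h"
  unfolding approx_state_def
proof (intro conjI ballI impI)
  fix a b assume ab: "a \<in> C" "b \<in> C" "a \<preceq> neg b"
  then have "h (a \<ominus> neg b) = 0" using assms(2) by (auto simp: pre_def)
  then show "\<bar>h (a \<oplus> b) - h a - h b\<bar> \<le> 0"
    using assms(1) ab by (auto simp: unit_hom_iff ominus_def min_def split: if_splits)
qed (use assms unit_hom_one in \<open>auto simp: unit_hom_iff\<close>)

lemma exact_hom:
  assumes h: "approx_state 0 h" shows "mv_hom M unit_mv h" "{x \<in> C. h x = 0} = m"
proof -
  have h01: "0 \<le> h a" "h a \<le> 1" if "a \<in> C" for a using h that by (auto simp: approx_state_def)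
  have add: "h (a \<oplus> b) = h a + h b" if "a \<in> C" "b \<in> C" "a \<preceq> neg b" for a b
  proof -
    have "\<bar>h (a \<oplus> b) - h a - h b\<bar> \<le> 0" using h that unfolding approx_state_def by blast
    then show ?thesis by linarith
  qed
  have h1: "h \<one> = 1" using h by (auto simp: approx_state_def)
  have neg: "h (neg a) = 1 - h a" if "a \<in> C" for a using add[of a "neg a"] that h1 by simp
  have mono: "h a \<le> h b" if "a \<in> C" "b \<in> C" "a \<preceq> b" for a b
    using add[of a "neg b"] that h01[of "a \<oplus> neg b"] neg[of b] by simp
  have h0: "h \<zero> = 0" using add[of \<zero> \<zero>] by simp
  show hom: "mv_hom M unit_mv h"
    unfolding unit_hom_iff
  proof (intro conjI ballI)
    fix x y assume xy: "x \<in> C" "y \<in> C"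
    show "h (x \<oplus> y) = min 1 (h x + h y)"
    proof (cases "x \<preceq> neg y")
      case True
      then show ?thesis using add[OF xy] h01[of "x \<oplus> y"] xy by simp
    next
      case False
      \<comment> \<open>The truncated case: by totality the sum is \<open>\<one>\<close> modulo
        \<open>m\<close>, and \<open>h x\<close> is at least \<open>1 - h y\<close>, so both sides
        are \<open>1\<close>.\<close>
      then have *: "neg y \<preceq> x" using pre_total[of x "neg y"] xy by simp
      then have "neg y \<oplus> y \<preceq> x \<oplus> y" using xy by (simp add: pre_plus_mono del: plus_neg)
      then show ?thesis
        using mono[of \<one> "x \<oplus> y"] mono[OF _ _ *] xy h1 neg[of y] h01[of "x \<oplus> y"] by simp
    qed
  qed (use h01 neg h0 in auto)
  show "{x \<in> C. h x = 0} = m"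
  proof (intro equalityI subsetI)
    fix x assume x: "x \<in> {x \<in> C. h x = 0}"
    show "x \<in> m"
    proof (rule ccontr)
      assume "x \<notin> m"
      then obtain n where "\<one> \<preceq> mult n x" using archimedean[of x] x by blast
      then show False using mono[of \<one> "mult n x"] x h1 unit_hom_mult[OF hom, of x n] by simp
    qed
  next
    fix x assume "x \<in> m"
    then show "x \<in> {x \<in> C. h x = 0}"
      using mono[of x \<zero>] h0 h01[of x] mI(1) by (auto simp: pre_zero)
  qed
qed

text \<open>Uniqueness for the definite description is \<open>approx_state_close\<close> with error
  \<open>0\<close>.\<close>

lemma star_eq:
  assumes "mv_hom M unit_mv h" "{x \<in> C. h x = 0} = m" "a \<in> C" shows "mv_star M a m = h a"
  unfolding mv_star_def
proof (rule the_equality)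
  fix r assume "\<exists>g. mv_hom M unit_mv g \<and> {x \<in> C. g x = 0} = m \<and> g a = r"
  then show "r = h a"
    using approx_state_close[OF hom_exact hom_exact[OF assms(1,2)], of _ a] assms(3) by force
qed (use assms in blast)

lemma star_props: "mv_hom M unit_mv (\<lambda>a. mv_star M a m)" "{x \<in> C. mv_star M x m = 0} = m"
proof -
  obtain h where h: "mv_hom M unit_mv h" "{x \<in> C. h x = 0} = m"
    using exact_state_exists exact_hom by blast
  have eq: "mv_star M a m = h a" if "a \<in> C" for a using star_eq[OF h that] .
  show "mv_hom M unit_mv (\<lambda>a. mv_star M a m)" using h(1) by (simp add: unit_hom_iff eq)
  show "{x \<in> C. mv_star M x m = 0} = m" using h(2) eq by auto
qed

end

section \<open>The maximal spectrum\<close>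

context mv_alg begin

lemma MaxSp_iff: "m \<in> MaxSp M \<longleftrightarrow> mv_maximal_ideal M m"
  by (simp add: MaxSp_def)

lemma star_hom: "m \<in> MaxSp M \<Longrightarrow> mv_hom M unit_mv (\<lambda>a. mv_star M a m)"
  using mv_maximal.star_props(1)[of M m] mv_alg_axioms
  by (simp add: mv_maximal_def mv_maximal_axioms_def MaxSp_iff)

lemma star_zero_iff: "m \<in> MaxSp M \<Longrightarrow> a \<in> C \<Longrightarrow> mv_star M a m = 0 \<longleftrightarrow> a \<in> m"
  using mv_maximal.star_props(2)[of M m] mv_alg_axioms
  by (auto simp: mv_maximal_def mv_maximal_axioms_def MaxSp_iff)

lemma star_eq_hom:
  assumes "mv_hom M unit_mv h" "a \<in> C" shows "mv_star M a {x \<in> C. h x = 0} = h a"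
proof -
  interpret mv_maximal M "{x \<in> C. h x = 0}"
    by standard (rule unit_hom_kernel_maximal[OF assms(1)])
  show ?thesis using star_eq[OF assms(1) refl assms(2)] .
qed

lemma star_bounds: "m \<in> MaxSp M \<Longrightarrow> a \<in> C \<Longrightarrow> 0 \<le> mv_star M a m \<and> mv_star M a m \<le> 1"
  and star_plus: "m \<in> MaxSp M \<Longrightarrow> a \<in> C \<Longrightarrow> b \<in> C \<Longrightarrow>
    mv_star M (a \<oplus> b) m = min 1 (mv_star M a m + mv_star M b m)"
  and star_neg: "m \<in> MaxSp M \<Longrightarrow> a \<in> C \<Longrightarrow> mv_star M (neg a) m = 1 - mv_star M a m"
  using star_hom[of m] by (simp_all add: unit_hom_iff)

lemma star_one: "m \<in> MaxSp M \<Longrightarrow> mv_star M \<one> m = 1"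
  using unit_hom_one[OF star_hom] by simp

lemma star_mono:
  assumes "m \<in> MaxSp M" "a \<in> C" "b \<in> C" "a \<sqsubseteq> b" shows "mv_star M a m \<le> mv_star M b m"
proof -
  have "mv_star M (neg a \<oplus> b) m = 1"
    using assms by (simp add: mv_le_def star_one)
  then show ?thesis using assms by (simp add: star_plus star_neg min_def split: if_splits)
qed

lemma topspace_MaxTop [simp]: "topspace (MaxTop M) = MaxSp M"
  using maximalD(2) one_closed unfolding MaxTop_def topology_generated_by_topspace MaxSp_iff[symmetric]
  by fast

section \<open>Compactness of the space of maximal ideals\<close>

definition homs :: "('a \<Rightarrow> real) set" where
  "homs = {h \<in> C \<rightarrow>\<^sub>E {0..1}. mv_hom M unit_mv h}"

definition cube :: "('a \<Rightarrow> real) topology" where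
  "cube = product_topology (\<lambda>_. top_of_set {0..1}) C"

lemma continuous_eval: "a \<in> C \<Longrightarrow> continuous_map cube euclideanreal (\<lambda>h. h a)"
  using continuous_map_product_projection[of a C "\<lambda>_. top_of_set {0..1::real}"]
  unfolding cube_def by (rule continuous_map_into_fulltopology)

lemma topspace_cube: "topspace cube = (C \<rightarrow>\<^sub>E {0..1})"
  by (simp add: cube_def)

text \<open>The cube is compact by Tychonoff, and being a homomorphism is a conjunction of equations
  between continuous functions of finitely many coordinates, hence a closed condition.\<close>

lemma homs_compact: "compactin cube homs"
proof -
  let ?E = "\<lambda>f g. {h \<in> topspace cube. f h = (g h :: real)}"
  have eq: "homs = (\<Inter>x\<in>C. \<Inter>y\<in>C. ?E (\<lambda>h. h (x \<oplus> y)) (\<lambda>h. min 1 (h x + h y)))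
      \<inter> ((\<Inter>x\<in>C. ?E (\<lambda>h. h (neg x)) (\<lambda>h. 1 - h x)) \<inter> ?E (\<lambda>h. h \<zero>) (\<lambda>h. 0))" (is "_ = ?R")
  proof (intro set_eqI iffI)
    fix h assume "h \<in> homs"
    then show "h \<in> ?R" by (simp add: homs_def unit_hom_iff topspace_cube)
  next
    fix h assume h: "h \<in> ?R"
    then have "h \<in> C \<rightarrow>\<^sub>E {0..1}" by (simp add: topspace_cube)
    then have "\<forall>x\<in>C. 0 \<le> h x \<and> h x \<le> 1" by (fastforce dest: PiE_mem)
    with h show "h \<in> homs" by (simp add: homs_def unit_hom_iff topspace_cube)
  qed
  have ne: "C \<noteq> {}" using zero_closed by blast
  note closed_eq = closedin_continuous_maps_eq[OF Hausdorff_space_euclidean]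
  have "closedin cube (?E (\<lambda>h. h (x \<oplus> y)) (\<lambda>h. min 1 (h x + h y)))" if "x \<in> C" "y \<in> C" for x y
    using that by (intro closed_eq continuous_eval continuous_map_real_min continuous_map_add) simp_all
  moreover have "closedin cube (?E (\<lambda>h. h (neg x)) (\<lambda>h. 1 - h x))" if "x \<in> C" for x
    using that by (intro closed_eq continuous_eval continuous_map_diff) simp_all
  moreover have "closedin cube (?E (\<lambda>h. h \<zero>) (\<lambda>h. 0))"
    by (intro closed_eq continuous_eval) simp_all
  ultimately have "closedin cube homs"
    unfolding eq using ne by (intro closedin_Int closedin_INT) simp_all
  moreover have "compact_space cube"
    unfolding cube_def compact_space_product_topology by (simp add: compact_space_subtopology)
  ultimately show ?thesis by (rule closedin_compact_space[rotated])
qed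

definition kernel :: "('a \<Rightarrow> real) \<Rightarrow> 'a set" where "kernel h = {x \<in> C. h x = 0}"

lemma kernel_homs: "kernel ` homs = MaxSp M"
proof (intro equalityI subsetI)
  fix m assume "m \<in> kernel ` homs"
  then show "m \<in> MaxSp M" using unit_hom_kernel_maximal by (auto simp: kernel_def homs_def MaxSp_iff)
next
  fix m assume m: "m \<in> MaxSp M"
  let ?h = "restrict (\<lambda>a. mv_star M a m) C"
  have "m \<subseteq> C" using m maximalD(3) by (simp add: MaxSp_iff)
  then have "m = kernel ?h"
    using star_zero_iff[OF m] by (auto simp: kernel_def)
  moreover have "mv_hom M unit_mv ?h" using star_hom[OF m] by (simp add: unit_hom_iff)
  then have "?h \<in> homs" using star_bounds[OF m] by (simp add: homs_def)
  ultimately show "m \<in> kernel ` homs" by blast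
qed

lemma kernel_inj: "inj_on kernel homs"
proof (rule inj_onI)
  fix g h assume gh: "g \<in> homs" "h \<in> homs" "kernel g = kernel h"
  have "g a = h a" if "a \<in> C" for a
    using star_eq_hom[of g a] star_eq_hom[of h a] gh that by (simp add: homs_def kernel_def)
  moreover have "g \<in> extensional C" "h \<in> extensional C" using gh by (auto simp: homs_def PiE_def)
  ultimately show "g = h" by (rule extensionalityI[rotated 2])
qed

lemma topspace_homs: "topspace (subtopology cube homs) = homs"
  using compactin_subset_topspace[OF homs_compact] by (simp add: Int_absorb1)

lemma continuous_kernel: "continuous_map (subtopology cube homs) (MaxTop M) kernel"
  unfolding MaxTop_def
proof (rule continuous_on_generated_topo)
  fix U assume "U \<in> (\<lambda>a. {m \<in> MaxSp M. a \<notin> m}) ` C"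
  then obtain a where a: "a \<in> C" "U = {m \<in> MaxSp M. a \<notin> m}" by blast
  have "openin (subtopology cube homs) {h \<in> topspace (subtopology cube homs). h a \<in> - {0}}"
    by (rule openin_continuous_map_preimage[OF continuous_map_from_subtopology[OF continuous_eval[OF a(1)]]]) auto
  moreover have "kernel -` U \<inter> topspace (subtopology cube homs) = {h \<in> topspace (subtopology cube homs). h a \<in> - {0}}"
    using kernel_homs a unfolding topspace_homs by (auto simp: kernel_def)
  ultimately show "openin (subtopology cube homs) (kernel -` U \<inter> topspace (subtopology cube homs))" by simp
next
  show "kernel ` topspace (subtopology cube homs) \<subseteq> \<Union> ((\<lambda>a. {m \<in> MaxSp M. a \<notin> m}) ` C)"
    unfolding topspace_homs kernel_homs using topspace_MaxTop[unfolded MaxTop_def] by simp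
qed

lemma compact_MaxTop: "compact_space (MaxTop M)"
proof -
  have "compactin (subtopology cube homs) homs" using homs_compact by (simp add: compactin_subtopology)
  then have "compactin (MaxTop M) (kernel ` homs)" using continuous_kernel by (rule image_compactin)
  then show ?thesis by (simp add: kernel_homs compact_space_def)
qed

text \<open>A continuous bijection from a compact space onto a Hausdorff space is a homeomorphism.
  So \<open>kernel\<close> has a continuous inverse, and \<open>mv_star M a\<close> is that inverse
  followed by evaluation at \<open>a\<close>.\<close>

lemma continuous_star:
  assumes "Hausdorff_space (MaxTop M)" "a \<in> C"
  shows "continuous_map (MaxTop M) euclideanreal (mv_star M a)"
proof -
  have "homeomorphic_map (subtopology cube homs) (MaxTop M) kernel"
    using continuous_kernel assms(1) kernel_inj kernel_homs homs_compact
    by (intro continuous_imp_homeomorphic_map compact_space_subtopology) (simp_all add: topspace_homs del: topspace_subtopology)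
  then obtain g where "homeomorphic_maps (subtopology cube homs) (MaxTop M) kernel g"
    by (auto simp: homeomorphic_map_maps)
  then have g: "continuous_map (MaxTop M) (subtopology cube homs) g"
    "\<And>m. m \<in> MaxSp M \<Longrightarrow> kernel (g m) = m"
    by (auto simp: homeomorphic_maps_def)
  have gh: "g m \<in> homs" if "m \<in> MaxSp M" for m
    using continuous_map_image_subset_topspace[OF g(1)] that by (auto simp: topspace_homs)
  have "continuous_map (MaxTop M) euclideanreal ((\<lambda>h. h a) \<circ> g)"
    by (rule continuous_map_compose[OF g(1) continuous_map_from_subtopology[OF continuous_eval[OF assms(2)]]])
  moreover have "((\<lambda>h. h a) \<circ> g) m = mv_star M a m" if "m \<in> topspace (MaxTop M)" for m
    using star_eq_hom[of "g m" a] g(2)[of m] gh[of m] that assms(2) by (simp add: homs_def kernel_def)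
  ultimately show ?thesis by (rule continuous_map_eq)
qed

lemma maximal_ideal_extends:
  assumes I: "mv_ideal M I" "\<one> \<notin> I"
  obtains m where "m \<in> MaxSp M" "I \<subseteq> m"
proof -
  define \<A> where "\<A> = {J. mv_ideal M J \<and> I \<subseteq> J \<and> \<one> \<notin> J}"
  have "\<exists>m\<in>\<A>. \<forall>J\<in>\<A>. m \<subseteq> J \<longrightarrow> J = m"
  proof (rule subset_Zorn_nonempty)
    show "\<A> \<noteq> {}" using I by (auto simp: \<A>_def)
    fix \<C> assume ne: "\<C> \<noteq> {}" and ch: "subset.chain \<A> \<C>"
    have ideals: "mv_ideal M J" "I \<subseteq> J" "\<one> \<notin> J" if "J \<in> \<C>" for J
      using ch that by (auto simp: subset.chain_def \<A>_def)
    have "mv_ideal M (\<Union>\<C>)"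
      unfolding mv_ideal_def
    proof (intro conjI ballI impI)
      show "\<Union>\<C> \<subseteq> C" using ideals(1) idealD(1) by (metis Union_least)
      obtain J where "J \<in> \<C>" using ne by blast
      then show "\<zero> \<in> \<Union>\<C>" using idealD(2)[OF ideals(1)[OF \<open>J \<in> \<C>\<close>]] by (rule UnionI)
      fix a assume "a \<in> \<Union>\<C>"
      then obtain J where J: "J \<in> \<C>" "a \<in> J" by (rule UnionE)
      show "b \<in> \<Union>\<C>" if "b \<in> C" "b \<sqsubseteq> a" for b
        using idealD(4)[OF ideals(1)[OF J(1)] J(2) that] by (rule UnionI[OF J(1)])
      fix b assume "b \<in> \<Union>\<C>"
      then obtain K where K: "K \<in> \<C>" "b \<in> K" by (rule UnionE)
      consider "J \<subseteq> K" | "K \<subseteq> J" using ch J(1) K(1) by (meson subset_chain_def)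
      then obtain L where "L \<in> \<C>" "a \<in> L" "b \<in> L"
        by cases (use J K in auto)
      then show "a \<oplus> b \<in> \<Union>\<C>" using idealD(3)[OF ideals(1), of L a b] by (meson UnionI)
    qed
    then show "\<Union>\<C> \<in> \<A>" using ne ideals unfolding \<A>_def by fast
  qed
  then obtain m where m: "m \<in> \<A>" "\<And>J. J \<in> \<A> \<Longrightarrow> m \<subseteq> J \<Longrightarrow> J = m" by meson
  have "mv_maximal_ideal M m"
    unfolding mv_maximal_ideal_def
  proof (intro conjI allI impI)
    show "mv_ideal M m" "m \<noteq> C" using m(1) one_closed by (auto simp: \<A>_def)
    fix J assume J: "mv_ideal M J \<and> m \<subseteq> J"
    show "J = m \<or> J = C"
    proof (cases "\<one> \<in> J")
      case True
      then show ?thesis using J ideal_one by simp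
    next
      case False
      then have "J \<in> \<A>" using J m(1) by (auto simp: \<A>_def)
      then show ?thesis using m(2) J by simp
    qed
  qed
  then show ?thesis using that m(1) by (auto simp: MaxSp_iff \<A>_def)
qed

end

section \<open>Boolean elements and states\<close>

context mv_alg begin

section \<open>Boolean elements and their supports\<close>

definition boolean :: "'a \<Rightarrow> bool" where "boolean e \<longleftrightarrow> e \<in> C \<and> e \<oplus> e = e"

definition supp :: "'a \<Rightarrow> 'a set set" where "supp e = {m \<in> MaxSp M. e \<notin> m}"

lemma boolean_closed: "boolean e \<Longrightarrow> e \<in> C"
  by (simp add: boolean_def)

lemma boolean_iff_disjoint: "e \<in> C \<Longrightarrow> e \<oplus> e = e \<longleftrightarrow> e \<sqinter> neg e = \<zero>"
proof
  assume e: "e \<in> C" "e \<oplus> e = e"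
  then show "e \<sqinter> neg e = \<zero>" using plus_minus_meet[of e e] by simp
next
  assume e: "e \<in> C" "e \<sqinter> neg e = \<zero>"
  then have "(e \<oplus> e) \<ominus> e = \<zero>" by (simp add: plus_minus_meet)
  then have "e \<oplus> e \<sqsubseteq> e" using e minus_le_iff[of "e \<oplus> e" e \<zero>] by simp
  then show "e \<oplus> e = e" using e by (intro le_antisym) auto
qed

lemma boolean_neg: "boolean e \<Longrightarrow> boolean (neg e)"
  using boolean_iff_disjoint[of e] boolean_iff_disjoint[of "neg e"]
  by (simp add: boolean_def meet_comm)

lemma boolean_plus: "boolean e \<Longrightarrow> boolean f \<Longrightarrow> boolean (e \<oplus> f)"
  unfolding boolean_def by (metis plus_assoc plus_closed plus_comm)

lemma boolean_zero: "boolean \<zero>"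
  by (simp add: boolean_def)

lemma disjoint_le_neg:
  assumes "x \<in> C" "y \<in> C" "x \<sqinter> y = \<zero>" shows "x \<sqsubseteq> neg y"
proof -
  have "x \<ominus> y = x" using minus_meet[of x y] assms by simp
  then show ?thesis using minus_le_neg[of x y] assms by simp
qed

lemma boolean_le_neg_disjoint:
  assumes e: "boolean e" and f: "f \<in> C" "f \<sqsubseteq> neg e" shows "e \<sqinter> f = \<zero>"
proof -
  have eC: "e \<in> C" "e \<sqinter> neg e = \<zero>" using e boolean_iff_disjoint[of e] by (simp_all add: boolean_def)
  have "e \<sqinter> f \<sqsubseteq> e \<sqinter> neg e"
    using eC(1) f le_trans[of "e \<sqinter> f" f "neg e"] by (intro meet_greatest) simp_all
  then show ?thesis using eC f by (simp add: le_zero)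
qed

lemma star_boolean_cases:
  assumes "boolean e" "m \<in> MaxSp M" shows "mv_star M e m = 0 \<or> mv_star M e m = 1"
proof -
  have eC: "e \<in> C" using assms(1) by (rule boolean_closed)
  have "mv_star M (e \<oplus> e) m = mv_star M e m" using assms(1) by (simp add: boolean_def)
  then show ?thesis
    using star_plus[OF assms(2) eC eC] by (auto simp: min_def split: if_splits)
qed

lemma supp_star_iff: "boolean e \<Longrightarrow> m \<in> supp e \<longleftrightarrow> m \<in> MaxSp M \<and> mv_star M e m = 1"
  using star_boolean_cases[of e m] star_zero_iff[of m e] boolean_closed[of e] by (auto simp: supp_def)

lemma star_boolean: "boolean e \<Longrightarrow> m \<in> MaxSp M \<Longrightarrow> mv_star M e m = indicator (supp e) m"
  using star_boolean_cases[of e m] by (auto simp: supp_star_iff indicator_def)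

lemma supp_neg: assumes e: "boolean e" shows "supp (neg e) = MaxSp M - supp e"
proof (rule set_eqI)
  fix m show "m \<in> supp (neg e) \<longleftrightarrow> m \<in> MaxSp M - supp e"
    using star_boolean_cases[OF e, of m] star_neg[of m e] boolean_closed[OF e]
    by (auto simp: supp_star_iff e boolean_neg)
qed

lemma supp_plus: assumes e: "boolean e" "boolean f" shows "supp (e \<oplus> f) = supp e \<union> supp f"
proof (rule set_eqI)
  fix m show "m \<in> supp (e \<oplus> f) \<longleftrightarrow> m \<in> supp e \<union> supp f"
    using star_boolean_cases[OF e(1), of m] star_boolean_cases[OF e(2), of m]
      star_plus[of m e f] boolean_closed e
    by (auto simp: supp_star_iff e boolean_plus)
qed

lemma supp_zero: "supp \<zero> = {}"
  using maximalD idealD(2) by (auto simp: supp_def MaxSp_iff)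

lemma supp_one: "supp \<one> = MaxSp M"
  using maximalD(2) by (auto simp: supp_def MaxSp_iff)

text \<open>For nonzero \<open>e\<close> the elements below \<open>neg e\<close> form a proper
  ideal, closed under \<open>\<oplus>\<close> because \<open>neg e\<close> is idempotent. A maximal
  ideal above it belongs to the support of \<open>e\<close>. Hence Boolean elements are determined
  by their supports.\<close>

lemma supp_empty_imp:
  assumes e: "boolean e" "supp e = {}" shows "e = \<zero>"
proof (rule ccontr)
  assume ne: "e \<noteq> \<zero>"
  have eC: "e \<in> C" and ne': "neg e \<oplus> neg e = neg e"
    using e(1) boolean_neg by (auto simp: boolean_def)
  have "mv_ideal M {x \<in> C. x \<sqsubseteq> neg e}"
    unfolding mv_ideal_def
  proof (intro conjI ballI impI)
    fix x y assume *: "x \<in> {x \<in> C. x \<sqsubseteq> neg e}" "y \<in> {x \<in> C. x \<sqsubseteq> neg e}"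
    then have "x \<oplus> y \<sqsubseteq> neg e \<oplus> neg e" using eC by (intro plus_mono) simp_all
    then show "x \<oplus> y \<in> {x \<in> C. x \<sqsubseteq> neg e}" using * ne' by simp
  next
    fix x y assume *: "x \<in> {x \<in> C. x \<sqsubseteq> neg e}" "y \<in> C" "y \<sqsubseteq> x"
    then show "y \<in> {x \<in> C. x \<sqsubseteq> neg e}" using eC le_trans[of y x "neg e"] by simp
  qed (use eC in auto)
  moreover have "\<one> \<notin> {x \<in> C. x \<sqsubseteq> neg e}"
  proof
    assume "\<one> \<in> {x \<in> C. x \<sqsubseteq> neg e}"
    then have "neg e = \<one>" using eC by (intro le_antisym) simp_all
    then have "neg (neg e) = \<zero>" by simp
    then show False using ne eC by simp
  qed
  ultimately obtain m where m: "m \<in> MaxSp M" "{x \<in> C. x \<sqsubseteq> neg e} \<subseteq> m"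
    using maximal_ideal_extends by metis
  then have "neg e \<in> m" using eC by auto
  then have "mv_star M (neg e) m = 0" using star_zero_iff[OF m(1)] eC by simp
  then have "m \<in> supp e" using star_neg[OF m(1) eC] m(1) e(1) by (simp add: supp_star_iff)
  then show False using e by simp
qed

lemma supp_disjoint_imp:
  assumes e: "boolean e" and f: "boolean f" and "supp e \<inter> supp f = {}" shows "f \<sqsubseteq> neg e"
proof -
  let ?g = "neg (neg f \<oplus> neg e)"
  have C: "e \<in> C" "f \<in> C" using e f by (auto simp: boolean_def)
  have g: "boolean ?g" using e f by (intro boolean_neg boolean_plus)
  have "supp ?g = MaxSp M - ((MaxSp M - supp f) \<union> (MaxSp M - supp e))"
    using e f by (simp add: supp_neg supp_plus boolean_neg boolean_plus)
  then have "supp ?g = {}" using assms(3) by blast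
  then have "?g = \<zero>" by (rule supp_empty_imp[OF g])
  then have "neg ?g = \<one>" by (simp only: neg_zero)
  then show ?thesis using C by (simp add: mv_le_def)
qed

lemma supp_disjoint_iff:
  assumes e: "boolean e" and f: "boolean f" shows "supp e \<inter> supp f = {} \<longleftrightarrow> e \<sqinter> f = \<zero>"
proof
  assume "supp e \<inter> supp f = {}"
  then show "e \<sqinter> f = \<zero>" using supp_disjoint_imp[OF e f] boolean_le_neg_disjoint[OF e] f boolean_closed by simp
next
  assume *: "e \<sqinter> f = \<zero>"
  have C: "e \<in> C" "f \<in> C" using e f by (auto simp: boolean_def)
  have "mv_star M e m \<le> 1 - mv_star M f m" if "m \<in> MaxSp M" for m
    using star_mono[OF that _ _ disjoint_le_neg[OF C *]] C star_neg[OF that] by simp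
  note le = this
  show "supp e \<inter> supp f = {}"
  proof (rule equals0I)
    fix m assume "m \<in> supp e \<inter> supp f"
    then have "m \<in> MaxSp M" "mv_star M e m = 1" "mv_star M f m = 1"
      using supp_star_iff e f by simp_all
    then show False using le[of m] by simp
  qed
qed

lemma supp_mono_imp:
  assumes e: "boolean e" and f: "boolean f" and s: "supp e \<subseteq> supp f" shows "e \<sqsubseteq> f"
proof -
  have "supp (neg f) \<inter> supp e = {}" using s supp_neg[OF f] by blast
  then have "e \<sqsubseteq> neg (neg f)" by (rule supp_disjoint_imp[OF boolean_neg[OF f] e])
  then show ?thesis using boolean_closed[OF f] by simp
qed

lemma supp_inj: "boolean e \<Longrightarrow> boolean f \<Longrightarrow> supp e = supp f \<Longrightarrow> e = f"
  by (rule le_antisym) (simp_all add: boolean_closed supp_mono_imp)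

definition clopens :: "'a set set set" where "clopens = supp ` Collect boolean"

lemma open_supp: "e \<in> C \<Longrightarrow> openin (MaxTop M) (supp e)"
  unfolding MaxTop_def supp_def by (rule topology_generated_by_Basis) blast

lemma algebra_clopens: "algebra (MaxSp M) clopens"
  unfolding algebra_iff_Un
proof (intro conjI ballI)
  show "clopens \<subseteq> Pow (MaxSp M)" by (auto simp: clopens_def supp_def)
  show "{} \<in> clopens" using boolean_zero supp_zero unfolding clopens_def by (metis image_eqI mem_Collect_eq)
  fix a assume "a \<in> clopens"
  then obtain e where e: "boolean e" "a = supp e" by (auto simp: clopens_def)
  then show "MaxSp M - a \<in> clopens"
    using supp_neg boolean_neg unfolding clopens_def by (metis image_eqI mem_Collect_eq)
  fix b assume "b \<in> clopens"
  then obtain f where f: "boolean f" "b = supp f" by (auto simp: clopens_def)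
  then show "a \<union> b \<in> clopens"
    using e supp_plus boolean_plus unfolding clopens_def by (metis image_eqI mem_Collect_eq)
qed

text \<open>Covers the evaluations at points of \<open>Max M\<close> as well as the functionals
  obtained from \<open>p\<close> at points of \<open>Max N\<close>.\<close>

definition state :: "('a \<Rightarrow> real) \<Rightarrow> bool" where
  "state s \<longleftrightarrow> (\<forall>a\<in>C. 0 \<le> s a \<and> s a \<le> 1) \<and> s \<one> = 1 \<and>
     (\<forall>a\<in>C. \<forall>b\<in>C. b \<sqsubseteq> neg a \<longrightarrow> s (a \<oplus> b) = s a + s b)"

lemma state_star: assumes m: "m \<in> MaxSp M" shows "state (\<lambda>a. mv_star M a m)"
  unfolding state_def
proof (intro conjI ballI impI)
  fix a b assume ab: "a \<in> C" "b \<in> C" "b \<sqsubseteq> neg a"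
  then have "mv_star M b m \<le> 1 - mv_star M a m"
    using star_mono[OF m ab(2) _ ab(3)] star_neg[OF m] by simp
  then show "mv_star M (a \<oplus> b) m = mv_star M a m + mv_star M b m"
    using ab star_plus[OF m] by simp
qed (use star_bounds[OF m] star_one[OF m] in simp_all)

lemma state_minus:
  assumes s: "state s" and xy: "x \<in> C" "y \<in> C" "x \<sqsubseteq> y" shows "s (y \<ominus> x) = s y - s x"
proof -
  have "s ((y \<ominus> x) \<oplus> x) = s (y \<ominus> x) + s x"
  proof -
    have "x \<sqsubseteq> neg (y \<ominus> x)"
      using xy le_neg_swap[of x "y \<ominus> x"] by simp
    then show ?thesis using s xy unfolding state_def by simp
  qed
  then show ?thesis using xy by (simp add: le_minus_plus)
qed

lemma state_mono:
  assumes "state s" "x \<in> C" "y \<in> C" "x \<sqsubseteq> y" shows "s x \<le> s y"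
proof -
  have "0 \<le> s (y \<ominus> x)" using assms unfolding state_def by simp
  then show ?thesis using state_minus[OF assms] by simp
qed

text \<open>The counterpart for states of \<open>min 1 (2 * a) = 2 * a - max 0 (2 * a - 1)\<close>,
  where \<open>a \<ominus> neg a\<close> plays the part of the last maximum.\<close>

lemma state_double:
  assumes s: "state s" and a: "a \<in> C" shows "s (a \<oplus> a) = 2 * s a - s (a \<ominus> neg a)"
proof -
  have "a \<oplus> a = a \<oplus> (a \<sqinter> neg a)"
    using le_minus_plus[of a "a \<oplus> a"] a by (simp add: plus_minus_meet plus_comm)
  moreover have "s (a \<oplus> (a \<sqinter> neg a)) = s a + s (a \<sqinter> neg a)"
    using s a by (simp add: state_def)
  moreover have "s (a \<sqinter> neg a) = s a - s (a \<ominus> neg a)"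
    using state_minus[OF s, of "a \<ominus> neg a" a] a by (simp add: meet_eq)
  ultimately show ?thesis by simp
qed

text \<open>For \<open>b \<sqsubseteq> neg a\<close> the first axiom gives
  \<open>p (a \<oplus> b)\<close> as the MV-sum of \<open>p a\<close> and \<open>p b\<close>. This
  sum is not truncated: \<open>neg a\<close> is \<open>b\<close> plus a disjointly added rest, so
  \<open>p b\<close> lies below \<open>p (neg a)\<close>, the negation of
  \<open>p a\<close>.\<close>

lemma probability_map_state:
  assumes N: "mv_alg N" and p: "probability_map M N p" and y: "y \<in> MaxSp N"
  shows "state (\<lambda>a. mv_star N (p a) y)"
proof -
  interpret N: mv_alg N by (rule N)
  have pC: "p a \<in> mv_carrier N" if "a \<in> C" for a
    using p that by (auto simp: probability_map_def)
  have add: "p (a \<oplus> b) = mv_plus N (p a) (p b)" if "a \<in> C" "b \<in> C" "b \<sqsubseteq> neg a" for a b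
  proof -
    have "p (a \<oplus> b) = mv_plus N (p a) (p (b \<sqinter> neg a))" using p that by (simp add: probability_map_def)
    then show ?thesis using that by (simp add: meet_absorb)
  qed
  show ?thesis
    unfolding state_def
  proof (intro conjI ballI impI)
    show "mv_star N (p \<one>) y = 1" using p N.star_one[OF y] by (simp add: probability_map_def)
    fix a b assume ab: "a \<in> C" "b \<in> C" "b \<sqsubseteq> neg a"
    have "neg a = b \<oplus> (neg a \<ominus> b)" using le_minus_plus[of b "neg a"] ab by (simp add: plus_comm)
    moreover have "p (b \<oplus> (neg a \<ominus> b)) = mv_plus N (p b) (p (neg a \<ominus> b))"
      using add[of b "neg a \<ominus> b"] ab by simp
    ultimately have "p (neg a) = mv_plus N (p b) (p (neg a \<ominus> b))" by simp
    then have "mv_star N (p b) y \<le> mv_star N (p (neg a)) y"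
      using N.star_mono[OF y, of "p b" "p (neg a)"] ab pC by simp
    also have "\<dots> = 1 - mv_star N (p a) y"
      using p ab N.star_neg[OF y] pC by (simp add: probability_map_def)
    finally show "mv_star N (p (a \<oplus> b)) y = mv_star N (p a) y + mv_star N (p b) y"
      using N.star_plus[OF y] ab pC by (simp add: add)
  qed (use N.star_bounds[OF y] pC in auto)
qed

end

section \<open>Complete algebras: Boolean envelopes and binary digits\<close>

locale complete_mv_alg = mv_alg +
  assumes complete: "mv_complete M"
begin

text \<open>The witness is the supremum of the double annihilator of \<open>P\<close>. An ideal is closed under
  \<open>\<oplus>\<close>, so the supremum of an annihilator is idempotent as soon as it lies in the annihilator.\<close>

lemma boolean_envelope:
  assumes P: "P \<subseteq> C"
  obtains e where "boolean e" "\<And>x. x \<in> P \<Longrightarrow> x \<sqsubseteq> e"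
    "\<And>z. z \<in> C \<Longrightarrow> (\<And>x. x \<in> P \<Longrightarrow> x \<sqinter> z = \<zero>) \<Longrightarrow> e \<sqinter> z = \<zero>"
proof -
  define Q where "Q = {z \<in> C. \<forall>x\<in>P. x \<sqinter> z = \<zero>}"
  define J where "J = {w \<in> C. \<forall>z\<in>Q. z \<sqinter> w = \<zero>}"
  have QC: "Q \<subseteq> C" and JC: "J \<subseteq> C" by (auto simp: Q_def J_def)
  obtain e where e: "e \<in> C" "\<And>w. w \<in> J \<Longrightarrow> w \<sqsubseteq> e"
    "\<And>u. u \<in> C \<Longrightarrow> (\<And>w. w \<in> J \<Longrightarrow> w \<sqsubseteq> u) \<Longrightarrow> e \<sqsubseteq> u"
    using complete JC unfolding mv_complete_def by metis
  have PJ: "x \<in> J" if "x \<in> P" for x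
    using that P by (auto simp: J_def Q_def meet_comm[of _ x])
  have dis: "e \<sqinter> y = \<zero>" if y: "y \<in> Q" for y
  proof -
    have yC: "y \<in> C" using y QC by blast
    define z where "z = e \<sqinter> y"
    have z: "z \<in> C" "z \<sqsubseteq> e" "z \<sqsubseteq> y" using e yC by (auto simp: z_def)
    \<comment> \<open>Each \<open>w\<close> in \<open>J\<close> is disjoint from \<open>z\<close>,
      so subtracting \<open>z\<close> does not change it and \<open>e \<ominus> z\<close> still
      bounds \<open>J\<close>. As \<open>e\<close> is the least bound, \<open>z\<close> must
      vanish.\<close>
    have "w \<sqsubseteq> e \<ominus> z" if w: "w \<in> J" for w
    proof -
      have wC: "w \<in> C" and wy: "y \<sqinter> w = \<zero>" using w y by (auto simp: J_def)
      have "w \<sqinter> z \<sqsubseteq> y \<sqinter> w"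
        using wC z yC le_trans[of "w \<sqinter> z" z y] by (intro meet_greatest) auto
      then have "w \<sqinter> z = \<zero>" using wy wC z by (simp add: le_zero)
      then have "w \<ominus> z = w" using minus_meet[of w z] wC z by simp
      then show ?thesis using minus_mono[of w e z z] wC e(1) e(2)[OF w] z by simp
    qed
    then have "e \<sqsubseteq> e \<ominus> z" using e(1,3) z by simp
    then have "e \<ominus> (e \<ominus> z) = \<zero>" using e(1) z by (simp add: minus_eq_zero)
    then have "e \<sqinter> z = \<zero>" using e(1) z by (simp add: meet_eq)
    moreover have "e \<sqinter> z = z" using e(1) z meet_absorb[of z e] by (simp add: meet_comm)
    ultimately show ?thesis by (simp add: z_def)
  qed
  have "e \<oplus> e \<in> J"
  proof -
    have "z \<sqinter> (e \<oplus> e) = \<zero>" if "z \<in> Q" for z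
      using dis[OF that] that QC e(1) by (intro disjoint_plus) (auto simp: meet_comm[of z])
    then show ?thesis using e(1) by (simp add: J_def)
  qed
  then have "e \<oplus> e = e" using e(1,2) by (intro le_antisym) simp_all
  then have "boolean e" using e(1) by (simp add: boolean_def)
  then show ?thesis
  proof (rule that)
    show "x \<sqsubseteq> e" if "x \<in> P" for x using e(2)[OF PJ[OF that]] .
    show "e \<sqinter> z = \<zero>" if "z \<in> C" "\<And>x. x \<in> P \<Longrightarrow> x \<sqinter> z = \<zero>" for z
      using that by (intro dis) (simp add: Q_def)
  qed
qed

text \<open>Take the envelope of \<open>a \<ominus> neg a\<close>. By prelinearity this element is
  disjoint from \<open>neg a \<ominus> a\<close>, hence so is the envelope, and the negation of
  \<open>neg a \<ominus> a\<close> is \<open>a \<oplus> a\<close>. Pointwise, \<open>e\<close> is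
  \<open>1\<close> where \<open>a > 1/2\<close> and \<open>0\<close> where
  \<open>a < 1/2\<close>.\<close>

lemma boolean_between:
  assumes a: "a \<in> C"
  obtains e where "boolean e" "a \<ominus> neg a \<sqsubseteq> e" "e \<sqsubseteq> a \<oplus> a"
proof -
  obtain e where e: "boolean e" "a \<ominus> neg a \<sqsubseteq> e"
    "\<And>z. z \<in> C \<Longrightarrow> (a \<ominus> neg a) \<sqinter> z = \<zero> \<Longrightarrow> e \<sqinter> z = \<zero>"
    using boolean_envelope[of "{a \<ominus> neg a}"] a by auto
  have "e \<sqinter> (neg a \<ominus> a) = \<zero>" using prelinear[of a "neg a"] a by (intro e(3)) simp_all
  then have "e \<sqsubseteq> neg (neg a \<ominus> a)" using e(1) a by (intro disjoint_le_neg) (simp_all add: boolean_closed)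
  then have "e \<sqsubseteq> a \<oplus> a" using a by (simp add: ominus_def)
  then show ?thesis using that e by blast
qed

lemma clopens_base:
  assumes "openin (MaxTop M) U" "m \<in> U" shows "\<exists>b\<in>clopens. m \<in> b \<and> b \<subseteq> U"
proof -
  have "generate_topology_on ((\<lambda>a. {m \<in> MaxSp M. a \<notin> m}) ` C) U"
    using assms(1) by (simp add: MaxTop_def openin_topology_generated_by_iff)
  then show ?thesis using assms(2)
  proof (induction U)
    case (Int U V)
    then obtain b c where *: "b \<in> clopens" "m \<in> b" "b \<subseteq> U" "c \<in> clopens" "m \<in> c" "c \<subseteq> V" by blast
    interpret c: algebra "MaxSp M" clopens by (rule algebra_clopens)
    have "b \<inter> c \<in> clopens" using *(1,4) by (rule c.Int)
    then show ?case using * by (intro bexI[of _ "b \<inter> c"]) auto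
  next
    case (UN K)
    then obtain U b where "U \<in> K" "b \<in> clopens" "m \<in> b" "b \<subseteq> U" by (metis UnionE)
    then show ?case by (intro bexI[of _ b]) auto
  next
    case (Basis U)
    then obtain a where a: "a \<in> C" "U = {m \<in> MaxSp M. a \<notin> m}" "m \<in> MaxSp M" "a \<notin> m" by auto
    then have "0 < mv_star M a m"
      using star_zero_iff[OF a(3,1)] star_bounds[OF a(3,1)] by simp
    \<comment> \<open>Scaling \<open>a\<close> up to the value \<open>1\<close> at \<open>m\<close>
      puts \<open>m\<close> on the side of \<open>boolean_between\<close> where \<open>e\<close> is
      \<open>1\<close>; conversely \<open>e\<close> can be \<open>1\<close> only where
      \<open>a\<close> is nonzero.\<close>
    then obtain n where n: "1 < real n * mv_star M a m" using reals_Archimedean3 by blast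
    define c where "c = mult n a"
    have c: "c \<in> C" "mv_star M c m = 1"
      using a n unit_hom_mult[OF star_hom[OF a(3)] a(1), of n] by (simp_all add: c_def)
    obtain e where e: "boolean e" "c \<ominus> neg c \<sqsubseteq> e" "e \<sqsubseteq> c \<oplus> c" using boolean_between[OF c(1)] .
    have "m \<in> supp e"
    proof -
      have "mv_star M (c \<ominus> neg c) m = 1" using c a(3) by (simp add: ominus_def star_neg star_plus)
      then have "mv_star M e m = 1"
        using star_mono[OF a(3) _ _ e(2)] star_bounds[OF a(3), of e] c(1) boolean_closed[OF e(1)] by simp
      then show ?thesis using supp_star_iff[OF e(1)] a(3) by simp
    qed
    moreover have "supp e \<subseteq> U"
    proof
      fix m' assume "m' \<in> supp e"
      then have m': "m' \<in> MaxSp M" "mv_star M e m' = 1" using e(1) by (auto simp: supp_star_iff)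
      have "1 \<le> mv_star M (c \<oplus> c) m'"
        using star_mono[OF m'(1) _ _ e(3)] c(1) e(1) m'(2) by (simp add: boolean_closed)
      then have "mv_star M c m' \<noteq> 0" using star_plus[OF m'(1) c(1) c(1)] by auto
      then have "mv_star M a m' \<noteq> 0"
        using unit_hom_mult[OF star_hom[OF m'(1)] a(1), of n] by (auto simp: c_def)
      then show "m' \<in> U" using star_zero_iff[OF m'(1) a(1)] m'(1) a(2) by simp
    qed
    ultimately show ?case using e(1) by (intro bexI[of _ "supp e"]) (auto simp: clopens_def)
  qed simp
qed

lemma clopen_base_MaxTop: "clopen_base (MaxTop M) clopens"
proof (rule clopen_base.intro)
  show "compact_space (MaxTop M)" by (rule compact_MaxTop)
  show "algebra (topspace (MaxTop M)) clopens" using algebra_clopens by simp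
  show "openin (MaxTop M) a" if "a \<in> clopens" for a
    using that open_supp boolean_closed by (auto simp: clopens_def)
qed (rule clopens_base)

text \<open>A binary digit: \<open>e\<close> marks (up to the boundary) the points where \<open>a \<ge> 1/2\<close>, and
  \<open>a'\<close> is \<open>2a - e\<close>.\<close>

lemma binary_digit:
  assumes a: "a \<in> C"
  shows "\<exists>e a'. boolean e \<and> a' \<in> C \<and> (\<forall>s. state s \<longrightarrow> 2 * s a = s e + s a')"
proof -
  define u where "u = a \<ominus> neg a"
  obtain e where e: "boolean e" "u \<sqsubseteq> e" "e \<sqsubseteq> a \<oplus> a" using boolean_between[OF a] unfolding u_def .
  have C: "u \<in> C" "e \<in> C" using a e boolean_closed by (auto simp: u_def)
  \<comment> \<open>Pointwise \<open>min 1 (2 * a) - e + max 0 (2 * a - 1)\<close>, that is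
    \<open>2 * a - e\<close>. The outer sum is not truncated since
    \<open>u \<sqsubseteq> e\<close>.\<close>
  define a' where "a' = ((a \<oplus> a) \<ominus> e) \<oplus> u"
  have a': "a' \<in> C" using a C by (simp add: a'_def)
  have "2 * s a = s e + s a'" if s: "state s" for s
  proof -
    have "(a \<oplus> a) \<ominus> e \<sqsubseteq> neg u"
      using le_trans[of "(a \<oplus> a) \<ominus> e" "neg e" "neg u"] a C e(2) by (simp add: neg_le_neg)
    then have "u \<sqsubseteq> neg ((a \<oplus> a) \<ominus> e)" using a C le_neg_swap[of u "(a \<oplus> a) \<ominus> e"] by simp
    then have "s a' = s ((a \<oplus> a) \<ominus> e) + s u"
      using s a C unfolding a'_def state_def by simp
    also have "s ((a \<oplus> a) \<ominus> e) = s (a \<oplus> a) - s e"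
      using s a C e(3) by (intro state_minus) simp_all
    also have "s (a \<oplus> a) = 2 * s a - s u" using state_double[OF s a] by (simp add: u_def)
    finally show ?thesis by simp
  qed
  then show ?thesis using e(1) a' by blast
qed

text \<open>Iterates \<open>binary_digit\<close>. The digits \<open>e\<close> and remainders
  \<open>A\<close> are fixed before the state, so one expansion serves all states, with error at
  most \<open>1 / 2 ^ n\<close>.\<close>

lemma binary_expansion:
  assumes a: "a \<in> C"
  obtains e A where "\<And>i::nat. boolean (e i)" "\<And>n. A n \<in> C"
    "\<And>s n. state s \<Longrightarrow> s a = (\<Sum>i<n. 1 / 2 ^ Suc i * s (e i)) + s (A n) / 2 ^ n"
proof -
  obtain d f where df: "\<And>a. a \<in> C \<Longrightarrow> boolean (d a) \<and> f a \<in> C \<and> (\<forall>s. state s \<longrightarrow> 2 * s a = s (d a) + s (f a))"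
    using binary_digit by metis
  define A where "A n = (f ^^ n) a" for n
  have A: "A n \<in> C" for n
    unfolding A_def using a df by (induction n) simp_all
  have "s a = (\<Sum>i<n. 1 / 2 ^ Suc i * s (d (A i))) + s (A n) / 2 ^ n" if s: "state s" for s n
  proof (induction n)
    case 0
    show ?case by (simp add: A_def)
  next
    case (Suc n)
    have "2 * s (A n) = s (d (A n)) + s (A (Suc n))"
      using df[OF A[of n]] s by (simp add: A_def)
    then have "s (A n) / 2 ^ n = 1 / 2 ^ Suc n * s (d (A n)) + s (A (Suc n)) / 2 ^ Suc n"
      by (simp add: field_simps)
    then show ?case using Suc by simp
  qed
  then show ?thesis using that[of "\<lambda>i. d (A i)" A] df A by blast
qed

end

section \<open>The representing vector measure\<close>

lemma compact_metrizable_subsequence: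
  fixes \<sigma> :: "nat \<Rightarrow> 'y"
  assumes "compact_space Y" "metrizable_space Y" "range \<sigma> \<subseteq> topspace Y"
  obtains l r where "l \<in> topspace Y" "strict_mono r" "limitin Y (\<sigma> \<circ> r) l sequentially"
proof -
  obtain S d where Sd: "Metric_space S d" "Y = Metric_space.mtopology S d"
    using assms(2) unfolding metrizable_space_def by blast
  interpret Metric_space S d by (rule Sd(1))
  have "\<exists>l r. l \<in> S \<and> strict_mono r \<and> limitin Y (\<sigma> \<circ> r) l sequentially"
    using assms(1,3) compact_space_sequentially unfolding Sd(2) by simp
  then show ?thesis using that by (auto simp: Sd(2))
qed

context mv_alg begin

text \<open>The partial sums \<open>g\<close> stay disjoint from all later elements, so finite
  additivity applies at each step.\<close>

lemma state_disjoint_sum: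
  assumes s: "state s" and E: "\<And>j::nat. boolean (E j)" "\<And>i j. i \<noteq> j \<Longrightarrow> E i \<sqinter> E j = \<zero>"
  shows "(\<Sum>j<n. s (E j)) \<le> 1"
proof -
  have EC: "E j \<in> C" for j using E(1) by (rule boolean_closed)
  have "\<exists>g\<in>C. s g = (\<Sum>j<n. s (E j)) \<and> (\<forall>k\<ge>n. E k \<sqinter> g = \<zero>)"
  proof (induction n)
    case 0
    have "s (\<zero> \<oplus> \<zero>) = s \<zero> + s \<zero>" using s unfolding state_def by (simp del: plus_zero zero_plus)
    moreover have "x \<sqinter> \<zero> = \<zero>" if "x \<in> C" for x using meet_le(2)[of x \<zero>] that by (simp add: le_zero)
    ultimately show ?case using EC by (intro bexI[of _ "\<zero>"]) simp_all
  next
    case (Suc n)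
    then obtain g where g: "g \<in> C" "s g = (\<Sum>j<n. s (E j))" "\<And>k. n \<le> k \<Longrightarrow> E k \<sqinter> g = \<zero>" by auto
    have "E n \<sqsubseteq> neg g" using g EC by (intro disjoint_le_neg) simp_all
    then have "s (g \<oplus> E n) = s g + s (E n)" using s g(1) EC unfolding state_def by simp
    moreover have "E k \<sqinter> (g \<oplus> E n) = \<zero>" if "Suc n \<le> k" for k
      using that g EC E(2) by (intro disjoint_plus) simp_all
    ultimately show ?case using g EC by (intro bexI[of _ "g \<oplus> E n"]) simp_all
  qed
  then show ?thesis using s unfolding state_def by metis
qed

end

context complete_mv_alg begin

text \<open>Suppose \<open>s (\<sigma> k) (e k) > \<epsilon>\<close> for all \<open>k\<close> and \<open>\<sigma> k\<close> converges to \<open>l\<close> along a subsequence. Split the subsequence into infinitely many infinite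
  parts. The envelopes \<open>E j\<close> of the parts are disjoint, so \<open>s l (E j) < \<epsilon>\<close> for some \<open>j\<close>, although
  \<open>s (\<sigma> k) (E j) > \<epsilon>\<close> for infinitely many \<open>k\<close>.\<close>

lemma states_uniformly_small:
  fixes Y :: "'y topology"
  assumes Y: "compact_space Y" "metrizable_space Y"
    and s: "\<And>y. y \<in> topspace Y \<Longrightarrow> state (s y)"
    and cont: "\<And>a. a \<in> C \<Longrightarrow> continuous_map Y euclideanreal (\<lambda>y. s y a)"
    and e: "\<And>k::nat. boolean (e k)" "\<And>i j. i \<noteq> j \<Longrightarrow> e i \<sqinter> e j = \<zero>"
    and \<epsilon>: "0 < \<epsilon>"
  shows "\<exists>k. \<forall>y\<in>topspace Y. s y (e k) \<le> \<epsilon>"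
proof (rule ccontr)
  assume "\<not> ?thesis"
  then have "\<forall>k. \<exists>y. y \<in> topspace Y \<and> \<epsilon> < s y (e k)" by (simp add: not_le) blast
  then obtain \<sigma> where \<sigma>: "\<And>k. \<sigma> k \<in> topspace Y" "\<And>k. \<epsilon> < s (\<sigma> k) (e k)" by metis
  have eC: "e k \<in> C" for k using e(1) by (rule boolean_closed)
  have "range \<sigma> \<subseteq> topspace Y" using \<sigma>(1) by auto
  then obtain l r where l: "l \<in> topspace Y" and r: "strict_mono r"
    and lim: "limitin Y (\<sigma> \<circ> r) l sequentially"
    using compact_metrizable_subsequence[OF Y] by metis
  \<comment> \<open>The pairing function splits the range of \<open>r\<close> into infinitely many
    infinite classes.\<close>
  define K where "K j = (\<lambda>i. r (prod_encode (j, i))) ` UNIV" for j :: nat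
  have K_disj: "e k \<sqinter> e k' = \<zero>" if k: "k \<in> K i" "k' \<in> K j" and ij: "i \<noteq> j" for i j k k'
  proof (rule e(2))
    show "k \<noteq> k'"
    proof
      assume "k = k'"
      then obtain a b where "r (prod_encode (i, a)) = r (prod_encode (j, b))"
        using k by (auto simp: K_def)
      then have "prod_encode (i, a) = prod_encode (j, b)"
        using strict_mono_eq[OF r] by blast
      then show False using ij by (simp add: prod_encode_eq)
    qed
  qed
  have "\<exists>E. boolean E \<and> (\<forall>k\<in>K j. e k \<sqsubseteq> E) \<and> (\<forall>z\<in>C. (\<forall>k\<in>K j. e k \<sqinter> z = \<zero>) \<longrightarrow> E \<sqinter> z = \<zero>)" for j
  proof -
    have "e ` K j \<subseteq> C" using eC by auto
    from boolean_envelope[OF this] obtain E where E: "boolean E" "\<And>x. x \<in> e ` K j \<Longrightarrow> x \<sqsubseteq> E"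
      "\<And>z. z \<in> C \<Longrightarrow> (\<And>x. x \<in> e ` K j \<Longrightarrow> x \<sqinter> z = \<zero>) \<Longrightarrow> E \<sqinter> z = \<zero>" by metis
    have "E \<sqinter> z = \<zero>" if "z \<in> C" "\<forall>k\<in>K j. e k \<sqinter> z = \<zero>" for z
      using that by (intro E(3)) auto
    then show ?thesis using E(1,2) by (intro exI[of _ E]) simp
  qed
  then obtain E where E: "\<And>j. boolean (E j)" "\<And>j k. k \<in> K j \<Longrightarrow> e k \<sqsubseteq> E j"
    "\<And>j z. z \<in> C \<Longrightarrow> (\<And>k. k \<in> K j \<Longrightarrow> e k \<sqinter> z = \<zero>) \<Longrightarrow> E j \<sqinter> z = \<zero>" by metis
  have EC: "E j \<in> C" for j using E(1) by (rule boolean_closed)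
  have E_disj: "E i \<sqinter> E j = \<zero>" if ij: "i \<noteq> j" for i j
  proof (rule E(3)[OF EC])
    fix k assume k: "k \<in> K i"
    \<comment> \<open>The annihilator property is used twice: \<open>E j\<close> misses each
      \<open>e k\<close> with \<open>k\<close> in the other class, and then \<open>E i\<close>
      misses \<open>E j\<close>.\<close>
    have "E j \<sqinter> e k = \<zero>" using K_disj[OF _ k] ij by (intro E(3)[OF eC]) auto
    then show "e k \<sqinter> E j = \<zero>" using meet_comm[OF EC eC] by simp
  qed
  have "\<exists>j. s l (E j) < \<epsilon>"
  proof (rule ccontr)
    assume "\<not> ?thesis"
    then have ge: "\<epsilon> \<le> s l (E j)" for j by (simp add: not_less)
    obtain n :: nat where n: "1 < n * \<epsilon>" using reals_Archimedean3[OF \<epsilon>] by blast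
    have "n * \<epsilon> = (\<Sum>j<n. \<epsilon>)" by simp
    also have "\<dots> \<le> (\<Sum>j<n. s l (E j))" using ge by (rule sum_mono)
    also have "\<dots> \<le> 1" by (rule state_disjoint_sum[OF s[OF l] E(1) E_disj])
    finally show False using n by simp
  qed
  then obtain j where j: "s l (E j) < \<epsilon>" by blast
  have "limitin euclideanreal ((\<lambda>y. s y (E j)) \<circ> (\<sigma> \<circ> r)) (s l (E j)) sequentially"
    by (rule continuous_map_limit[OF cont[OF EC] lim])
  then have "(\<lambda>n. s (\<sigma> (r n)) (E j)) \<longlonglongrightarrow> s l (E j)" by (simp add: o_def)
  then have "\<forall>\<^sub>F n in sequentially. s (\<sigma> (r n)) (E j) < \<epsilon>" using j by (rule order_tendstoD(2))
  then obtain n0 where n0: "\<And>n. n0 \<le> n \<Longrightarrow> s (\<sigma> (r n)) (E j) < \<epsilon>"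
    by (auto simp: eventually_sequentially)
  \<comment> \<open>An index in class \<open>j\<close> that is at least \<open>n0\<close>: there
    \<open>s (\<sigma> (r n)) (E j)\<close> is below \<epsilon>, yet it dominates the value at
    \<open>e (r n)\<close>.\<close>
  define n where "n = prod_encode (j, n0)"
  have "n0 \<le> n" unfolding n_def by (rule le_prod_encode_2)
  then have "s (\<sigma> (r n)) (E j) < \<epsilon>" by (rule n0)
  moreover have "s (\<sigma> (r n)) (e (r n)) \<le> s (\<sigma> (r n)) (E j)"
    by (intro state_mono s \<sigma>(1) eC EC E(2)) (simp add: K_def n_def)
  ultimately show False using \<sigma>(2)[of "r n"] by simp
qed

lemma state_family_representation:
  fixes Y :: "'y topology"
  assumes Y: "compact_space Y" "metrizable_space Y"
    and s: "\<And>y. y \<in> topspace Y \<Longrightarrow> state (s y)"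
    and cont: "\<And>a. a \<in> C \<Longrightarrow> continuous_map Y euclideanreal (\<lambda>y. s y a)"
  shows "\<exists>\<mu>. regular_vector_measure (MaxTop M) Y \<mu> \<and>
    (\<forall>a\<in>C. vm_has_integral (MaxTop M) Y \<mu> (mv_star M a) (\<lambda>y. s y a))"
proof -
  \<comment> \<open>Inverse of \<open>supp\<close> on Boolean elements, well defined by
    \<open>supp_inj\<close>.\<close>
  define elt where "elt B = (SOME e. boolean e \<and> supp e = B)" for B
  have elt: "elt (supp e) = e" if "boolean e" for e
    unfolding elt_def using that supp_inj by (intro some_equality) auto
  define \<nu> where "\<nu> y B = s y (elt B)" for y B
  have content: "clopen_content (MaxTop M) clopens (\<nu> y)" if y: "y \<in> topspace Y" for y
  proof (rule clopen_content.intro[OF clopen_base_MaxTop], rule clopen_content_axioms.intro)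
    fix a assume "a \<in> clopens"
    then obtain e where e: "boolean e" "a = supp e" by (auto simp: clopens_def)
    then show "0 \<le> \<nu> y a" using s[OF y] boolean_closed[of e] by (simp add: \<nu>_def elt state_def)
    fix b assume "b \<in> clopens" and ab: "a \<inter> b = {}"
    then obtain f where f: "boolean f" "b = supp f" by (auto simp: clopens_def)
    have "f \<sqsubseteq> neg e" using ab e f by (intro supp_disjoint_imp) auto
    then have "s y (e \<oplus> f) = s y e + s y f"
      using s[OF y] e f boolean_closed unfolding state_def by simp
    then show "\<nu> y (a \<union> b) = \<nu> y a + \<nu> y b"
      using e f elt boolean_plus by (simp add: \<nu>_def flip: supp_plus)
  qed
  define \<mu> where "\<mu> y = clopen_content.extension (MaxTop M) clopens (\<nu> y)" for y
  have em: "emeasure (\<mu> y) (supp e) = ennreal (s y e)" if "y \<in> topspace Y" "boolean e" for y e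
    using clopen_content.emeasure_extension_member[OF content[OF that(1)], of "supp e"] that(2)
    by (simp add: \<mu>_def \<nu>_def elt clopens_def)
  have me: "measure (\<mu> y) (supp e) = s y e" if "y \<in> topspace Y" "boolean e" for y e
    using em[OF that] s[OF that(1)] boolean_closed[OF that(2)] by (simp add: measure_def state_def)
  interpret measure_family "MaxTop M" clopens Y \<mu>
  proof (rule measure_family.intro[OF clopen_base_MaxTop], rule measure_family_axioms.intro)
    show "compact_space Y" by (rule Y(1))
    fix y assume y: "y \<in> topspace Y"
    show "sets (\<mu> y) = borel_sets (MaxTop M)" "space (\<mu> y) = topspace (MaxTop M)"
      unfolding \<mu>_def
      by (rule clopen_content.sets_extension[OF content[OF y]], rule clopen_content.space_extension[OF content[OF y]])
    have "boolean \<one>" by (simp add: boolean_def)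
    then show "emeasure (\<mu> y) (topspace (MaxTop M)) = 1"
      using em[OF y, of \<one>] s[OF y] by (simp add: supp_one state_def)
    show "\<exists>a\<in>clopens. a \<subseteq> U \<and> c < emeasure (\<mu> y) a"
      if "openin (MaxTop M) U" "c < emeasure (\<mu> y) U" for U c
      using clopen_content.emeasure_extension_open_gt[OF content[OF y]] that unfolding \<mu>_def by simp
  next
    fix a assume "a \<in> clopens"
    then obtain e where e: "boolean e" "a = supp e" by (auto simp: clopens_def)
    show "continuous_map Y euclideanreal (\<lambda>y. measure (\<mu> y) a)"
      by (rule continuous_map_eq[OF cont[OF boolean_closed[OF e(1)]]]) (simp add: me e)
  next
    fix D :: "nat \<Rightarrow> 'a set set" and \<epsilon> :: real
    assume D: "range D \<subseteq> clopens" "disjoint_family D" and \<epsilon>: "0 < \<epsilon>"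
    have "\<exists>e. boolean e \<and> D k = supp e" for k using D(1) by (auto simp: clopens_def)
    then obtain e where e: "\<And>k. boolean (e k)" "\<And>k. D k = supp (e k)" by metis
    have "e i \<sqinter> e j = \<zero>" if "i \<noteq> j" for i j
      using D(2) that e by (simp add: disjoint_family_on_def flip: supp_disjoint_iff)
    then obtain k where "\<forall>y\<in>topspace Y. s y (e k) \<le> \<epsilon>"
      using states_uniformly_small[of Y s e, OF Y s cont e(1) _ \<epsilon>] by auto
    then show "\<exists>k. \<forall>y\<in>topspace Y. measure (\<mu> y) (D k) \<le> \<epsilon>"
      by (intro exI[of _ k]) (simp add: e me)
  qed
  have "vm_has_integral (MaxTop M) Y (\<lambda>B y. measure (\<mu> y) B) (mv_star M a) (\<lambda>y. s y a)" if a: "a \<in> C" for a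
  proof -
    have "\<exists>e A. (\<forall>i. boolean (e i)) \<and> (\<forall>n. A n \<in> C) \<and>
        (\<forall>s n. state s \<longrightarrow> s a = (\<Sum>i<n. 1 / 2 ^ Suc i * s (e i)) + s (A n) / 2 ^ n)"
      by (rule binary_expansion[OF a]) blast
    then obtain e :: "nat \<Rightarrow> 'a" and A where e: "\<And>i. boolean (e i)" and A: "\<And>n. A n \<in> C"
      and exp: "\<And>s n. state s \<Longrightarrow> s a = (\<Sum>i<n. 1 / 2 ^ Suc i * s (e i)) + s (A n) / 2 ^ n"
      by blast
    \<comment> \<open>Used twice below: with evaluation at \<open>m\<close> for the simple
      functions, and with \<open>s y\<close> for their integrals.\<close>
    have close: "\<bar>(\<Sum>i<n. 1 / 2 ^ Suc i * s (e i)) - s a\<bar> \<le> 1 / 2 ^ n" if "state s" for s n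
      using exp[OF that, of n] that A[of n] by (simp add: state_def divide_right_mono)
    have borel: "supp (e i) \<in> borel_sets (MaxTop M)" for i
      using e by (intro member_borel) (simp add: clopens_def)
    have "\<exists>t. simple_repr (MaxTop M) t \<and>
        (\<forall>m\<in>MaxSp M. \<bar>simple_fun t m - mv_star M a m\<bar> \<le> 1 / 2 ^ n) \<and>
        (\<forall>y\<in>topspace Y. \<bar>simple_integral (\<lambda>B y. measure (\<mu> y) B) t y - s y a\<bar> \<le> 1 / 2 ^ n)" for n
    proof (rule simple_repr_sum[OF borel, where n = n and c = "\<lambda>i. 1 / 2 ^ Suc i"])
      fix t assume t: "simple_repr (MaxTop M) t"
        "\<And>m. m \<in> topspace (MaxTop M) \<Longrightarrow> simple_fun t m = (\<Sum>i<n. 1 / 2 ^ Suc i * indicator (supp (e i)) m)"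
        "\<And>y. y \<in> topspace Y \<Longrightarrow> simple_integral (\<lambda>B y. measure (\<mu> y) B) t y
          = (\<Sum>i<n. 1 / 2 ^ Suc i * measure (\<mu> y) (supp (e i)))"
      have "\<bar>simple_fun t m - mv_star M a m\<bar> \<le> 1 / 2 ^ n" if m: "m \<in> MaxSp M" for m
        using close[OF state_star[OF m], of n] t(2)[of m] m by (simp add: star_boolean[OF e m])
      moreover have "\<bar>simple_integral (\<lambda>B y. measure (\<mu> y) B) t y - s y a\<bar> \<le> 1 / 2 ^ n"
        if y: "y \<in> topspace Y" for y
        using close[OF s[OF y], of n] t(3)[OF y] by (simp add: me[OF y e])
      ultimately show "\<exists>t. simple_repr (MaxTop M) t \<and>
        (\<forall>m\<in>MaxSp M. \<bar>simple_fun t m - mv_star M a m\<bar> \<le> 1 / 2 ^ n) \<and>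
        (\<forall>y\<in>topspace Y. \<bar>simple_integral (\<lambda>B y. measure (\<mu> y) B) t y - s y a\<bar> \<le> 1 / 2 ^ n)"
        using t(1) by (intro exI[of _ t]) simp
    qed
    then obtain t where t: "\<And>n. simple_repr (MaxTop M) (t n)"
      "\<And>n m. m \<in> MaxSp M \<Longrightarrow> \<bar>simple_fun (t n) m - mv_star M a m\<bar> \<le> 1 / 2 ^ n"
      "\<And>n y. y \<in> topspace Y \<Longrightarrow> \<bar>simple_integral (\<lambda>B y. measure (\<mu> y) B) (t n) y - s y a\<bar> \<le> 1 / 2 ^ n"
      by metis
    have small: "\<exists>n0. \<forall>n\<ge>n0. 1 / 2 ^ n \<le> \<epsilon>" if "0 < \<epsilon>" for \<epsilon> :: real
    proof -
      have "(\<lambda>n. 1 / 2 ^ n :: real) \<longlonglongrightarrow> 0" by (rule LIMSEQ_divide_realpow_zero) simp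
      then have "\<forall>\<^sub>F n in sequentially. 1 / 2 ^ n < \<epsilon>" using that by (rule order_tendstoD(2))
      then show ?thesis by (auto simp: eventually_sequentially intro: less_imp_le)
    qed
    show ?thesis
    proof (rule vm_has_integralI[OF t(1)])
      show "unif_conv (MaxTop M) (\<lambda>n. simple_fun (t n)) (mv_star M a)"
        unfolding unif_conv_def topspace_MaxTop using small t(2) by (meson order_trans)
      show "unif_conv Y (\<lambda>n. simple_integral (\<lambda>B y. measure (\<mu> y) B) (t n)) (\<lambda>y. s y a)"
        unfolding unif_conv_def using small t(3) by (meson order_trans)
    qed
  qed
  then show ?thesis using regular_vector_measure_\<mu> by blast
qed

end

theorem theorem3p15:
  fixes M :: "'a mv_algebra" and N :: "'b mv_algebra" and p :: "'a \<Rightarrow> 'b"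
  assumes "mv_algebra M" and "mv_complete M"
    and "mv_algebra N" and "mv_semisimple N"
    and "metrizable_space (MaxTop N)"
    and "probability_map M N p"
  shows "\<exists>\<mu>. regular_vector_measure (MaxTop M) (MaxTop N) \<mu> \<and>
           (\<forall>a\<in>mv_carrier M.
              vm_has_integral (MaxTop M) (MaxTop N) \<mu> (mv_star M a) (mv_star N (p a)))"
proof -
  interpret M: complete_mv_alg M by (simp add: complete_mv_alg_def complete_mv_alg_axioms_def mv_alg_def assms)
  interpret N: mv_alg N by (simp add: mv_alg_def assms)
  have p: "p a \<in> mv_carrier N" if "a \<in> mv_carrier M" for a
    using assms(6) that by (auto simp: probability_map_def)
  show ?thesis
  proof (rule M.state_family_representation[OF N.compact_MaxTop assms(5)])
    show "M.state (\<lambda>a. mv_star N (p a) y)" if "y \<in> topspace (MaxTop N)" for y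
      using that M.probability_map_state[OF N.mv_alg_axioms assms(6)] by simp
    show "continuous_map (MaxTop N) euclideanreal (mv_star N (p a))" if "a \<in> mv_carrier M" for a
      using that by (intro N.continuous_star metrizable_imp_Hausdorff_space assms(5) p)
  qed
qed

end
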